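(* Let $m\ge2$ and $p=2$. For every Pieri Schubert data $\alpha^\bullet$ for $\mathrm{Grass}(2,m+2)$ in which one of the conditions is $J_{m-1}=(1,m+1)$, the property $\mathrm{SG}(m,2;\alpha^\bullet)$ holds.
   Context: Let $n=m+2$. $\mathrm{Grass}(2,n)$ is the Grassmannian of complex 2-planes in $\mathbb C^n$; a complete flag $K_\bullet$ is a chain $K_1\subset\cdots\subset K_n=\mathbb C^n$, $\dim K_i=i$. A Schubert condition is $\alpha=(\alpha_1<\alpha_2)\subset\{1,\dots,n\}$, $|\alpha|=(\alpha_1-1)+(\alpha_2-2)$, and $\Omega_\alpha K_\bullet=\{X:\dim(X\cap K_{n+1-\alpha_1})\ge2,\ \dim(X\cap K_{n+1-\alpha_2})\ge1\}$. Schubert data: a sequence $(\alpha^1,\dots,\alpha^k)$ with $\sum_j|\alpha^j|=2m$; $d(m,2;\alpha^\bullet)$ is the number of points in $\bigcap_j\Omega_{\alpha^j}F^j_\bullet$ for flags in general position. $K_\bullet(s)$ ($s\in\mathbb C$) is the flag with $K_i(s)$ the row span of the first $i$ rows of the $n\times n$ matrix with $(i,j)$ entry $\binom{j-1}{i-1}s^{j-i}$. Property $\mathrm{SG}(m,2;\alpha^\bullet)$: there is a nonzero real polynomial $f$ in $k$ variables such that for all distinct reals $s_1,\dots,s_k$ with $f(s_1,\dots,s_k)\ne0$, $\bigcap_j\Omega_{\alpha^j}K_\bullet(s_j)$ consists of exactly $d(m,2;\alpha^\bullet)$ points, all real. Pieri conditions: $J_a=(1,1+a)$, $1\le a\le m$;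 Pieri Schubert data: Schubert data in which at most two conditions are not Pieri conditions. *)

theory Defs
  imports Complex_Main
begin

text \<open>Vectors of C^n are functions nat => complex vanishing at indices >= n
  (coordinates are 0-based: index j corresponds to coordinate j+1).\<close>

definition cvec :: "nat \<Rightarrow> (nat \<Rightarrow> complex) set" where
  "cvec n = {v. \<forall>i\<ge>n. v i = 0}"

definition lin_indep :: "(nat \<Rightarrow> complex) list \<Rightarrow> bool" where
  "lin_indep vs \<longleftrightarrow>
     (\<forall>c::nat \<Rightarrow> complex. (\<forall>j. (\<Sum>i<length vs. c i * (vs!i) j) = 0) \<longrightarrow> (\<forall>i<length vs. c i = 0))"

definition cspan :: "(nat \<Rightarrow> complex) list \<Rightarrow> (nat \<Rightarrow> complex) set" where
  "cspan vs = {w. \<exists>c::nat \<Rightarrow> complex. \<forall>j. w j = (\<Sum>i<length vs. c i * (vs!i) j)}"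

definition dim_ge :: "(nat \<Rightarrow> complex) set \<Rightarrow> nat \<Rightarrow> bool" where
  "dim_ge S d \<longleftrightarrow> (\<exists>vs. length vs = d \<and> set vs \<subseteq> S \<and> lin_indep vs)"

definition grass2 :: "nat \<Rightarrow> (nat \<Rightarrow> complex) set set" where
  "grass2 n = {X. \<exists>u v. u \<in> cvec n \<and> v \<in> cvec n \<and> lin_indep [u, v] \<and> X = cspan [u, v]}"

text \<open>A complete flag is given by an invertible n x n matrix M (rows 0..n-1):
  K_i is the span of the first i rows.\<close>
definition mrow :: "nat \<Rightarrow> (nat \<Rightarrow> nat \<Rightarrow> complex) \<Rightarrow> nat \<Rightarrow> (nat \<Rightarrow> complex)" where
  "mrow n M r = (\<lambda>j. if j < n then M r j else 0)"

definition invertible_mat :: "nat \<Rightarrow> (nat \<Rightarrow> nat \<Rightarrow> complex) \<Rightarrow> bool" where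
  "invertible_mat n M \<longleftrightarrow> lin_indep (map (mrow n M) [0..<n])"

definition flag_space :: "nat \<Rightarrow> (nat \<Rightarrow> nat \<Rightarrow> complex) \<Rightarrow> nat \<Rightarrow> (nat \<Rightarrow> complex) set" where
  "flag_space n M i = cspan (map (mrow n M) [0..<i])"

definition schubert_cond :: "nat \<Rightarrow> nat \<times> nat \<Rightarrow> bool" where
  "schubert_cond n a \<longleftrightarrow> 1 \<le> fst a \<and> fst a < snd a \<and> snd a \<le> n"

definition cond_size :: "nat \<times> nat \<Rightarrow> nat" where
  "cond_size a = (fst a - 1) + (snd a - 2)"

definition schubert_var :: "nat \<Rightarrow> nat \<times> nat \<Rightarrow> (nat \<Rightarrow> nat \<Rightarrow> complex) \<Rightarrow> (nat \<Rightarrow> complex) set set" where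
  "schubert_var n a M = {X \<in> grass2 n.
      dim_ge (X \<inter> flag_space n M (n + 1 - fst a)) 2 \<and>
      dim_ge (X \<inter> flag_space n M (n + 1 - snd a)) 1}"

definition schubert_data :: "nat \<Rightarrow> (nat \<times> nat) list \<Rightarrow> bool" where
  "schubert_data m as \<longleftrightarrow> (\<forall>a \<in> set as. schubert_cond (m + 2) a) \<and> (\<Sum>a\<leftarrow>as. cond_size a) = 2 * m"

definition schubert_inter :: "nat \<Rightarrow> (nat \<times> nat) list \<Rightarrow> (nat \<Rightarrow> nat \<Rightarrow> nat \<Rightarrow> complex) \<Rightarrow> (nat \<Rightarrow> complex) set set" where
  "schubert_inter n as Ms = grass2 n \<inter> (\<Inter>j<length as. schubert_var n (as!j) (Ms j))"

text \<open>Polynomial functions in N variables (a nonzero polynomial over an infinite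
  field is the same as a polynomial function that is not identically zero).\<close>
definition poly_fun :: "nat \<Rightarrow> ((nat \<Rightarrow> 'a::comm_ring_1) \<Rightarrow> 'a) \<Rightarrow> bool" where
  "poly_fun N g \<longleftrightarrow> (\<exists>E c. finite E \<and> (\<forall>e\<in>E. \<forall>i\<ge>N. e i = (0::nat)) \<and>
      (\<forall>x. g x = (\<Sum>e\<in>E. c e * (\<Prod>i<N. x i ^ e i))))"

definition mat_vars :: "nat \<Rightarrow> (nat \<Rightarrow> nat \<Rightarrow> nat \<Rightarrow> complex) \<Rightarrow> nat \<Rightarrow> complex" where
  "mat_vars n Ms = (\<lambda>v. Ms (v div (n * n)) ((v mod (n * n)) div n) (v mod n))"

text \<open>c is the number of points of the intersection for flags in general position:
  there is a nonempty Zariski open set of tuples of flags (given by a nonzero polynomial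
  in the entries of the defining matrices) on which the intersection has exactly c points.\<close>
definition generic_count :: "nat \<Rightarrow> (nat \<times> nat) list \<Rightarrow> nat \<Rightarrow> bool" where
  "generic_count n as c \<longleftrightarrow>
     (\<exists>g. poly_fun (length as * n * n) g \<and> (\<exists>x. g x \<noteq> 0) \<and>
        (\<forall>Ms. (\<forall>j<length as. invertible_mat n (Ms j)) \<and> g (mat_vars n Ms) \<noteq> 0 \<longrightarrow>
               finite (schubert_inter n as Ms) \<and> card (schubert_inter n as Ms) = c))"

definition d_num :: "nat \<Rightarrow> (nat \<times> nat) list \<Rightarrow> nat" where
  "d_num m as = (THE c. generic_count (m + 2) as c)"

text \<open>Osculating flag K(s): entry (i,j) (1-based) is binom(j-1,i-1) s^(j-i); 0-based below.\<close>
definition osc_mat :: "real \<Rightarrow> nat \<Rightarrow> nat \<Rightarrow> complex" where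
  "osc_mat s i j = complex_of_real (real (j choose i) * s ^ (j - i))"

definition real_point :: "(nat \<Rightarrow> complex) set \<Rightarrow> bool" where
  "real_point X \<longleftrightarrow> (\<exists>u v. (\<forall>j. u j \<in> \<real>) \<and> (\<forall>j. v j \<in> \<real>) \<and> X = cspan [u, v])"

definition SG :: "nat \<Rightarrow> (nat \<times> nat) list \<Rightarrow> bool" where
  "SG m as \<longleftrightarrow>
     (\<exists>f::(nat \<Rightarrow> real) \<Rightarrow> real. poly_fun (length as) f \<and> (\<exists>x. f x \<noteq> 0) \<and>
        (\<forall>s::nat \<Rightarrow> real. inj_on s {..<length as} \<and> f s \<noteq> 0 \<longrightarrow>
           (let I = schubert_inter (m + 2) as (\<lambda>j. osc_mat (s j)) in
             finite I \<and> card I = d_num m as \<and> (\<forall>X\<in>I. real_point X))))"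

definition pieri_cond :: "nat \<Rightarrow> nat \<times> nat \<Rightarrow> bool" where
  "pieri_cond m a \<longleftrightarrow> (\<exists>b. 1 \<le> b \<and> b \<le> m \<and> a = (1, 1 + b))"

definition pieri_data :: "nat \<Rightarrow> (nat \<times> nat) list \<Rightarrow> bool" where
  "pieri_data m as \<longleftrightarrow> schubert_data m as \<and>
     card {j. j < length as \<and> \<not> pieri_cond m (as!j)} \<le> 2"

end

theory Submission
  imports Defs "Jordan_Normal_Form.Char_Poly"
begin

text \<open>
  Let \<open>L\<close> be the 2-dimensional space \<open>K\<^sub>2\<close> of the flag carrying the condition \<open>(1, m + 1)\<close>; every
  solution \<open>X\<close> contains a vector \<open>y\<close> of \<open>L\<close>.  If the other conditions force \<open>X\<close> into a subspace of
  codimension at least 2, that subspace misses \<open>L\<close> and there is no solution.  If they force \<open>X\<close> into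
  a hyperplane, \<open>y\<close> is determined up to scaling and the remaining conditions on \<open>X / y\<close> are linear, with
  exactly one solution.  Otherwise \<open>y\<close> moves in a pencil \<open>f + t e\<close>, and solutions correspond to the
  roots \<open>t\<close> of a determinant of degree \<open>r - 1\<close>, where \<open>r\<close> is the number of remaining conditions of
  positive codimension.  General position means that certain square linear systems are
  nonsingular and that this determinant has simple roots; these are polynomial conditions on the flags.

  Osculating flags at distinct real points always satisfy these conditions.  Identify vectors with
  polynomials, \<open>K\<^sub>d(s)\<close> being the multiples of \<open>(z - s)\<close> to the codimension of \<open>K\<^sub>d\<close>, and move the
  point of the special condition to infinity.  Then \<open>X\<close> contains a linear polynomial \<open>w - \<tau>\<close>, and its
  Wronskian is \<open>Q = \<Prod>(w - w\<^sub>i)\<close> to the powers given by the codimensions.  A second generator exists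
  iff \<open>Q / (w - \<tau>)\<^sup>2\<close> has no residue at \<open>\<tau>\<close>, that is \<open>Q'(\<tau>) = 0\<close>, and by Rolle's theorem \<open>Q'\<close> has
  \<open>r - 1\<close> distinct real zeros between the \<open>w\<^sub>i\<close>.
\<close>

subsection \<open>Polynomial functions\<close>

text \<open>Nothing is known about \<open>d_num\<close> beforehand, so the generic number has to
  come out together with the real solutions. Each case supplies one polynomial \<open>g\<close> in
  the matrix entries such that all flags with \<open>g\<close> nonzero have exactly the same number
  of solutions; as nonempty Zariski open sets meet, that number is \<open>d_num\<close>. Since
  \<open>g\<close> vanishes at no osculating tuple with distinct parameters, such flags are
  themselves in general position, and the polynomial demanded by \<open>SG\<close> can be the
  constant 1. This is why general position is always phrased as nonsingularity of a square linear
  system: it is polynomial in the entries, and for osculating flags it can be checked with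
  polynomials of one variable. In the pencil case the determinant has degree r - 1 and Rolle's
  theorem produces as many roots, hence they are simple. Simplicity matters twice: a two-dimensional
  kernel would be a double root, so each y lies on only one solution, and a one-dimensional kernel
  of a real system has a real generator, so that solution is real.\<close>

lemma poly_funI:
  fixes e :: "'i \<Rightarrow> nat \<Rightarrow> nat"
  assumes "finite I" and "\<And>i j. i \<in> I \<Longrightarrow> j \<ge> N \<Longrightarrow> e i j = 0"
    and "\<And>x. g x = (\<Sum>i\<in>I. c i * (\<Prod>j<N. x j ^ e i j))"
  shows "poly_fun N g"
  unfolding poly_fun_def
proof (intro exI conjI allI)
  show "finite (e ` I)" using assms(1) by simp
  show "\<forall>f\<in>e ` I. \<forall>i\<ge>N. f i = 0" using assms(2) by auto
  fix x :: "nat \<Rightarrow> 'a"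
  \<comment> \<open>Different indices may carry the same exponent, whereas \<open>poly_fun\<close>
    wants a set of exponents: the terms in each fibre of \<open>e\<close> are merged.\<close>
  have "g x = (\<Sum>f\<in>e ` I. \<Sum>i\<in>{i\<in>I. e i = f}. c i * (\<Prod>j<N. x j ^ e i j))"
    unfolding assms(3) using assms(1) by (rule sum.image_gen)
  also have "\<dots> = (\<Sum>f\<in>e ` I. (\<Sum>i\<in>{i\<in>I. e i = f}. c i) * (\<Prod>j<N. x j ^ f j))"
    by (intro sum.cong refl) (simp add: sum_distrib_right)
  finally show "g x = (\<Sum>f\<in>e ` I. (\<Sum>i\<in>{i\<in>I. e i = f}. c i) * (\<Prod>j<N. x j ^ f j))" .
qed

lemma poly_fun_const: "poly_fun N (\<lambda>_. a)"
  by (rule poly_funI[of "{()}" N "\<lambda>_ _. 0" _ "\<lambda>_. a"]) auto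

lemma poly_fun_var:
  assumes "i < N" shows "poly_fun N (\<lambda>x. x i)"
proof (rule poly_funI[of "{()}" N "\<lambda>_ j. if j = i then 1 else 0" _ "\<lambda>_. 1"])
  fix x :: "nat \<Rightarrow> 'a"
  have "(\<Prod>j<N. x j ^ (if j = i then 1 else 0)) = (\<Prod>j<N. if j = i then x j else 1)"
    by (intro prod.cong) auto
  also have "\<dots> = x i" using assms by (simp add: prod.delta)
  finally show "x i = (\<Sum>_\<in>{()}. 1 * (\<Prod>j<N. x j ^ (if j = i then 1 else 0)))" by simp
qed (use assms in auto)

lemma poly_fun_add:
  assumes "poly_fun N g" "poly_fun N h" shows "poly_fun N (\<lambda>x. g x + h x)"
proof -
  obtain E c where E: "finite E" "\<forall>e\<in>E. \<forall>i\<ge>N. e i = 0"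
    "\<And>x. g x = (\<Sum>e\<in>E. c e * (\<Prod>i<N. x i ^ e i))"
    using assms(1) unfolding poly_fun_def by blast
  obtain F d where F: "finite F" "\<forall>e\<in>F. \<forall>i\<ge>N. e i = 0"
    "\<And>x. h x = (\<Sum>e\<in>F. d e * (\<Prod>i<N. x i ^ e i))"
    using assms(2) unfolding poly_fun_def by blast
  show ?thesis
    by (rule poly_funI[of "E <+> F" N "case_sum id id" _ "case_sum c d"])
      (use E F in \<open>auto simp: sum.Plus split: sum.splits\<close>)
qed

lemma poly_fun_mult:
  assumes "poly_fun N g" "poly_fun N h" shows "poly_fun N (\<lambda>x. g x * h x)"
proof -
  obtain E c where E: "finite E" "\<forall>e\<in>E. \<forall>i\<ge>N. e i = 0"
    "\<And>x. g x = (\<Sum>e\<in>E. c e * (\<Prod>i<N. x i ^ e i))"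
    using assms(1) unfolding poly_fun_def by blast
  obtain F d where F: "finite F" "\<forall>e\<in>F. \<forall>i\<ge>N. e i = 0"
    "\<And>x. h x = (\<Sum>e\<in>F. d e * (\<Prod>i<N. x i ^ e i))"
    using assms(2) unfolding poly_fun_def by blast
  show ?thesis
  proof (rule poly_funI[of "E \<times> F" N "\<lambda>(e, f) i. e i + f i" _ "\<lambda>(e, f). c e * d f"])
    fix x
    show "g x * h x = (\<Sum>i\<in>E \<times> F. (case i of (e, f) \<Rightarrow> c e * d f) *
        (\<Prod>j<N. x j ^ (case i of (e, f) \<Rightarrow> \<lambda>i. e i + f i) j))"
      unfolding E(3) F(3) sum_product sum.cartesian_product
      by (intro sum.cong refl) (auto simp: power_add prod.distrib algebra_simps)
  qed (use E F in auto)
qed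

lemma poly_fun_sum:
  assumes "\<And>i. i \<in> I \<Longrightarrow> poly_fun N (g i)" shows "poly_fun N (\<lambda>x. \<Sum>i\<in>I. g i x)"
proof (cases "finite I")
  case True
  then show ?thesis using assms
    by (induction I rule: finite_induct) (auto intro: poly_fun_const poly_fun_add)
qed (simp add: poly_fun_const)

lemma poly_fun_prod:
  assumes "\<And>i. i \<in> I \<Longrightarrow> poly_fun N (g i)" shows "poly_fun N (\<lambda>x. \<Prod>i\<in>I. g i x)"
proof (cases "finite I")
  case True
  then show ?thesis using assms
    by (induction I rule: finite_induct) (auto intro: poly_fun_const poly_fun_mult)
qed (simp add: poly_fun_const)

lemma poly_fun_uminus: "poly_fun N g \<Longrightarrow> poly_fun N (\<lambda>x. - g x)"
  using poly_fun_mult[OF poly_fun_const[of N "-1"], of g] by simp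

lemma poly_fun_on_line:
  fixes g :: "(nat \<Rightarrow> 'a::comm_ring_1) \<Rightarrow> 'a"
  assumes "poly_fun N g"
  obtains P where "\<And>\<tau>. g (\<lambda>i. x i + \<tau> * y i) = poly P \<tau>"
proof -
  obtain E c where E: "\<And>x. g x = (\<Sum>e\<in>E. c e * (\<Prod>i<N. x i ^ e i))"
    using assms unfolding poly_fun_def by blast
  show ?thesis
    by (rule that[of "\<Sum>e\<in>E. [:c e:] * (\<Prod>i<N. [:x i, y i:] ^ e i)"])
      (simp add: E poly_sum poly_prod)
qed

text \<open>Nonempty Zariski open sets meet: on the line from \<open>x\<close> to \<open>y\<close>
  both functions become univariate polynomials, nonzero at the parameters 0 and 1 respectively, so
  all but finitely many parameters serve.\<close>

lemma poly_fun_common_nonzero: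
  fixes g h :: "(nat \<Rightarrow> complex) \<Rightarrow> complex"
  assumes "poly_fun N g" "poly_fun N h" "g x \<noteq> 0" "h y \<noteq> 0"
  obtains z where "g z \<noteq> 0" "h z \<noteq> 0"
proof -
  obtain P where P: "\<And>\<tau>. g (\<lambda>i. x i + \<tau> * (y i - x i)) = poly P \<tau>"
    using poly_fun_on_line[OF assms(1), of x "\<lambda>i. y i - x i"] by metis
  obtain Q where Q: "\<And>\<tau>. h (\<lambda>i. x i + \<tau> * (y i - x i)) = poly Q \<tau>"
    using poly_fun_on_line[OF assms(2), of x "\<lambda>i. y i - x i"] by metis
  have "P \<noteq> 0" using P[of 0] assms(3) by auto
  moreover have "Q \<noteq> 0" using Q[of 1] assms(4) by auto
  ultimately have "P * Q \<noteq> 0" by simp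
  then have "finite {\<tau>. poly (P * Q) \<tau> = 0}" by (rule poly_roots_finite)
  then obtain \<tau> where "poly (P * Q) \<tau> \<noteq> 0"
    using ex_new_if_finite[OF infinite_UNIV_char_0] by blast
  then have "g (\<lambda>i. x i + \<tau> * (y i - x i)) \<noteq> 0" "h (\<lambda>i. x i + \<tau> * (y i - x i)) \<noteq> 0"
    unfolding P Q by auto
  then show thesis by (rule that)
qed

subsection \<open>Determinants of parametrised linear systems\<close>

text \<open>The bounds \<open>d i\<close> need not be attained: the second claim concerns the
  coefficient at the sum of the bounds, which may be 0. This is how the top coefficient of a
  determinant is read off from columns of bounded degree.\<close>

lemma degree_prod_bound:
  assumes "finite I" "\<And>i. i \<in> I \<Longrightarrow> degree (f i) \<le> d i"
  shows "degree (\<Prod>i\<in>I. f i) \<le> (\<Sum>i\<in>I. d i)"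
    and "coeff (\<Prod>i\<in>I. f i) (\<Sum>i\<in>I. d i) = (\<Prod>i\<in>I. coeff (f i) (d i))"
proof -
  have "degree (\<Prod>i\<in>I. f i) \<le> (\<Sum>i\<in>I. d i) \<and>
      coeff (\<Prod>i\<in>I. f i) (\<Sum>i\<in>I. d i) = (\<Prod>i\<in>I. coeff (f i) (d i))"
    using assms
  proof (induction I rule: finite_induct)
    case (insert a I)
    let ?p = "\<Prod>i\<in>I. f i" and ?s = "\<Sum>i\<in>I. d i"
    have IH: "degree ?p \<le> ?s" "coeff ?p ?s = (\<Prod>i\<in>I. coeff (f i) (d i))"
      using insert by auto
    have da: "degree (f a) \<le> d a" using insert by auto
    have "coeff (f a * ?p) (d a + ?s) = (\<Sum>i\<le>d a + ?s. coeff (f a) i * coeff ?p (d a + ?s - i))"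
      by (simp add: coeff_mult)
    also have "\<dots> = (\<Sum>i\<in>{d a}. coeff (f a) i * coeff ?p (d a + ?s - i))"
    proof (rule sum.mono_neutral_right)
      show "\<forall>i\<in>{..d a + ?s} - {d a}. coeff (f a) i * coeff ?p (d a + ?s - i) = 0"
      proof
        fix i assume i: "i \<in> {..d a + ?s} - {d a}"
        show "coeff (f a) i * coeff ?p (d a + ?s - i) = 0"
        proof (cases "i < d a")
          case True
          then have "degree ?p < d a + ?s - i" using IH(1) by linarith
          then show ?thesis by (simp add: coeff_eq_0)
        next
          case False
          then have "degree (f a) < i" using i da by auto
          then show ?thesis by (simp add: coeff_eq_0)
        qed
      qed
    qed auto
    finally have "coeff (f a * ?p) (d a + ?s) = coeff (f a) (d a) * coeff ?p ?s" by simp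
    moreover have "degree (f a * ?p) \<le> d a + ?s"
      using degree_mult_le[of "f a" ?p] IH(1) da by linarith
    ultimately show ?case using insert(1,2) IH(2) by simp
  qed simp
  then show "degree (\<Prod>i\<in>I. f i) \<le> (\<Sum>i\<in>I. d i)"
    and "coeff (\<Prod>i\<in>I. f i) (\<Sum>i\<in>I. d i) = (\<Prod>i\<in>I. coeff (f i) (d i))" by auto
qed

text \<open>Equations and unknowns are indexed by arbitrary sets because the unknowns below are
  pairs. Matrices need ranges \<open>{0..<N}\<close>; \<open>det_zero_iff_kernel\<close> passes
  between the two by enumerations.\<close>

definition in_kernel :: "'e set \<Rightarrow> 'c set \<Rightarrow> ('e \<Rightarrow> 'c \<Rightarrow> 'a::comm_ring_1) \<Rightarrow> ('c \<Rightarrow> 'a) \<Rightarrow> bool" where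
  "in_kernel E C A v \<longleftrightarrow> (\<forall>e\<in>E. (\<Sum>c\<in>C. A e c * v c) = 0)"

definition trivial_kernel :: "'e set \<Rightarrow> 'c set \<Rightarrow> ('e \<Rightarrow> 'c \<Rightarrow> 'a::comm_ring_1) \<Rightarrow> bool" where
  "trivial_kernel E C A \<longleftrightarrow> (\<forall>v. in_kernel E C A v \<longrightarrow> (\<forall>c\<in>C. v c = 0))"

lemma det_zero_iff_kernel:
  fixes A :: "'e \<Rightarrow> 'c \<Rightarrow> 'a::field"
  assumes \<phi>: "bij_betw \<phi> {0..<N} E" and \<psi>: "bij_betw \<psi> {0..<N} C"
  shows "det (mat N N (\<lambda>(i, j). A (\<phi> i) (\<psi> j))) = 0 \<longleftrightarrow> \<not> trivial_kernel E C A"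
proof -
  let ?M = "mat N N (\<lambda>(i, j). A (\<phi> i) (\<psi> j))"
  have sumC: "(\<Sum>c\<in>C. F c) = (\<Sum>j = 0..<N. F (\<psi> j))" for F :: "'c \<Rightarrow> 'a"
    using sum.reindex_bij_betw[OF \<psi>, of F] by simp
  have key: "?M *\<^sub>v v = 0\<^sub>v N \<longleftrightarrow> (\<forall>e\<in>E. (\<Sum>j = 0..<N. A e (\<psi> j) * v $ j) = 0)"
    if v: "v \<in> carrier_vec N" for v
  proof -
    have "?M *\<^sub>v v = 0\<^sub>v N \<longleftrightarrow> (\<forall>i<N. (\<Sum>j = 0..<N. A (\<phi> i) (\<psi> j) * v $ j) = 0)"
      using v by (auto simp: vec_eq_iff scalar_prod_def)
    also have "\<dots> \<longleftrightarrow> (\<forall>e\<in>E. (\<Sum>j = 0..<N. A e (\<psi> j) * v $ j) = 0)"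
      using \<phi> by (force simp: bij_betw_def)
    finally show ?thesis .
  qed
  have "det ?M = 0 \<longleftrightarrow> (\<exists>v. v \<in> carrier_vec N \<and> v \<noteq> 0\<^sub>v N \<and> ?M *\<^sub>v v = 0\<^sub>v N)"
    by (rule det_0_iff_vec_prod_zero_field) simp
  also have "\<dots> \<longleftrightarrow> \<not> trivial_kernel E C A"
  proof
    assume "\<exists>v. v \<in> carrier_vec N \<and> v \<noteq> 0\<^sub>v N \<and> ?M *\<^sub>v v = 0\<^sub>v N"
    then obtain v where v: "v \<in> carrier_vec N" "v \<noteq> 0\<^sub>v N" "?M *\<^sub>v v = 0\<^sub>v N" by blast
    from v(1,2) obtain j where j: "j < N" "v $ j \<noteq> 0" by (auto simp: vec_eq_iff)
    define w where "w c = v $ (the_inv_into {0..<N} \<psi> c)" for c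
    have w: "w (\<psi> j) = v $ j" if "j < N" for j
      using \<psi> that by (simp add: w_def bij_betw_def the_inv_into_f_f)
    have "in_kernel E C A w"
      unfolding in_kernel_def sumC using v(3) key[OF v(1)] by (simp add: w)
    moreover have "w (\<psi> j) \<noteq> 0" "\<psi> j \<in> C" using j w \<psi> by (auto simp: bij_betw_def)
    ultimately show "\<not> trivial_kernel E C A" unfolding trivial_kernel_def by blast
  next
    assume "\<not> trivial_kernel E C A"
    then obtain w c where w: "in_kernel E C A w" "c \<in> C" "w c \<noteq> 0"
      unfolding trivial_kernel_def by blast
    from w(2) obtain j where j: "j < N" "c = \<psi> j" using \<psi> by (auto simp: bij_betw_def)
    let ?v = "vec N (\<lambda>j. w (\<psi> j))"
    have "?v \<noteq> 0\<^sub>v N" using j w(3) by (auto simp: vec_eq_iff)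
    moreover have "?M *\<^sub>v ?v = 0\<^sub>v N"
      using w(1) by (subst key) (simp_all add: in_kernel_def sumC)
    ultimately show "\<exists>v. v \<in> carrier_vec N \<and> v \<noteq> 0\<^sub>v N \<and> ?M *\<^sub>v v = 0\<^sub>v N"
      by (intro exI[of _ ?v]) auto
  qed
  finally show ?thesis .
qed

lemma sign_poly_eq: "(of_int k :: 'a::comm_ring_1 poly) = [:of_int k:]"
  by (simp add: of_int_poly)

lemma poly_det:
  assumes "B \<in> carrier_mat N N"
  shows "poly (det B) t = det (map_mat (\<lambda>p. poly p t) B)"
  using assms by (simp add: det_def' poly_sum poly_prod sign_poly_eq)

text \<open>Every permutation takes one entry from column \<open>a\<close> and another, in a
  different row, from column \<open>b\<close>, so each Leibniz term contains two factors divisible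
  by \<open>q\<close>.\<close>

lemma det_dvd_square:
  fixes B :: "'a::comm_ring_1 mat"
  assumes B: "B \<in> carrier_mat N N" and ab: "a < N" "b < N" "a \<noteq> b"
    and dv: "\<And>i. i < N \<Longrightarrow> q dvd B $$ (i, a)" "\<And>i. i < N \<Longrightarrow> q dvd B $$ (i, b)"
  shows "q ^ 2 dvd det B"
proof -
  have "q ^ 2 dvd (\<Prod>i = 0..<N. B $$ (i, p i))" if p: "p permutes {0..<N}" for p
  proof -
    have "a \<in> p ` {0..<N}" "b \<in> p ` {0..<N}" using ab permutes_image[OF p] by auto
    then obtain i j where ij: "i < N" "p i = a" "j < N" "p j = b" by auto
    have "i \<noteq> j" using ij ab by auto
    then have "(\<Prod>i = 0..<N. B $$ (i, p i)) =
        B $$ (i, a) * (B $$ (j, b) * (\<Prod>i\<in>{0..<N} - {i} - {j}. B $$ (i, p i)))"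
      using ij prod.remove[of "{0..<N}" i "\<lambda>i. B $$ (i, p i)"]
        prod.remove[of "{0..<N} - {i}" j "\<lambda>i. B $$ (i, p i)"] by simp
    moreover have "q * q dvd B $$ (i, a) * B $$ (j, b)" using dv ij by (intro mult_dvd_mono) auto
    ultimately show ?thesis by (simp add: power2_eq_square mult.assoc[symmetric])
  qed
  then show ?thesis unfolding det_def'[OF B] by (intro dvd_sum dvd_mult) auto
qed

lemma poly_fun_if:
  "(b \<Longrightarrow> poly_fun N g) \<Longrightarrow> (\<not> b \<Longrightarrow> poly_fun N h) \<Longrightarrow> poly_fun N (\<lambda>x. if b then g x else h x)"
  by (cases b) auto

lemma poly_fun_coeff_mult:
  assumes "\<And>k. poly_fun N (\<lambda>x. coeff (f x) k)" "\<And>k. poly_fun N (\<lambda>x. coeff (g x) k)"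
  shows "poly_fun N (\<lambda>x. coeff (f x * g x) k)"
  unfolding coeff_mult by (intro poly_fun_sum poly_fun_mult assms)

lemma poly_fun_coeff_prod:
  assumes "finite I" "\<And>i k. i \<in> I \<Longrightarrow> poly_fun N (\<lambda>x. coeff (f i x) k)"
  shows "poly_fun N (\<lambda>x. coeff (\<Prod>i\<in>I. f i x) k)"
  using assms
proof (induction I arbitrary: k rule: finite_induct)
  case empty
  then show ?case by (simp add: poly_fun_const)
next
  case (insert a I)
  show ?case using insert by (simp add: poly_fun_coeff_mult)
qed

text \<open>A rank drop of two at \<open>t\<close> gives a double root of the determinant: a
  constant invertible change of basis puts \<open>v\<close> and \<open>w\<close> into two columns,
  and both of these columns of the product vanish at \<open>t\<close>.\<close>

lemma double_root_of_kernel: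
  fixes B :: "'e \<Rightarrow> 'c \<Rightarrow> complex poly"
  assumes \<phi>: "bij_betw \<phi> {0..<N} E" and \<psi>: "bij_betw \<psi> {0..<N} C"
    and v: "in_kernel E C (\<lambda>e c. poly (B e c) t) v" "v a = 1" "v b = 0"
    and w: "in_kernel E C (\<lambda>e c. poly (B e c) t) w" "w a = 0" "w b = 1"
    and ab: "a \<in> C" "b \<in> C"
  shows "[:-t, 1:] ^ 2 dvd det (mat N N (\<lambda>(i, j). B (\<phi> i) (\<psi> j)))"
proof -
  let ?B = "mat N N (\<lambda>(i, j). B (\<phi> i) (\<psi> j))"
  \<comment> \<open>The identity matrix with columns \<open>a\<close> and \<open>b\<close> replaced
    by \<open>v\<close> and \<open>w\<close>. The values of \<open>v\<close> and \<open>w\<close> at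
    \<open>a\<close> and \<open>b\<close> make it invertible.\<close>
  define R where "R i j = (if j = a then v i else if j = b then w i else if i = j then 1 else 0)" for i j
  let ?R = "mat N N (\<lambda>(i, j). [:R (\<psi> i) (\<psi> j):])"
  have "a \<noteq> b" using v by auto
  have inj: "inj_on \<psi> {0..<N}" and im: "\<psi> ` {0..<N} = C" using \<psi> by (auto simp: bij_betw_def)
  have finC: "finite C" using im by auto
  obtain a' b' where a': "a' < N" "\<psi> a' = a" and b': "b' < N" "\<psi> b' = b" using ab im by auto
  have sumC: "(\<Sum>c\<in>C. F c) = (\<Sum>j = 0..<N. F (\<psi> j))" for F :: "'c \<Rightarrow> complex"
    using sum.reindex_bij_betw[OF \<psi>, of F] by simp
  have "det (mat N N (\<lambda>(i, j). R (\<psi> i) (\<psi> j))) \<noteq> 0"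
  proof -
    have "trivial_kernel C C R"
      unfolding trivial_kernel_def
    proof (intro allI impI ballI)
      fix u assume u: "in_kernel C C R u"
      have row: "(\<Sum>c\<in>C. R i c * u c) = 0" if "i \<in> C" for i
        using u that by (auto simp: in_kernel_def)
      have R1: "(\<Sum>c\<in>C. R i c * u c) = v i * u a + w i * u b
          + (\<Sum>c\<in>C - {a} - {b}. (if i = c then 1 else 0) * u c)" for i
        using sum.remove[OF finC ab(1), of "\<lambda>c. R i c * u c"]
          sum.remove[of "C - {a}" b "\<lambda>c. R i c * u c"] finC ab \<open>a \<noteq> b\<close>
        by (simp add: R_def add.assoc)
      have delta: "(\<Sum>c\<in>C - {a} - {b}. (if i = c then 1 else 0) * u c) =
          (if i \<in> C - {a} - {b} then u i else 0)" for i
        using finC by (simp add: if_distrib[of "\<lambda>x. x * _"] cong: if_cong)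
      have ua: "u a = 0" using row[OF ab(1)] R1[of a] delta[of a] v w by simp
      have ub: "u b = 0" using row[OF ab(2)] R1[of b] delta[of b] v w by simp
      fix c assume "c \<in> C"
      then show "u c = 0" using row[of c] R1[of c] delta[of c] ua ub
        by (cases "c = a"; cases "c = b") auto
    qed
    then show ?thesis using det_zero_iff_kernel[OF \<psi> \<psi>, of R] by simp
  qed
  moreover have "det (mat N N (\<lambda>(i, j). R (\<psi> i) (\<psi> j))) = poly (det ?R) t"
  proof -
    have "map_mat (\<lambda>p. poly p t) ?R = mat N N (\<lambda>(i, j). R (\<psi> i) (\<psi> j))" by auto
    then show ?thesis using poly_det[of ?R N t] by simp
  qed
  ultimately have dR: "poly (det ?R) t \<noteq> 0" by simp
  have col: "[:-t, 1:] dvd (?B * ?R) $$ (i, j)" if i: "i < N" and j: "j < N" "j = a' \<or> j = b'" for i j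
  proof -
    have ei: "\<phi> i \<in> E" using i \<phi> by (auto simp: bij_betw_def)
    have "poly ((?B * ?R) $$ (i, j)) t = (\<Sum>k = 0..<N. poly (B (\<phi> i) (\<psi> k)) t * R (\<psi> k) (\<psi> j))"
      using i j(1) by (simp add: scalar_prod_def poly_sum mult.commute)
    also have "\<dots> = (\<Sum>c\<in>C. poly (B (\<phi> i) c) t * R c (\<psi> j))" by (simp add: sumC)
    also have "\<dots> = 0"
      using j(2)
    proof
      assume "j = a'"
      then show ?thesis using v(1) ei a' by (simp add: R_def in_kernel_def)
    next
      assume "j = b'"
      then show ?thesis using w(1) ei b' \<open>a \<noteq> b\<close> by (simp add: R_def in_kernel_def)
    qed
    finally show ?thesis by (simp add: poly_eq_0_iff_dvd)
  qed
  have "[:-t, 1:] ^ 2 dvd det (?B * ?R)"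
    by (rule det_dvd_square[of _ N a' b']) (use a' b' \<open>a \<noteq> b\<close> col in auto)
  then have "[:-t, 1:] ^ 2 dvd det ?B * det ?R" by (subst (asm) det_mult[of _ N]) auto
  moreover have "order t (det ?R) = 0" "det ?R \<noteq> 0" using dR by (auto simp: order_0I)
  ultimately show ?thesis by (cases "det ?B = 0") (simp_all add: order_divides order_mult)
qed

text \<open>Only the columns in \<open>C1\<close> depend on \<open>t\<close>, and they do so
  linearly. Each Leibniz term meets every column once, which bounds the degree; dividing these
  columns by \<open>t\<close> and letting \<open>t\<close> tend to infinity shows that the top
  coefficient is the determinant of the system of leading coefficients. Everything stays polynomial
  in the parameters \<open>x\<close>.\<close>

lemma linear_pencil:
  fixes A :: "(nat \<Rightarrow> complex) \<Rightarrow> 'e \<Rightarrow> 'c \<Rightarrow> complex poly"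
  assumes fin: "finite E" "finite C" and card: "card E = card C" and C1: "C1 \<subseteq> C"
    and deg: "\<And>x e c. e \<in> E \<Longrightarrow> c \<in> C \<Longrightarrow> degree (A x e c) \<le> (if c \<in> C1 then 1 else 0)"
    and pf: "\<And>e c k. e \<in> E \<Longrightarrow> c \<in> C \<Longrightarrow> poly_fun N (\<lambda>x. coeff (A x e c) k)"
  obtains D where "\<And>x. degree (D x) \<le> card C1" "\<And>k. poly_fun N (\<lambda>x. coeff (D x) k)"
    "\<And>x t. poly (D x) t = 0 \<longleftrightarrow> \<not> trivial_kernel E C (\<lambda>e c. poly (A x e c) t)"
    "\<And>x. coeff (D x) (card C1) = 0 \<longleftrightarrow>
       \<not> trivial_kernel E C (\<lambda>e c. coeff (A x e c) (if c \<in> C1 then 1 else 0))"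
    "\<And>x t v w a b. in_kernel E C (\<lambda>e c. poly (A x e c) t) v \<Longrightarrow> v a = 1 \<Longrightarrow> v b = 0 \<Longrightarrow>
       in_kernel E C (\<lambda>e c. poly (A x e c) t) w \<Longrightarrow> w a = 0 \<Longrightarrow> w b = 1 \<Longrightarrow>
       a \<in> C \<Longrightarrow> b \<in> C \<Longrightarrow> [:-t, 1:] ^ 2 dvd D x"
proof -
  let ?N = "card C"
  obtain \<phi> where \<phi>: "bij_betw \<phi> {0..<?N} E" using ex_bij_betw_nat_finite[OF fin(1)] card by auto
  obtain \<psi> where \<psi>: "bij_betw \<psi> {0..<?N} C" using ex_bij_betw_nat_finite[OF fin(2)] by auto
  define B where "B x = mat ?N ?N (\<lambda>(i, j). A x (\<phi> i) (\<psi> j))" for x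
  have B: "B x \<in> carrier_mat ?N ?N" for x by (simp add: B_def)
  have mem: "\<phi> i \<in> E" "\<psi> i \<in> C" if "i < ?N" for i
    using that \<phi> \<psi> by (auto simp: bij_betw_def)
  let ?d = "\<lambda>c. if c \<in> C1 then 1 else (0::nat)"
  have sumd: "(\<Sum>i = 0..<?N. ?d (\<psi> (p i))) = card C1" if p: "p permutes {0..<?N}" for p
  proof -
    have "(\<Sum>i = 0..<?N. ?d (\<psi> (p i))) = (\<Sum>c\<in>C. ?d c)"
      using sum.reindex_bij_betw[OF bij_betw_trans[OF permutes_imp_bij[OF p] \<psi>], of ?d] by simp
    also have "\<dots> = card C1" using C1 fin by (simp add: sum.If_cases Int_absorb1)
    finally show ?thesis .
  qed
  have degp: "degree (\<Prod>i = 0..<?N. B x $$ (i, p i)) \<le> card C1"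
    "coeff (\<Prod>i = 0..<?N. B x $$ (i, p i)) (card C1)
       = (\<Prod>i = 0..<?N. coeff (A x (\<phi> i) (\<psi> (p i))) (?d (\<psi> (p i))))"
    if p: "p permutes {0..<?N}" for p x
  proof -
    have pl: "p i < ?N" if "i < ?N" for i using p that permutes_in_image[OF p, of i] by auto
    have d: "degree (B x $$ (i, p i)) \<le> ?d (\<psi> (p i))" if "i \<in> {0..<?N}" for i
      using that pl[of i] deg[OF mem(1) mem(2), of i "p i" x] by (auto simp: B_def)
    show "degree (\<Prod>i = 0..<?N. B x $$ (i, p i)) \<le> card C1"
      using degree_prod_bound(1)[of "{0..<?N}" "\<lambda>i. B x $$ (i, p i)" "\<lambda>i. ?d (\<psi> (p i))", OF _ d]
      by (simp add: sumd[OF p])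
    have "coeff (\<Prod>i = 0..<?N. B x $$ (i, p i)) (card C1)
       = (\<Prod>i = 0..<?N. coeff (B x $$ (i, p i)) (?d (\<psi> (p i))))"
      using degree_prod_bound(2)[of "{0..<?N}" "\<lambda>i. B x $$ (i, p i)" "\<lambda>i. ?d (\<psi> (p i))", OF _ d]
      by (simp add: sumd[OF p])
    also have "\<dots> = (\<Prod>i = 0..<?N. coeff (A x (\<phi> i) (\<psi> (p i))) (?d (\<psi> (p i))))"
      using pl by (intro prod.cong) (auto simp: B_def)
    finally show "coeff (\<Prod>i = 0..<?N. B x $$ (i, p i)) (card C1)
       = (\<Prod>i = 0..<?N. coeff (A x (\<phi> i) (\<psi> (p i))) (?d (\<psi> (p i))))" .
  qed
  have coeffdet: "coeff (det (B x)) k = (\<Sum>p | p permutes {0..<?N}.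
      of_int (sign p) * coeff (\<Prod>i = 0..<?N. B x $$ (i, p i)) k)" for x k
    by (simp add: det_def'[OF B] coeff_sum sign_poly_eq)
  show thesis
  proof (rule that[of "\<lambda>x. det (B x)"])
    show "degree (det (B x)) \<le> card C1" for x
      unfolding det_def'[OF B]
    proof (intro degree_sum_le)
      fix p assume p: "p \<in> {p. p permutes {0..<?N}}"
      have "degree (signof p * (\<Prod>i = 0..<?N. B x $$ (i, p i)))
          \<le> degree (\<Prod>i = 0..<?N. B x $$ (i, p i))"
        using degree_mult_le[of "signof p" "\<Prod>i = 0..<?N. B x $$ (i, p i)"]
        by (simp add: sign_poly_eq)
      then show "degree (signof p * (\<Prod>i = 0..<?N. B x $$ (i, p i))) \<le> card C1"
        using degp(1)[of p x] p by simp
    qed (simp add: finite_permutations)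
    show "poly_fun N (\<lambda>x. coeff (det (B x)) k)" for k
      unfolding coeffdet
    proof (intro poly_fun_sum poly_fun_mult poly_fun_const poly_fun_coeff_prod)
      fix p i k assume p: "p \<in> {p. p permutes {0..<?N}}" and i: "i \<in> {0..<?N}"
      then have pl: "p i < ?N" using permutes_in_image[of p "{0..<?N}" i] by auto
      then show "poly_fun N (\<lambda>x. coeff (B x $$ (i, p i)) k)"
        using i pf[OF mem(1) mem(2), of i "p i" k] by (simp add: B_def)
    qed auto
    show "poly (det (B x)) t = 0 \<longleftrightarrow> \<not> trivial_kernel E C (\<lambda>e c. poly (A x e c) t)" for x t
    proof -
      have "map_mat (\<lambda>p. poly p t) (B x) = mat ?N ?N (\<lambda>(i, j). poly (A x (\<phi> i) (\<psi> j)) t)"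
        by (auto simp: B_def)
      then show ?thesis
        using det_zero_iff_kernel[OF \<phi> \<psi>, of "\<lambda>e c. poly (A x e c) t"] by (simp add: poly_det[OF B])
    qed
    show "coeff (det (B x)) (card C1) = 0 \<longleftrightarrow>
       \<not> trivial_kernel E C (\<lambda>e c. coeff (A x e c) (?d c))" for x
    proof -
      let ?L = "mat ?N ?N (\<lambda>(i, j). coeff (A x (\<phi> i) (\<psi> j)) (?d (\<psi> j)))"
      have "det ?L = (\<Sum>p | p permutes {0..<?N}.
         of_int (sign p) * (\<Prod>i = 0..<?N. coeff (A x (\<phi> i) (\<psi> (p i))) (?d (\<psi> (p i)))))"
      proof (subst det_def'[of _ ?N], simp, intro sum.cong arg_cong2[where f = "(*)"] prod.cong refl)
        fix p i assume "p \<in> {p. p permutes {0..<?N}}" "i \<in> {0..<?N}"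
        then have "p i < ?N" "i < ?N" using permutes_in_image[of p "{0..<?N}" i] by auto
        then show "?L $$ (i, p i) = coeff (A x (\<phi> i) (\<psi> (p i))) (?d (\<psi> (p i)))" by simp
      qed
      also have "\<dots> = coeff (det (B x)) (card C1)"
        unfolding coeffdet using degp(2) by (intro sum.cong refl) auto
      finally show ?thesis
        using det_zero_iff_kernel[OF \<phi> \<psi>, of "\<lambda>e c. coeff (A x e c) (?d c)"] by simp
    qed
  qed (unfold B_def, rule double_root_of_kernel[OF \<phi> \<psi>])
qed

text \<open>With no moving column, the polynomial of \<open>linear_pencil\<close> is a constant, the
  determinant. This turns each nonsingularity requirement into the nonvanishing of a polynomial
  function, hence into a condition of general position.\<close>

lemma kernel_condition:
  fixes A :: "(nat \<Rightarrow> complex) \<Rightarrow> 'e \<Rightarrow> 'c \<Rightarrow> complex"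
  assumes fin: "finite E" "finite C" and card: "card E = card C"
    and pf: "\<And>e c. e \<in> E \<Longrightarrow> c \<in> C \<Longrightarrow> poly_fun N (\<lambda>x. A x e c)"
  shows "\<exists>G. poly_fun N G \<and> (\<forall>x. G x = 0 \<longleftrightarrow> \<not> trivial_kernel E C (A x))"
proof -
  have pf': "poly_fun N (\<lambda>x. coeff [:A x e c:] k)" if "e \<in> E" "c \<in> C" for e c k
    using pf[OF that] by (cases k) (simp_all add: poly_fun_const)
  obtain D where D: "\<And>k. poly_fun N (\<lambda>x. coeff (D x) k)"
    "\<And>x. coeff (D x) (card {}) = 0 \<longleftrightarrow>
       \<not> trivial_kernel E C (\<lambda>e c. coeff [:A x e c:] (if c \<in> {} then 1 else 0))"
    by (rule linear_pencil[OF fin card empty_subsetI, of "\<lambda>x e c. [:A x e c:]" N]) (auto intro: pf')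
  show ?thesis
    using D(1)[of "card ({} :: 'c set)"] D(2) by (intro exI[of _ "\<lambda>x. coeff (D x) (card ({} :: 'c set))"]) simp
qed

text \<open>\<open>G\<close> is the Sylvester determinant of \<open>D x\<close> and its derivative
  for the formal degrees \<open>d\<close> and \<open>d - 1\<close>. Unlike an expression in the
  roots it is visibly polynomial in the coefficients, and it decides squarefreeness wherever the
  degree is really \<open>d\<close>.\<close>

lemma discriminant_condition:
  fixes D :: "(nat \<Rightarrow> complex) \<Rightarrow> complex poly"
  assumes deg: "\<And>x. degree (D x) \<le> d" and pf: "\<And>k. poly_fun N (\<lambda>x. coeff (D x) k)"
    and d: "d \<ge> 1"
  obtains G where "poly_fun N G"
    "\<And>x. coeff (D x) d \<noteq> 0 \<Longrightarrow> G x \<noteq> 0 \<longleftrightarrow> rsquarefree (D x)"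
proof -
  \<comment> \<open>Write p for \<open>D x\<close>. The unknowns are the coefficients of multipliers
    a and b of degree below d - 1 and d; the equations say that a p + b p' has no term below degree
    2 d - 1, that is a p + b p' = 0.\<close>
  define E where "E = {..<2 * d - 1}"
  define C where "C = {..<d - 1} <+> {..<d}"
  define A where "A x e c = (case c of Inl i \<Rightarrow> (if e < i then 0 else coeff (D x) (e - i))
    | Inr j \<Rightarrow> (if e < j then 0 else coeff (pderiv (D x)) (e - j)))" for x e c
  have fin: "finite E" "finite C" and card: "card E = card C"
    using d by (auto simp: E_def C_def card_Plus)
  have pfA: "poly_fun N (\<lambda>x. A x e c)" if "e \<in> E" "c \<in> C" for e c
    unfolding A_def coeff_pderiv
    by (cases c) (auto simp del: of_nat_Suc intro!: poly_fun_if pf poly_fun_mult poly_fun_const)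
  obtain G where G: "poly_fun N G" "\<And>x. G x = 0 \<longleftrightarrow> \<not> trivial_kernel E C (A x)"
    using kernel_condition[of E C N A, OF fin card pfA] by blast
  have sumA: "(\<Sum>c\<in>C. A x e c * v c) = coeff ((\<Sum>i<d - 1. monom (v (Inl i)) i) * D x
      + (\<Sum>j<d. monom (v (Inr j)) j) * pderiv (D x)) e" for x e v
  proof -
    have "A x e (Inl i) * v (Inl i) = coeff (monom (v (Inl i)) i * D x) e" for i
      by (simp add: A_def coeff_monom_mult)
    moreover have "A x e (Inr j) * v (Inr j) = coeff (monom (v (Inr j)) j * pderiv (D x)) e" for j
      by (simp add: A_def coeff_monom_mult)
    ultimately show ?thesis
      by (simp add: C_def sum.Plus sum_distrib_right coeff_sum)
  qed
  have deg_lt: "degree (\<Sum>i<k. monom (c i) i) < k" if "k > 0" for k and c :: "nat \<Rightarrow> complex"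
  proof -
    have "degree (\<Sum>i<k. monom (c i) i) \<le> k - 1"
      by (intro degree_sum_le) (auto intro: order.trans[OF degree_monom_le])
    then show ?thesis using that by simp
  qed
  show thesis
  proof (rule that[OF G(1)])
    fix x assume lead: "coeff (D x) d \<noteq> 0"
    let ?p = "D x"
    have p0: "?p \<noteq> 0" using lead by auto
    have degp: "degree ?p = d" using deg[of x] lead le_degree[of ?p d] by simp
    show "G x \<noteq> 0 \<longleftrightarrow> rsquarefree ?p"
    proof
      assume Gx: "G x \<noteq> 0"
      show "rsquarefree ?p"
        unfolding rsquarefree_roots
      proof (intro allI notI)
        fix t assume t: "poly ?p t = 0 \<and> poly (pderiv ?p) t = 0"
        \<comment> \<open>A common root is divided out of p and p'. The cofactors satisfy W p - U p'
          = 0, and their degrees are small enough to make them a nonzero kernel vector.\<close>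
        obtain U where U: "?p = [:-t, 1:] * U" using t by (auto simp: poly_eq_0_iff_dvd elim: dvdE)
        obtain W where W: "pderiv ?p = [:-t, 1:] * W"
          using t by (auto simp: poly_eq_0_iff_dvd elim: dvdE)
        have U0: "U \<noteq> 0" using p0 unfolding U by auto
        have "degree ([:-t, 1:] * U) = degree [:-t, 1:] + degree U"
          using U0 by (intro degree_mult_eq) auto
        then have degU: "degree U < d" using degp unfolding U by simp
        have pd: "degree (pderiv ?p) = d - 1" by (simp add: degree_pderiv degp)
        have "pderiv ?p \<noteq> 0" using degp d by (simp add: pderiv_eq_0_iff)
        then have W0: "W \<noteq> 0" unfolding W by auto
        have "degree ([:-t, 1:] * W) = degree [:-t, 1:] + degree W"
          using W0 by (intro degree_mult_eq) auto
        then have degW: "degree W < d - 1" using pd unfolding W by simp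
        define v where "v = case_sum (coeff W) (\<lambda>j. - coeff U j)"
        have "(\<Sum>i<d - 1. monom (v (Inl i)) i) = W"
          using poly_as_sum_of_monoms'[of W "d - 2"] degW
          by (simp add: v_def lessThan_Suc_atMost[symmetric] Suc_diff_Suc numeral_2_eq_2)
        moreover have "(\<Sum>j<d. monom (v (Inr j)) j) = - U"
          using poly_as_sum_of_monoms'[of U "d - 1"] degU
          by (simp add: v_def lessThan_Suc_atMost[symmetric] sum_negf minus_monom[symmetric])
        moreover have "W * ?p = U * pderiv ?p"
        proof -
          have "W * ?p = W * ([:-t, 1:] * U)" by (rule arg_cong[OF U])
          also have "\<dots> = U * ([:-t, 1:] * W)" by (simp only: mult_ac)
          also have "\<dots> = U * pderiv ?p" by (rule arg_cong[OF W[symmetric]])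
          finally show ?thesis .
        qed
        ultimately have "in_kernel E C (A x) v"
          unfolding in_kernel_def sumA by simp
        then have "\<forall>c\<in>C. v c = 0" using Gx G(2)[of x] unfolding trivial_kernel_def by blast
        then have "v (Inr (degree U)) = 0" using degU by (auto simp: C_def)
        then show False using U0 by (simp add: v_def)
      qed
    next
      assume sf: "rsquarefree ?p"
      have "trivial_kernel E C (A x)"
        unfolding trivial_kernel_def
      proof (intro allI impI)
        fix v assume v: "in_kernel E C (A x) v"
        define a where "a = (\<Sum>i<d - 1. monom (v (Inl i)) i)"
        define b where "b = (\<Sum>j<d. monom (v (Inr j)) j)"
        have "a * ?p + b * pderiv ?p = 0"
        proof (rule poly_eqI)
          fix e
          show "coeff (a * ?p + b * pderiv ?p) e = coeff 0 e"
          proof (cases "e < 2 * d - 1")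
            case True
            then show ?thesis using v unfolding in_kernel_def sumA a_def b_def E_def by auto
          next
            case False
            have "degree (a * ?p) < 2 * d - 1"
            proof (cases "d = 1")
              case False
              then show ?thesis using degree_mult_le[of a ?p] deg_lt[of "d - 1" "v \<circ> Inl"] d degp
                by (simp add: a_def)
            qed (simp add: a_def)
            moreover have "degree (b * pderiv ?p) < 2 * d - 1"
              using degree_mult_le[of b "pderiv ?p"] deg_lt[of d "v \<circ> Inr"] d degp
              by (simp add: b_def degree_pderiv)
            ultimately show ?thesis using False by (simp add: coeff_eq_0)
          qed
        qed
        then have ab: "a * ?p = - (b * pderiv ?p)" by (simp add: eq_neg_iff_add_eq_0)
        have "b = 0"
        proof (rule ccontr)
          assume "b \<noteq> 0"
          \<comment> \<open>At a root of p the derivative does not vanish, so \<open>b\<close> does;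
            a nonzero polynomial of degree below \<open>d\<close> would have \<open>d\<close>
            roots.\<close>
          have "{t. poly ?p t = 0} \<subseteq> {t. poly b t = 0}"
          proof
            fix t assume "t \<in> {t. poly ?p t = 0}"
            moreover have "poly a t * poly ?p t = - (poly b t * poly (pderiv ?p) t)"
              using arg_cong[OF ab, of "\<lambda>q. poly q t"] by simp
            ultimately show "t \<in> {t. poly b t = 0}" using sf by (auto simp: rsquarefree_roots)
          qed
          then have "card {t. poly ?p t = 0} \<le> card {t. poly b t = 0}"
            using \<open>b \<noteq> 0\<close> by (intro card_mono poly_roots_finite)
          also have "\<dots> \<le> degree b" using \<open>b \<noteq> 0\<close> by (rule card_poly_roots_bound)
          also have "\<dots> < d" using deg_lt[of d "v \<circ> Inr"] d by (simp add: b_def)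
          finally show False using sf p0 degp rsquarefree_card_degree[OF p0] by simp
        qed
        then have "a = 0" using ab p0 by simp
        show "\<forall>c\<in>C. v c = 0"
        proof
          fix c assume "c \<in> C"
          moreover have "v (Inl i) = coeff a i" if "i < d - 1" for i
            using that by (simp add: a_def coeff_sum)
          moreover have "v (Inr i) = coeff b i" if "i < d" for i
            using that by (simp add: b_def coeff_sum)
          ultimately show "v c = 0" using \<open>a = 0\<close> \<open>b = 0\<close> by (auto simp: C_def)
        qed
      qed
      then show "G x \<noteq> 0" using G(2) by blast
    qed
  qed
qed

section \<open>Normal forms of kernel vectors and underdetermined systems\<close>

lemma in_kernel_comb:
  assumes "in_kernel E C A v" "in_kernel E C A w"
  shows "in_kernel E C A (\<lambda>c. \<alpha> * v c + \<beta> * w c)"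
proof -
  have "(\<Sum>c\<in>C. A e c * (\<alpha> * v c + \<beta> * w c)) =
      \<alpha> * (\<Sum>c\<in>C. A e c * v c) + \<beta> * (\<Sum>c\<in>C. A e c * w c)" for e
    by (simp add: distrib_left sum.distrib sum_distrib_left mult.left_commute)
  then show ?thesis using assms unfolding in_kernel_def by simp
qed

text \<open>Gaussian elimination brings two independent kernel vectors into the shape that
  \<open>double_root_of_kernel\<close> expects.\<close>

lemma kernel_two_dim_normal_form:
  fixes v w :: "'c \<Rightarrow> 'a::field"
  assumes v: "in_kernel E C A v" and w: "in_kernel E C A w"
    and a: "a \<in> C" "v a \<noteq> 0" and ind: "\<nexists>\<kappa>. \<forall>c\<in>C. w c = \<kappa> * v c"
  obtains v' w' b where "in_kernel E C A v'" "v' a = 1" "v' b = 0"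
    "in_kernel E C A w'" "w' a = 0" "w' b = 1" "b \<in> C"
proof -
  define w1 where "w1 c = 1 * w c + (- (w a / v a)) * v c" for c
  have w1: "in_kernel E C A w1" unfolding w1_def by (rule in_kernel_comb[OF w v])
  have w1a: "w1 a = 0" using a by (simp add: w1_def)
  obtain b where b: "b \<in> C" "w1 b \<noteq> 0"
  proof -
    have "\<exists>b\<in>C. w b \<noteq> (w a / v a) * v b" using ind by blast
    then show ?thesis using that by (auto simp: w1_def)
  qed
  define w' where "w' c = (1 / w1 b) * w1 c + 0 * w1 c" for c
  define v' where "v' c = (1 / v a) * v c + (- v b / (v a * w1 b)) * w1 c" for c
  have "in_kernel E C A v'" unfolding v'_def by (rule in_kernel_comb[OF v w1])
  moreover have "in_kernel E C A w'" unfolding w'_def by (rule in_kernel_comb[OF w1 w1])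
  moreover have "v' a = 1" "v' b = 0" "w' a = 0" "w' b = 1"
    using a b w1a by (simp_all add: v'_def w'_def)
  ultimately show thesis using that b(1) by metis
qed

text \<open>Padding with zero equations gives a square matrix with a zero row, whose determinant is
  0.\<close>

lemma kernel_nontrivial:
  fixes A :: "'e \<Rightarrow> 'c \<Rightarrow> 'a::field"
  assumes fin: "finite E" "finite C" and card: "card E < card C"
  shows "\<not> trivial_kernel E C A"
proof -
  define E' where "E' = E <+> {..<card C - card E}"
  define A' where "A' = case_sum A (\<lambda>(_ :: nat) _. 0)"
  have E': "finite E'" "card E' = card C" using fin card by (auto simp: E'_def card_Plus)
  obtain \<phi> where \<phi>: "bij_betw \<phi> {0..<card C} E'" using ex_bij_betw_nat_finite[OF E'(1)] E'(2) by auto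
  obtain \<psi> where \<psi>: "bij_betw \<psi> {0..<card C} C" using ex_bij_betw_nat_finite[OF fin(2)] by auto
  have "Inr 0 \<in> E'" using card by (auto simp: E'_def)
  then obtain i where i: "i < card C" "\<phi> i = Inr 0" using \<phi> by (force simp: bij_betw_def)
  have "det (mat (card C) (card C) (\<lambda>(i, j). A' (\<phi> i) (\<psi> j))) = 0"
  proof (subst det_def'[of _ "card C"], simp, rule sum.neutral, intro ballI)
    fix p assume "p \<in> {p. p permutes {0..<card C}}"
    then have "p i < card C" using i permutes_in_image[of p "{0..<card C}" i] by auto
    then have "\<exists>i\<in>{0..<card C}. mat (card C) (card C) (\<lambda>(i, j). A' (\<phi> i) (\<psi> j)) $$ (i, p i) = 0"
      using i by (intro bexI[of _ i]) (auto simp: A'_def)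
    then have "(\<Prod>i = 0..<card C. mat (card C) (card C) (\<lambda>(i, j). A' (\<phi> i) (\<psi> j)) $$ (i, p i)) = 0"
      by (intro prod_zero) auto
    then show "signof p * (\<Prod>i = 0..<card C. mat (card C) (card C) (\<lambda>(i, j). A' (\<phi> i) (\<psi> j)) $$ (i, p i)) = 0"
      by simp
  qed
  then have "\<not> trivial_kernel E' C A'" using det_zero_iff_kernel[OF \<phi> \<psi>, of A'] by simp
  moreover have "in_kernel E C A v" if "in_kernel E' C A' v" for v
    unfolding in_kernel_def
  proof
    fix e assume "e \<in> E"
    then have "Inl e \<in> E'" by (auto simp: E'_def)
    from bspec[OF that[unfolded in_kernel_def] this] show "(\<Sum>c\<in>C. A e c * v c) = 0"
      by (simp add: A'_def)
  qed
  ultimately show ?thesis unfolding trivial_kernel_def by blast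
qed

subsection \<open>Planes and flags\<close>

lemma lin_indep2: "lin_indep [u, v] \<longleftrightarrow> (\<forall>a b. (\<forall>j. a * u j + b * v j = 0) \<longrightarrow> a = 0 \<and> b = 0)"
proof -
  have S: "(\<Sum>i<length [u, v]. c i * ([u, v] ! i) j) = c 0 * u j + c 1 * v j" for c j
    by (simp add: lessThan_Suc add.commute)
  have "lin_indep [u, v] \<longleftrightarrow> (\<forall>c. (\<forall>j. c 0 * u j + c 1 * v j = 0) \<longrightarrow> c 0 = 0 \<and> c (1::nat) = 0)"
    unfolding lin_indep_def S by (auto simp: less_Suc_eq numeral_2_eq_2)
  also have "\<dots> \<longleftrightarrow> (\<forall>a b. (\<forall>j. a * u j + b * v j = 0) \<longrightarrow> a = 0 \<and> b = 0)" (is "?l = ?r")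
  proof
    assume l: ?l
    show ?r
    proof (intro allI impI)
      fix a b assume "\<forall>j. a * u j + b * v j = 0"
      then show "a = 0 \<and> b = 0" using l[rule_format, of "\<lambda>i. if i = 0 then a else b"] by simp
    qed
  qed blast
  finally show ?thesis .
qed

lemma cspan2: "w \<in> cspan [u, v] \<longleftrightarrow> (\<exists>a b. \<forall>j. w j = a * u j + b * v j)"
proof -
  have S: "(\<Sum>i<length [u, v]. c i * ([u, v] ! i) j) = c 0 * u j + c 1 * v j" for c j
    by (simp add: lessThan_Suc add.commute)
  have "w \<in> cspan [u, v] \<longleftrightarrow> (\<exists>c. \<forall>j. w j = c 0 * u j + c (1::nat) * v j)"
    unfolding cspan_def S by simp
  also have "\<dots> \<longleftrightarrow> (\<exists>a b. \<forall>j. w j = a * u j + b * v j)" (is "?l = ?r")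
  proof
    assume ?r
    then obtain a b where "\<forall>j. w j = a * u j + b * v j" by blast
    then show ?l by (intro exI[of _ "\<lambda>i. if i = 0 then a else b"]) simp
  qed blast
  finally show ?thesis .
qed

lemma cspan2_left: "u \<in> cspan [u, v]"
  unfolding cspan2 by (intro exI[of _ 1] exI[of _ 0]) simp

lemma cspan2_right: "v \<in> cspan [u, v]"
  unfolding cspan2 by (intro exI[of _ 0] exI[of _ 1]) simp

lemma grass2_comb:
  assumes "X \<in> grass2 n" "u \<in> X" "v \<in> X" shows "(\<lambda>j. a * u j + b * v j) \<in> X"
proof -
  obtain p q where X: "X = cspan [p, q]" using assms(1) unfolding grass2_def by blast
  obtain c d where u: "\<And>j. u j = c * p j + d * q j" using assms(2) unfolding X cspan2 by blast
  obtain e f where v: "\<And>j. v j = e * p j + f * q j" using assms(3) unfolding X cspan2 by blast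
  show ?thesis unfolding X cspan2
    by (rule exI[of _ "a * c + b * e"], rule exI[of _ "a * d + b * f"])
      (simp add: u v algebra_simps)
qed

lemma grass2_subset: "X \<in> grass2 n \<Longrightarrow> X \<subseteq> cvec n"
  unfolding grass2_def by (auto simp: cspan2 cvec_def)

lemma grass2_basis:
  assumes X: "X \<in> grass2 n" and x: "x \<in> X" and y: "y \<in> X" and ind: "lin_indep [x, y]"
  shows "X = cspan [x, y]"
proof
  show "cspan [x, y] \<subseteq> X"
  proof
    fix w assume "w \<in> cspan [x, y]"
    then obtain a b where "\<And>j. w j = a * x j + b * y j" unfolding cspan2 by blast
    then have "w = (\<lambda>j. a * x j + b * y j)" by auto
    then show "w \<in> X" using grass2_comb[OF X x y] by simp
  qed
  obtain p q where X': "X = cspan [p, q]" using X unfolding grass2_def by blast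
  obtain a b where x': "\<And>j. x j = a * p j + b * q j" using x unfolding X' cspan2 by blast
  obtain c d where y': "\<And>j. y j = c * p j + d * q j" using y unfolding X' cspan2 by blast
  note I = ind[unfolded lin_indep2, rule_format]
  \<comment> \<open>The determinant of \<open>x\<close>, \<open>y\<close> in terms of
    \<open>p\<close>, \<open>q\<close>; the coefficients further down are Cramer's rule.\<close>
  let ?D = "a * d - b * c"
  have D: "?D \<noteq> 0"
  proof
    assume D: "?D = 0"
    have 1: "d * x j + (- b) * y j = ?D * p j" for j by (simp add: x' y' algebra_simps)
    have 2: "c * x j + (- a) * y j = - ?D * q j" for j by (simp add: x' y' algebra_simps)
    have "d = 0 \<and> - b = 0" by (rule I) (simp only: 1 D, simp)
    moreover have "c = 0 \<and> - a = 0" by (rule I) (simp only: 2 D, simp)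
    ultimately have "1 * x j + 0 * y j = 0" for j by (simp add: x')
    then have "1 = (0::complex) \<and> 0 = (0::complex)" by (intro I) simp
    then show False by simp
  qed
  show "X \<subseteq> cspan [x, y]"
  proof
    fix w assume "w \<in> X"
    then obtain e f where w: "\<And>j. w j = e * p j + f * q j" unfolding X' cspan2 by blast
    have "w j = ((e * d - f * c) / ?D) * x j + ((f * a - e * b) / ?D) * y j" for j
    proof -
      have "?D * w j = (e * d - f * c) * x j + (f * a - e * b) * y j"
        by (simp add: w x' y' algebra_simps)
      then have "w j = ((e * d - f * c) * x j + (f * a - e * b) * y j) / ?D"
        using D by (simp add: field_simps)
      then show ?thesis by (simp add: add_divide_distrib)
    qed
    then show "w \<in> cspan [x, y]" unfolding cspan2 by blast
  qed
qed

lemma flag_space_iff: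
  "w \<in> flag_space n M i \<longleftrightarrow> (\<exists>c. \<forall>j. w j = (\<Sum>a<i. c a * mrow n M a j))"
  unfolding flag_space_def cspan_def by simp

lemma flag_space_comb:
  assumes "u \<in> flag_space n M i" "v \<in> flag_space n M i"
  shows "(\<lambda>j. a * u j + b * v j) \<in> flag_space n M i"
proof -
  obtain c where c: "\<And>j. u j = (\<Sum>a<i. c a * mrow n M a j)" using assms(1) flag_space_iff by blast
  obtain d where d: "\<And>j. v j = (\<Sum>a<i. d a * mrow n M a j)" using assms(2) flag_space_iff by blast
  show ?thesis unfolding flag_space_iff
    by (rule exI[of _ "\<lambda>k. a * c k + b * d k"])
      (simp add: c d sum_distrib_left sum.distrib algebra_simps)
qed

lemma flag_space_mono:
  assumes "i \<le> i'" shows "flag_space n M i \<subseteq> flag_space n M i'"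
proof
  fix w assume "w \<in> flag_space n M i"
  then obtain c where c: "\<And>j. w j = (\<Sum>a<i. c a * mrow n M a j)" using flag_space_iff by blast
  have "(\<Sum>a<i. c a * mrow n M a j) = (\<Sum>a<i'. (if a < i then c a else 0) * mrow n M a j)" for j
    using assms by (intro sum.mono_neutral_cong_left) auto
  then show "w \<in> flag_space n M i'" unfolding flag_space_iff c
    by (intro exI[of _ "\<lambda>a. if a < i then c a else 0"]) simp
qed

lemma flag_space_cvec: "flag_space n M i \<subseteq> cvec n"
  by (auto simp: flag_space_iff cvec_def mrow_def)

lemma invertible_mat_kernel:
  "Defs.invertible_mat n M \<longleftrightarrow> trivial_kernel {..<n} {..<n} (\<lambda>b a. M a b)"
proof -
  have S: "(\<Sum>i<length (map (mrow n M) [0..<n]). c i * (map (mrow n M) [0..<n] ! i) j) =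
      (if j < n then \<Sum>a<n. M a j * c a else 0)" for c j
    by (simp add: mrow_def mult.commute)
  show ?thesis
    unfolding Defs.invertible_mat_def lin_indep_def S trivial_kernel_def in_kernel_def by auto
qed

lemma invertible_matD:
  assumes "Defs.invertible_mat n M" "d \<le> n" "\<And>j. (\<Sum>a<d. c a * mrow n M a j) = 0" "a < d"
  shows "c a = 0"
proof -
  let ?c = "\<lambda>i. if i < d then c i else 0"
  have "(\<Sum>i<n. M i j * ?c i) = 0" if "j < n" for j
  proof -
    have "(\<Sum>i<n. M i j * ?c i) = (\<Sum>a<d. c a * mrow n M a j)"
      using assms(2) that by (intro sum.mono_neutral_cong_right) (auto simp: mrow_def)
    then show ?thesis using assms(3) by simp
  qed
  then have "in_kernel {..<n} {..<n} (\<lambda>b a. M a b) ?c" by (simp add: in_kernel_def)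
  then have "\<forall>i\<in>{..<n}. ?c i = 0"
    using assms(1) unfolding invertible_mat_kernel trivial_kernel_def by blast
  then have "?c a = 0" using assms(2,4) by (metis lessThan_iff less_le_trans)
  then show ?thesis using assms(4) by simp
qed

lemma flag_space_solve:
  assumes "\<And>b. (\<Sum>a<d. c a * mrow n M a b) + k * v b = 0" "k \<noteq> 0"
  shows "v \<in> flag_space n M d"
  unfolding flag_space_iff
proof (intro exI[of _ "\<lambda>a. - c a / k"] allI)
  fix b show "v b = (\<Sum>a<d. (- c a / k) * mrow n M a b)"
    using assms(1)[of b] assms(2) by (simp add: sum_divide_distrib[symmetric] sum_negf field_simps
        eq_neg_iff_add_eq_0 add.commute)
qed

lemma flag_space_top:
  assumes inv: "Defs.invertible_mat n M" shows "flag_space n M n = cvec n"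
proof
  show "cvec n \<subseteq> flag_space n M n"
  proof
    fix w assume w: "w \<in> cvec n"
    let ?A = "\<lambda>b a. if a < n then M a b else w b"
    have S: "(\<Sum>a\<in>{..<Suc n}. ?A b a * c a) = (\<Sum>a<n. c a * M a b) + c n * w b" for b c
      by (simp add: mult.commute)
    have "\<not> trivial_kernel {..<n} {..<Suc n} ?A" by (rule kernel_nontrivial) auto
    then obtain c a where c: "in_kernel {..<n} {..<Suc n} ?A c" "a < Suc n" "c a \<noteq> 0"
      unfolding trivial_kernel_def by blast
    have eq: "(\<Sum>a<n. c a * mrow n M a b) + c n * w b = 0" for b
      using c(1) w unfolding in_kernel_def S by (cases "b < n") (auto simp: mrow_def cvec_def)
    have "c n \<noteq> 0"
    proof
      assume 0: "c n = 0"
      then have "c a = 0" if "a < n" for a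
        using invertible_matD[OF inv order_refl, of c a] eq that by simp
      then show False using 0 c by (auto simp: less_Suc_eq)
    qed
    then show "w \<in> flag_space n M n" using flag_space_solve[OF eq] by blast
  qed
qed (rule flag_space_cvec)

text \<open>The last coordinate with respect to the rows of \<open>M\<close> is one linear form, and
  on a two-dimensional space it has a nonzero zero. Hence a Schubert condition with second entry 2
  makes no demand on what the plane meets.\<close>

lemma grass2_meets_hyperplane:
  assumes inv: "Defs.invertible_mat n M" and X: "X \<in> grass2 n" and n: "n \<ge> 1"
  obtains w where "w \<in> X" "w \<in> flag_space n M (n - 1)" "w \<noteq> (\<lambda>_. 0)"
proof -
  obtain u v where uv: "u \<in> cvec n" "v \<in> cvec n" "lin_indep [u, v]" "X = cspan [u, v]"
    using X unfolding grass2_def by blast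
  obtain N where N: "n = Suc N" using n by (cases n) auto
  obtain c where c: "\<And>j. u j = (\<Sum>a<Suc N. c a * mrow n M a j)"
    using uv(1) flag_space_top[OF inv] flag_space_iff[of u n M n] N by auto
  obtain d where d: "\<And>j. v j = (\<Sum>a<Suc N. d a * mrow n M a j)"
    using uv(2) flag_space_top[OF inv] flag_space_iff[of v n M n] N by auto
  note I = uv(3)[unfolded lin_indep2, rule_format]
  obtain \<alpha> \<beta> where ab: "\<alpha> \<noteq> 0 \<or> \<beta> \<noteq> 0" "\<alpha> * c N + \<beta> * d N = 0"
  proof (cases "c N = 0")
    case True then show ?thesis using that[of 1 0] by simp
  next
    case False then show ?thesis using that[of "d N" "- c N"] by simp
  qed
  let ?w = "\<lambda>j. \<alpha> * u j + \<beta> * v j"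
  have "?w j = (\<Sum>a<N. (\<alpha> * c a + \<beta> * d a) * mrow n M a j)" for j
  proof -
    have "?w j = (\<Sum>a<N. (\<alpha> * c a + \<beta> * d a) * mrow n M a j) + (\<alpha> * c N + \<beta> * d N) * mrow n M N j"
      by (simp add: c d algebra_simps sum.distrib sum_distrib_left)
    then show ?thesis by (simp add: ab(2))
  qed
  then have "?w \<in> flag_space n M (n - 1)" unfolding flag_space_iff N diff_Suc_1
    by (intro exI[of _ "\<lambda>a. \<alpha> * c a + \<beta> * d a"]) blast
  moreover have "?w \<in> X" unfolding uv(4) cspan2 by blast
  moreover have "?w \<noteq> (\<lambda>_. 0)"
  proof
    assume "?w = (\<lambda>_. 0)"
    then have "\<alpha> = 0 \<and> \<beta> = 0" by (intro I) (rule fun_cong)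
    then show False using ab(1) by simp
  qed
  ultimately show thesis using that by blast
qed

lemma dim_ge_1: "dim_ge S 1 \<longleftrightarrow> (\<exists>w\<in>S. w \<noteq> (\<lambda>_. 0))"
proof -
  have 1: "lin_indep [w] \<longleftrightarrow> w \<noteq> (\<lambda>_. 0)" for w
  proof -
    have "lin_indep [w] \<longleftrightarrow> (\<forall>c. (\<forall>j. c (0::nat) * w j = 0) \<longrightarrow> c 0 = 0)"
      unfolding lin_indep_def by simp
    also have "\<dots> \<longleftrightarrow> (\<exists>j. w j \<noteq> 0)"
    proof
      assume *: "\<forall>c. (\<forall>j. c (0::nat) * w j = 0) \<longrightarrow> c 0 = 0"
      show "\<exists>j. w j \<noteq> 0" using spec[OF *, of "\<lambda>_. 1"] by simp
    qed auto
    finally show ?thesis by auto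
  qed
  have "dim_ge S 1 \<longleftrightarrow> (\<exists>w. w \<in> S \<and> lin_indep [w])"
  proof
    assume "dim_ge S 1"
    then obtain vs where vs: "length vs = 1" "set vs \<subseteq> S" "lin_indep vs" unfolding dim_ge_def by blast
    then obtain w where "vs = [w]" by (auto simp: length_Suc_conv)
    then show "\<exists>w. w \<in> S \<and> lin_indep [w]" using vs by auto
  next
    assume "\<exists>w. w \<in> S \<and> lin_indep [w]"
    then obtain w where "w \<in> S" "lin_indep [w]" by blast
    then show "dim_ge S 1" unfolding dim_ge_def by (intro exI[of _ "[w]"]) auto
  qed
  then show ?thesis unfolding 1 by blast
qed

lemma dim_ge_2_plane:
  assumes X: "X \<in> grass2 n"
  shows "dim_ge (X \<inter> flag_space n M i) 2 \<longleftrightarrow> X \<subseteq> flag_space n M i"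
proof
  assume "dim_ge (X \<inter> flag_space n M i) 2"
  then obtain vs where vs: "length vs = 2" "set vs \<subseteq> X \<inter> flag_space n M i" "lin_indep vs"
    unfolding dim_ge_def by blast
  then obtain u v where uv: "vs = [u, v]" by (auto simp: length_Suc_conv numeral_2_eq_2)
  have Xuv: "X = cspan [u, v]" using vs uv by (intro grass2_basis[OF X]) auto
  then show "X \<subseteq> flag_space n M i"
  proof (intro subsetI)
    fix w assume "w \<in> X"
    then obtain a b where "\<And>j. w j = a * u j + b * v j" unfolding Xuv cspan2 by blast
    then have "w = (\<lambda>j. a * u j + b * v j)" by (intro ext)
    then show "w \<in> flag_space n M i" using vs(2) uv flag_space_comb[of u n M i v] by simp
  qed
next
  assume sub: "X \<subseteq> flag_space n M i"
  obtain u v where uv: "lin_indep [u, v]" "X = cspan [u, v]" using X unfolding grass2_def by blast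
  have "set [u, v] \<subseteq> X \<inter> flag_space n M i"
    using sub cspan2_left[of u v] cspan2_right[of v u] by (auto simp: uv(2))
  then show "dim_ge (X \<inter> flag_space n M i) 2"
    unfolding dim_ge_def using uv(1) by (intro exI[of _ "[u, v]"]) auto
qed

lemma schubert_var_iff:
  "X \<in> schubert_var n a M \<longleftrightarrow> X \<in> grass2 n \<and> X \<subseteq> flag_space n M (n + 1 - fst a) \<and>
     (\<exists>w\<in>X. w \<in> flag_space n M (n + 1 - snd a) \<and> w \<noteq> (\<lambda>_. 0))"
  unfolding schubert_var_def dim_ge_1 using dim_ge_2_plane[of X n] by auto

subsection \<open>Planes through a vector meeting several flag subspaces\<close>

definition meets :: "(nat \<Rightarrow> complex) set \<Rightarrow> (nat \<Rightarrow> complex) set \<Rightarrow> bool" where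
  "meets X S \<longleftrightarrow> (\<exists>w\<in>X. w \<in> S \<and> w \<noteq> (\<lambda>_. 0))"

text \<open>A plane \<open>X\<close> containing \<open>y\<close> meets \<open>K_d(i0)\<close> and all the other \<open>K_d(i)\<close> iff it contains some
  \<open>x\<close> in \<open>K_d(i0)\<close> such that \<open>x - \<mu>(i) y\<close> lies in \<open>K_d(i)\<close> for all \<open>i\<close>.  The unknowns \<open>(i, a)\<close> with
  \<open>a < d i\<close> are coordinates in \<open>K_d(i)\<close>, and \<open>(i, d i)\<close> stands for \<open>\<mu>(i)\<close>.\<close>

definition line_unknowns :: "nat set \<Rightarrow> nat \<Rightarrow> (nat \<Rightarrow> nat) \<Rightarrow> (nat \<times> nat) set" where
  "line_unknowns R i0 d = Sigma R (\<lambda>i. if i = i0 then {..<d i} else {..<Suc (d i)})"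

definition line_equations :: "nat \<Rightarrow> nat set \<Rightarrow> nat \<Rightarrow> (nat \<times> nat) set" where
  "line_equations n R i0 = (R - {i0}) \<times> {..<n}"

text \<open>Equation \<open>(i, b)\<close> is coordinate \<open>b\<close> of x - \<mu>(i) y - k(i) =
  0, with k(i) in the space of flag \<open>i\<close>. The ring is left open so that the entries of y
  may also be linear polynomials in a pencil parameter.\<close>

definition line_coeff :: "nat \<Rightarrow> (nat \<Rightarrow> nat) \<Rightarrow> (nat \<Rightarrow> nat \<Rightarrow> nat \<Rightarrow> 'a) \<Rightarrow> (nat \<Rightarrow> 'a) \<Rightarrow>
    nat \<times> nat \<Rightarrow> nat \<times> nat \<Rightarrow> 'a::comm_ring_1" where
  "line_coeff i0 d Ms y e c = (if fst c = i0 then Ms i0 (snd c) (snd e)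
     else if fst c = fst e then (if snd c < d (fst e) then - Ms (fst e) (snd c) (snd e) else - y (snd e))
     else 0)"

definition line_vec :: "nat \<Rightarrow> nat \<Rightarrow> (nat \<Rightarrow> nat) \<Rightarrow> (nat \<Rightarrow> nat \<Rightarrow> nat \<Rightarrow> complex) \<Rightarrow>
    (nat \<times> nat \<Rightarrow> complex) \<Rightarrow> nat \<Rightarrow> complex" where
  "line_vec n i0 d Ms v = (\<lambda>b. \<Sum>a<d i0. v (i0, a) * mrow n (Ms i0) a b)"

lemma finite_line_unknowns: "finite R \<Longrightarrow> finite (line_unknowns R i0 d)"
  by (auto simp: line_unknowns_def)

lemma finite_line_equations: "finite R \<Longrightarrow> finite (line_equations n R i0)"
  by (auto simp: line_equations_def)

lemma card_line_unknowns:
  assumes "finite R" "i0 \<in> R" shows "card (line_unknowns R i0 d) + 1 = (\<Sum>i\<in>R. d i + 1)"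
proof -
  have "card (line_unknowns R i0 d) = (\<Sum>i\<in>R. if i = i0 then d i else Suc (d i))"
    using assms by (auto simp: line_unknowns_def card_SigmaI intro!: sum.cong)
  also have "\<dots> = d i0 + (\<Sum>i\<in>R - {i0}. d i + 1)"
    by (subst sum.remove[OF assms]) (auto intro!: sum.cong)
  finally show ?thesis using sum.remove[OF assms, of "\<lambda>i. d i + 1"] by simp
qed

lemma card_line_equations:
  assumes "i0 \<in> R" shows "card (line_equations n R i0) = (card R - 1) * n"
  using assms by (simp add: line_equations_def card_cartesian_product)

lemma line_coeff_sum:
  fixes Ms :: "nat \<Rightarrow> nat \<Rightarrow> nat \<Rightarrow> 'a::comm_ring_1"
  assumes R: "finite R" "i0 \<in> R" and i: "i \<in> R - {i0}"
  shows "(\<Sum>c\<in>line_unknowns R i0 d. line_coeff i0 d Ms y (i, b) c * v c) =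
    (\<Sum>a<d i0. v (i0, a) * Ms i0 a b) - (v (i, d i) * y b + (\<Sum>a<d i. v (i, a) * Ms i a b))"
proof -
  let ?S = "\<lambda>j. if j = i0 then {..<d j} else {..<Suc (d j)}"
  let ?F = "\<lambda>j a. line_coeff i0 d Ms y (i, b) (j, a) * v (j, a)"
  have "(\<Sum>c\<in>line_unknowns R i0 d. line_coeff i0 d Ms y (i, b) c * v c) = (\<Sum>j\<in>R. \<Sum>a\<in>?S j. ?F j a)"
    unfolding line_unknowns_def using R(1) by (subst sum.Sigma) auto
  also have "\<dots> = (\<Sum>a\<in>?S i0. ?F i0 a) + ((\<Sum>a\<in>?S i. ?F i a) + (\<Sum>j\<in>R - {i0} - {i}. \<Sum>a\<in>?S j. ?F j a))"
    using R i by (simp add: sum.remove[of R i0] sum.remove[of "R - {i0}" i])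
  also have "(\<Sum>j\<in>R - {i0} - {i}. \<Sum>a\<in>?S j. ?F j a) = 0"
    by (intro sum.neutral ballI) (auto simp: line_coeff_def)
  also have "(\<Sum>a\<in>?S i0. ?F i0 a) = (\<Sum>a<d i0. v (i0, a) * Ms i0 a b)"
    by (simp add: line_coeff_def mult.commute)
  also have "(\<Sum>a\<in>?S i. ?F i a) = - (v (i, d i) * y b + (\<Sum>a<d i. v (i, a) * Ms i a b))"
    using i by (simp add: line_coeff_def sum_negf mult.commute)
  finally show ?thesis by simp
qed

text \<open>The hypothesis \<open>y_notin\<close> makes the problem linear: a nonzero vector of one
  of the spaces is never a multiple of \<open>y\<close>, so together with \<open>y\<close> it spans
  every plane through \<open>y\<close> that contains it, and the meeting conditions become
  conditions on the plane modulo \<open>y\<close>.\<close>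

locale line_system =
  fixes n :: nat and R :: "nat set" and i0 :: nat and d :: "nat \<Rightarrow> nat"
    and Ms :: "nat \<Rightarrow> nat \<Rightarrow> nat \<Rightarrow> complex" and y :: "nat \<Rightarrow> complex"
  assumes finR: "finite R" and i0: "i0 \<in> R"
    and inv: "\<And>j. j \<in> R \<Longrightarrow> Defs.invertible_mat n (Ms j)"
    and d_le: "\<And>j. j \<in> R \<Longrightarrow> d j \<le> n"
    and y: "y \<in> cvec n"
    and y_notin: "\<And>j. j \<in> R \<Longrightarrow> y \<notin> flag_space n (Ms j) (d j)"
begin

abbreviation ker :: "(nat \<times> nat \<Rightarrow> complex) \<Rightarrow> bool" where
  "ker \<equiv> in_kernel (line_equations n R i0) (line_unknowns R i0 d) (line_coeff i0 d Ms y)"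

lemma ker_iff:
  "ker v \<longleftrightarrow> (\<forall>i\<in>R - {i0}. \<forall>b. line_vec n i0 d Ms v b =
     v (i, d i) * y b + (\<Sum>a<d i. v (i, a) * mrow n (Ms i) a b))"
proof -
  have "ker v \<longleftrightarrow> (\<forall>i\<in>R - {i0}. \<forall>b<n. (\<Sum>c\<in>line_unknowns R i0 d. line_coeff i0 d Ms y (i, b) c * v c) = 0)"
    unfolding in_kernel_def line_equations_def by auto
  also have "\<dots> \<longleftrightarrow> (\<forall>i\<in>R - {i0}. \<forall>b<n. line_vec n i0 d Ms v b =
     v (i, d i) * y b + (\<Sum>a<d i. v (i, a) * mrow n (Ms i) a b))"
    by (intro ball_cong refl all_cong)
      (simp add: line_coeff_sum[OF finR i0] line_vec_def mrow_def)
  also have "\<dots> \<longleftrightarrow> (\<forall>i\<in>R - {i0}. \<forall>b. line_vec n i0 d Ms v b =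
     v (i, d i) * y b + (\<Sum>a<d i. v (i, a) * mrow n (Ms i) a b))"
  proof -
    have "line_vec n i0 d Ms v b = v (i, d i) * y b + (\<Sum>a<d i. v (i, a) * mrow n (Ms i) a b)"
      if "\<not> b < n" for i b
      using y that by (simp add: line_vec_def mrow_def cvec_def)
    then show ?thesis by blast
  qed
  finally show ?thesis .
qed

lemma line_vec_flag: "line_vec n i0 d Ms v \<in> flag_space n (Ms i0) (d i0)"
  unfolding flag_space_iff line_vec_def by (intro exI[of _ "\<lambda>a. v (i0, a)"]) simp

lemma indep_y:
  assumes j: "j \<in> R" and x: "x \<in> flag_space n (Ms j) (d j)" "x \<noteq> (\<lambda>_. 0)"
  shows "lin_indep [x, y]"
  unfolding lin_indep2
proof (intro allI impI)
  fix a b assume ab: "\<forall>j. a * x j + b * y j = 0"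
  have "b = 0"
  proof (rule ccontr)
    assume "b \<noteq> 0"
    then have "y = (\<lambda>j. (- a / b) * x j + 0 * x j)"
      using ab by (intro ext) (simp add: field_simps eq_neg_iff_add_eq_0 add.commute)
    then show False using flag_space_comb[OF x(1) x(1), of "- a / b" 0] y_notin[OF j] by simp
  qed
  then show "a = 0 \<and> b = 0" using ab x(2) by auto
qed

text \<open>If x = 0, an equation reads \<mu>(i) y + k(i) = 0. As \<open>y\<close> lies outside the
  space of k(i), this forces \<mu>(i) = 0, and independence of the rows kills the remaining
  coordinates. So every nonzero solution yields a plane.\<close>

lemma line_vec_nonzero:
  assumes v: "ker v" and c: "c \<in> line_unknowns R i0 d" "v c \<noteq> 0"
  shows "line_vec n i0 d Ms v \<noteq> (\<lambda>_. 0)"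
proof
  assume 0: "line_vec n i0 d Ms v = (\<lambda>_. 0)"
  obtain i a where c': "c = (i, a)" "i \<in> R" by (cases c) (use c in \<open>auto simp: line_unknowns_def\<close>)
  show False
  proof (cases "i = i0")
    case True
    then have "a < d i0" using c c' by (auto simp: line_unknowns_def)
    then have "v (i0, a) = 0"
      using invertible_matD[OF inv[OF i0] d_le[OF i0], of "\<lambda>a. v (i0, a)" a] fun_cong[OF 0]
      by (simp add: line_vec_def)
    then show False using c c' True by simp
  next
    case False
    have eq: "v (i, d i) * y b + (\<Sum>a<d i. v (i, a) * mrow n (Ms i) a b) = 0" for b
      using v[unfolded ker_iff, rule_format, of i b] False c'(2) 0 by simp
    have mu: "v (i, d i) = 0"
    proof (rule ccontr)
      assume nz: "v (i, d i) \<noteq> 0"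
      have "y \<in> flag_space n (Ms i) (d i)"
        using flag_space_solve[where c = "\<lambda>a. v (i, a)" and k = "v (i, d i)" and v = y] eq nz
        by (simp add: add.commute)
      then show False using y_notin[OF c'(2)] by simp
    qed
    have "v (i, a) = 0"
    proof (cases "a = d i")
      case False
      then have "a < d i" using c c' \<open>i \<noteq> i0\<close> by (auto simp: line_unknowns_def)
      then show ?thesis
        using invertible_matD[OF inv[OF c'(2)] d_le[OF c'(2)], of "\<lambda>a. v (i, a)" a] eq mu by simp
    qed (simp add: mu)
    then show False using c c' by simp
  qed
qed

lemma plane_of_kernel:
  assumes v: "ker v" and c: "c \<in> line_unknowns R i0 d" "v c \<noteq> 0"
  shows "cspan [line_vec n i0 d Ms v, y] \<in> grass2 n"
    and "\<And>j. j \<in> R \<Longrightarrow> meets (cspan [line_vec n i0 d Ms v, y]) (flag_space n (Ms j) (d j))"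
proof -
  let ?x = "line_vec n i0 d Ms v"
  have x: "?x \<noteq> (\<lambda>_. 0)" by (rule line_vec_nonzero[OF v c])
  have ind: "lin_indep [?x, y]" by (rule indep_y[OF i0 line_vec_flag x])
  show "cspan [?x, y] \<in> grass2 n"
    unfolding grass2_def using ind y line_vec_flag flag_space_cvec by blast
  fix j assume j: "j \<in> R"
  show "meets (cspan [?x, y]) (flag_space n (Ms j) (d j))"
  proof (cases "j = i0")
    case True
    then show ?thesis unfolding meets_def using x line_vec_flag cspan2_left by blast
  next
    case False
    let ?w = "\<lambda>b. 1 * ?x b + (- v (j, d j)) * y b"
    have "?w b = (\<Sum>a<d j. v (j, a) * mrow n (Ms j) a b)" for b
      using v[unfolded ker_iff, rule_format, of j b] False j by simp
    then have "?w \<in> flag_space n (Ms j) (d j)" unfolding flag_space_iff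
      by (intro exI[of _ "\<lambda>a. v (j, a)"]) simp
    moreover have "?w \<in> cspan [?x, y]" unfolding cspan2
      by (intro exI[of _ 1] exI[of _ "- v (j, d j)"]) simp
    moreover have "?w \<noteq> (\<lambda>_. 0)"
    proof
      assume "?w = (\<lambda>_. 0)"
      then have "1 = (0::complex) \<and> - v (j, d j) = 0"
        by (intro ind[unfolded lin_indep2, rule_format]) (rule fun_cong)
      then show False by simp
    qed
    ultimately show ?thesis unfolding meets_def by blast
  qed
qed

lemma kernel_of_plane:
  assumes X: "X \<in> grass2 n" "y \<in> X"
    and meet: "\<And>j. j \<in> R \<Longrightarrow> meets X (flag_space n (Ms j) (d j))"
  obtains v c where "ker v" "c \<in> line_unknowns R i0 d" "v c \<noteq> 0"
    "X = cspan [line_vec n i0 d Ms v, y]"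
proof -
  obtain x where x: "x \<in> X" "x \<in> flag_space n (Ms i0) (d i0)" "x \<noteq> (\<lambda>_. 0)"
    using meet[OF i0] unfolding meets_def by blast
  have Xeq: "X = cspan [x, y]" by (rule grass2_basis[OF X(1) x(1) X(2) indep_y[OF i0 x(2,3)]])
  obtain v0 where v0: "\<And>b. x b = (\<Sum>a<d i0. v0 a * mrow n (Ms i0) a b)"
    using x(2) unfolding flag_space_iff by blast
  have "\<exists>\<mu> \<nu>. \<forall>b. x b = \<mu> * y b + (\<Sum>a<d i. \<nu> a * mrow n (Ms i) a b)" if i: "i \<in> R" for i
  proof -
    obtain w where w: "w \<in> X" "w \<in> flag_space n (Ms i) (d i)" "w \<noteq> (\<lambda>_. 0)"
      using meet[OF i] unfolding meets_def by blast
    obtain \<alpha> \<beta> where ab: "\<And>b. w b = \<alpha> * x b + \<beta> * y b" using w(1) unfolding Xeq cspan2 by blast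
    obtain \<nu> where nu: "\<And>b. w b = (\<Sum>a<d i. \<nu> a * mrow n (Ms i) a b)"
      using w(2) unfolding flag_space_iff by blast
    \<comment> \<open>Otherwise \<open>w\<close> would be a multiple of \<open>y\<close>. Dividing
      by \<alpha> then produces the normalised relation in which \<open>x\<close> has coefficient
      1.\<close>
    have "\<alpha> \<noteq> 0"
    proof
      assume "\<alpha> = 0"
      then have "\<forall>b. 1 * w b + (- \<beta>) * y b = 0" using ab by simp
      then have "1 = (0::complex) \<and> - \<beta> = 0"
        by (intro indep_y[OF i w(2,3), unfolded lin_indep2, rule_format]) simp
      then show False by simp
    qed
    have "x b = (- \<beta> / \<alpha>) * y b + (\<Sum>a<d i. (\<nu> a / \<alpha>) * mrow n (Ms i) a b)" for b
    proof -
      have "(\<Sum>a<d i. (\<nu> a / \<alpha>) * mrow n (Ms i) a b) = w b / \<alpha>"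
        by (simp add: nu sum_divide_distrib)
      then show ?thesis using \<open>\<alpha> \<noteq> 0\<close> by (simp add: ab field_simps)
    qed
    then show ?thesis by (intro exI[of _ "- \<beta> / \<alpha>"] exI[of _ "\<lambda>a. \<nu> a / \<alpha>"]) simp
  qed
  then obtain \<mu> \<nu> where mn: "\<And>i b. i \<in> R \<Longrightarrow> x b = \<mu> i * y b + (\<Sum>a<d i. \<nu> i a * mrow n (Ms i) a b)"
    by metis
  define v where "v c = (if fst c = i0 then v0 (snd c)
    else if snd c < d (fst c) then \<nu> (fst c) (snd c) else \<mu> (fst c))" for c
  have xv: "line_vec n i0 d Ms v = x" by (auto simp: line_vec_def v_def v0)
  have "ker v" unfolding ker_iff xv using mn by (auto simp: v_def)
  moreover have "\<exists>a<d i0. v (i0, a) \<noteq> 0"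
  proof (rule ccontr)
    assume "\<not> (\<exists>a<d i0. v (i0, a) \<noteq> 0)"
    then have "line_vec n i0 d Ms v = (\<lambda>_. 0)" by (simp add: line_vec_def)
    then show False using xv x(3) by simp
  qed
  then obtain a where "a < d i0" "v (i0, a) \<noteq> 0" by blast
  moreover have "(i0, a) \<in> line_unknowns R i0 d" using i0 \<open>a < d i0\<close> by (simp add: line_unknowns_def)
  ultimately show thesis using that xv Xeq by blast
qed

definition one_dim_ker :: bool where
  "one_dim_ker \<longleftrightarrow> (\<forall>v w c. ker v \<longrightarrow> ker w \<longrightarrow> c \<in> line_unknowns R i0 d \<longrightarrow> v c \<noteq> 0 \<longrightarrow>
     (\<exists>\<kappa>. \<forall>c\<in>line_unknowns R i0 d. w c = \<kappa> * v c))"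

lemma plane_unique:
  assumes one: one_dim_ker
    and X: "X \<in> grass2 n" "y \<in> X" "\<And>j. j \<in> R \<Longrightarrow> meets X (flag_space n (Ms j) (d j))"
    and X': "X' \<in> grass2 n" "y \<in> X'" "\<And>j. j \<in> R \<Longrightarrow> meets X' (flag_space n (Ms j) (d j))"
  shows "X = X'"
proof -
  obtain v c where v: "ker v" "c \<in> line_unknowns R i0 d" "v c \<noteq> 0" "X = cspan [line_vec n i0 d Ms v, y]"
    by (rule kernel_of_plane[OF X]) auto
  obtain w c' where w: "ker w" "c' \<in> line_unknowns R i0 d" "w c' \<noteq> 0" "X' = cspan [line_vec n i0 d Ms w, y]"
    by (rule kernel_of_plane[OF X']) auto
  obtain \<kappa> where \<kappa>: "\<forall>c\<in>line_unknowns R i0 d. w c = \<kappa> * v c"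
    using one v w unfolding one_dim_ker_def by blast
  have "line_vec n i0 d Ms w = (\<lambda>b. \<kappa> * line_vec n i0 d Ms v b)"
    using \<kappa> i0 by (auto simp: line_vec_def line_unknowns_def sum_distrib_left mult.assoc intro!: sum.cong)
  then have "line_vec n i0 d Ms w \<in> X" unfolding v(4) cspan2
    by (intro exI[of _ \<kappa>] exI[of _ 0]) simp
  moreover have "lin_indep [line_vec n i0 d Ms w, y]"
    by (rule indep_y[OF i0 line_vec_flag line_vec_nonzero[OF w(1-3)]])
  ultimately show ?thesis using grass2_basis[OF X(1) _ X(2)] w(4) by blast
qed

text \<open>Conjugation preserves the kernel of a real system. If the kernel is a line, a kernel
  vector scaled to have one coordinate equal to 1 is its own conjugate, and it provides a real
  generator besides \<open>y\<close>.\<close>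

lemma plane_real:
  assumes one: one_dim_ker
    and real: "\<And>j a b. j \<in> R \<Longrightarrow> Ms j a b \<in> \<real>" "\<And>b. y b \<in> \<real>"
    and X: "X \<in> grass2 n" "y \<in> X" "\<And>j. j \<in> R \<Longrightarrow> meets X (flag_space n (Ms j) (d j))"
  shows "real_point X"
proof -
  obtain v c where v: "ker v" "c \<in> line_unknowns R i0 d" "v c \<noteq> 0" "X = cspan [line_vec n i0 d Ms v, y]"
    by (rule kernel_of_plane[OF X]) auto
  define u where "u c' = (1 / v c) * v c' + 0 * v c'" for c'
  have u: "ker u" unfolding u_def by (rule in_kernel_comb[OF v(1) v(1)])
  have uc: "u c = 1" using v(3) by (simp add: u_def)
  have "ker (\<lambda>c. cnj (u c))"
    unfolding in_kernel_def
  proof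
    fix e assume e: "e \<in> line_equations n R i0"
    then have "fst e \<in> R" by (auto simp: line_equations_def)
    then have "cnj (line_coeff i0 d Ms y e c) = line_coeff i0 d Ms y e c" for c
      using real i0 by (auto simp: line_coeff_def Reals_cnj_iff)
    then have "(\<Sum>c\<in>line_unknowns R i0 d. line_coeff i0 d Ms y e c * cnj (u c)) =
        cnj (\<Sum>c\<in>line_unknowns R i0 d. line_coeff i0 d Ms y e c * u c)" by simp
    also have "\<dots> = 0" using u e unfolding in_kernel_def by simp
    finally show "(\<Sum>c\<in>line_unknowns R i0 d. line_coeff i0 d Ms y e c * cnj (u c)) = 0" .
  qed
  then obtain \<kappa> where \<kappa>: "\<forall>c\<in>line_unknowns R i0 d. cnj (u c) = \<kappa> * u c"
    using one u v(2) uc unfolding one_dim_ker_def by (metis zero_neq_one)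
  have "\<kappa> = 1" using bspec[OF \<kappa> v(2)] uc by simp
  then have "u c \<in> \<real>" if "c \<in> line_unknowns R i0 d" for c
    using \<kappa> that by (simp add: Reals_cnj_iff)
  then have ru: "line_vec n i0 d Ms u b \<in> \<real>" for b
    using real(1)[OF i0] i0 by (auto simp: line_vec_def line_unknowns_def mrow_def intro!: sum_in_Reals)
  have "line_vec n i0 d Ms u = (\<lambda>b. (1 / v c) * line_vec n i0 d Ms v b)"
    by (auto simp: line_vec_def u_def sum_divide_distrib)
  then have "line_vec n i0 d Ms u \<in> X" unfolding v(4) cspan2
    by (intro exI[of _ "1 / v c"] exI[of _ 0]) simp
  moreover have "lin_indep [line_vec n i0 d Ms u, y]"
    using uc by (intro indep_y[OF i0 line_vec_flag line_vec_nonzero[OF u v(2)]]) simp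
  ultimately have "X = cspan [line_vec n i0 d Ms u, y]" using grass2_basis[OF X(1) _ X(2)] by blast
  then show ?thesis unfolding real_point_def using ru real(2) by blast
qed

end

subsection \<open>Osculating flags and polynomials\<close>

text \<open>This identifies \<open>\<complex>\<^sup>N\<^sup>+\<^sup>1\<close> with the polynomials of degree at most \<open>N\<close> in such a way that
  \<open>K\<^sub>d(s)\<close> corresponds to the multiples of \<open>(z - s)\<^sup>N\<^sup>+\<^sup>1\<^sup>-\<^sup>d\<close>.\<close>

definition vec_poly :: "nat \<Rightarrow> (nat \<Rightarrow> complex) \<Rightarrow> complex poly" where
  "vec_poly N v = (\<Sum>j\<le>N. monom ((- 1) ^ j * of_nat (N choose j) * v j) (N - j))"

lemma vec_poly_comb:
  "vec_poly N (\<lambda>j. a * u j + b * v j) = Polynomial.smult a (vec_poly N u) + Polynomial.smult b (vec_poly N v)"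
  by (simp add: vec_poly_def smult_sum2 sum.distrib[symmetric] smult_monom add_monom algebra_simps)

lemma vec_poly_sum:
  "vec_poly N (\<lambda>j. \<Sum>a\<in>I. c a * w a j) = (\<Sum>a\<in>I. Polynomial.smult (c a) (vec_poly N (w a)))"
proof (induction I rule: infinite_finite_induct)
  case (insert x F)
  then show ?case using vec_poly_comb[of N "c x" "w x" 1 "\<lambda>j. \<Sum>a\<in>F. c a * w a j"] by simp
qed (simp_all add: vec_poly_def)

lemma degree_vec_poly: "degree (vec_poly N v) \<le> N"
  unfolding vec_poly_def by (intro degree_sum_le) (auto intro: order.trans[OF degree_monom_le])

lemma coeff_vec_poly:
  assumes "j \<le> N" shows "coeff (vec_poly N v) (N - j) = (- 1) ^ j * of_nat (N choose j) * v j"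
proof -
  have "coeff (vec_poly N v) (N - j) =
      (\<Sum>i\<le>N. if i = j then (- 1) ^ j * of_nat (N choose j) * v j else 0)"
    unfolding vec_poly_def coeff_sum coeff_monom using assms by (intro sum.cong) auto
  then show ?thesis using assms by simp
qed

lemma vec_poly_inj:
  assumes "vec_poly N u = vec_poly N v" "u \<in> cvec (Suc N)" "v \<in> cvec (Suc N)"
  shows "u = v"
proof
  fix j show "u j = v j"
  proof (cases "j \<le> N")
    case True
    then have "(- 1) ^ j * of_nat (N choose j) * u j = (- 1) ^ j * of_nat (N choose j) * v j"
      using coeff_vec_poly[OF True, of u] coeff_vec_poly[OF True, of v] assms(1) by simp
    then show ?thesis using True by simp
  qed (use assms in \<open>simp add: cvec_def\<close>)
qed

lemma vec_poly_0: "vec_poly N (\<lambda>_. 0) = 0"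
  by (simp add: vec_poly_def)

lemma vec_poly_surj:
  assumes "degree p \<le> N"
  obtains v where "v \<in> cvec (Suc N)" "vec_poly N v = p"
proof -
  define v where "v j = (if j \<le> N then coeff p (N - j) / ((- 1) ^ j * of_nat (N choose j)) else 0)" for j
  have "vec_poly N v = p"
  proof (rule poly_eqI)
    fix k
    show "coeff (vec_poly N v) k = coeff p k"
    proof (cases "k \<le> N")
      case True
      then show ?thesis using coeff_vec_poly[of "N - k" N v] by (simp add: v_def)
    next
      case False
      then show ?thesis using assms degree_vec_poly[of N v] by (simp add: coeff_eq_0)
    qed
  qed
  moreover have "v \<in> cvec (Suc N)" by (simp add: v_def cvec_def)
  ultimately show thesis using that by blast
qed

text \<open>The weights in \<open>vec_poly\<close> are made for this:
  \<open>(N choose j) * (j choose i)\<close> equals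
  \<open>(N choose i) * ((N - i) choose (j - i))\<close>, and what remains is the binomial theorem
  for (z - s)^(N - i).\<close>

lemma vec_poly_osc_row:
  assumes i: "i \<le> N"
  shows "vec_poly N (mrow (Suc N) (osc_mat s) i) =
    Polynomial.smult ((- 1) ^ i * of_nat (N choose i)) ([:- of_real s, 1:] ^ (N - i))"
proof (rule poly_ext)
  fix z :: complex
  let ?s = "of_real s :: complex"
  let ?g = "\<lambda>j. (- 1) ^ j * of_nat (N choose j) * (of_nat (j choose i) * ?s ^ (j - i)) * z ^ (N - j)"
  have "poly (vec_poly N (mrow (Suc N) (osc_mat s) i)) z = (\<Sum>j\<le>N. ?g j)"
    unfolding vec_poly_def poly_sum poly_monom
    by (intro sum.cong) (auto simp: mrow_def osc_mat_def)
  also have "\<dots> = (\<Sum>j\<in>{i..N}. ?g j)"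
    by (intro sum.mono_neutral_right) auto
  also have "\<dots> = (\<Sum>l\<le>N - i. ?g (l + i))"
    by (intro sum.reindex_bij_witness[of _ "\<lambda>l. l + i" "\<lambda>j. j - i"]) (use i in auto)
  also have "\<dots> = (\<Sum>l\<le>N - i. ((- 1) ^ i * of_nat (N choose i)) *
      (of_nat ((N - i) choose l) * (- ?s) ^ l * z ^ (N - i - l)))"
  proof (intro sum.cong refl)
    fix l assume l: "l \<in> {..N - i}"
    have "(N choose (l + i)) * ((l + i) choose i) = (N choose i) * ((N - i) choose l)"
      using choose_mult[of i "l + i" N] l i by simp
    then have "of_nat (N choose (l + i)) * of_nat ((l + i) choose i) =
        (of_nat (N choose i) * of_nat ((N - i) choose l) :: complex)"
      by (metis of_nat_mult)
    moreover have "?g (l + i) = (- 1) ^ i * ((- 1) ^ l * ?s ^ l) *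
        (of_nat (N choose (l + i)) * of_nat ((l + i) choose i)) * z ^ (N - i - l)"
      by (simp add: power_add mult_ac add.commute[of l i] diff_diff_left[symmetric] del: diff_diff_left)
    ultimately show "?g (l + i) = ((- 1) ^ i * of_nat (N choose i)) *
      (of_nat ((N - i) choose l) * (- ?s) ^ l * z ^ (N - i - l))"
      by (simp add: power_minus[of ?s] mult_ac)
  qed
  also have "\<dots> = ((- 1) ^ i * of_nat (N choose i)) * (- ?s + z) ^ (N - i)"
    by (simp only: binomial_ring[of "- ?s" z] sum_distrib_left)
  finally show "poly (vec_poly N (mrow (Suc N) (osc_mat s) i)) z =
      poly (Polynomial.smult ((- 1) ^ i * of_nat (N choose i)) ([:- ?s, 1:] ^ (N - i))) z" by simp
qed

lemma shifted_power_expansion: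
  fixes q :: "complex poly"
  assumes "degree q < d"
  shows "\<exists>e. q = (\<Sum>k<d. Polynomial.smult (e k) ([:- s, 1:] ^ k))"
  using assms
proof (induction d arbitrary: q)
  case (Suc d)
  let ?q = "synthetic_div q s"
  have div: "q = [:- s, 1:] * ?q + [:poly q s:]"
    using synthetic_div_correct'[of s q] by simp
  have "\<exists>e. ?q = (\<Sum>k<d. Polynomial.smult (e k) ([:- s, 1:] ^ k))"
  proof (cases "degree q = 0")
    case True
    then have "?q = 0" by (simp add: synthetic_div_eq_0_iff)
    then show ?thesis by (intro exI[of _ "\<lambda>_. 0"]) simp
  next
    case False
    then have "degree ?q < d" using Suc.prems by (simp add: degree_synthetic_div)
    then show ?thesis by (rule Suc.IH)
  qed
  then obtain e where e: "?q = (\<Sum>k<d. Polynomial.smult (e k) ([:- s, 1:] ^ k))" by blast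
  have "q = (\<Sum>k<Suc d. Polynomial.smult (case_nat (poly q s) e k) ([:- s, 1:] ^ k))"
    unfolding sum.lessThan_Suc_shift
    by (subst div, subst e) (simp add: sum_distrib_left one_pCons mult_smult_right del: mult_pCons_left)
  then show ?case by blast
qed simp

lemma osc_flag_iff:
  assumes v: "v \<in> cvec (Suc N)" and d: "d \<le> Suc N"
  shows "v \<in> flag_space (Suc N) (osc_mat s) d \<longleftrightarrow> [:- of_real s, 1:] ^ (Suc N - d) dvd vec_poly N v"
proof
  let ?L = "[:- of_real s, 1:] :: complex poly"
  assume "v \<in> flag_space (Suc N) (osc_mat s) d"
  then obtain c where c: "\<And>j. v j = (\<Sum>a<d. c a * mrow (Suc N) (osc_mat s) a j)"
    unfolding flag_space_iff by blast
  then have "v = (\<lambda>j. \<Sum>a<d. c a * mrow (Suc N) (osc_mat s) a j)" by (intro ext)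
  then have vp: "vec_poly N v = (\<Sum>a<d. Polynomial.smult (c a) (vec_poly N (mrow (Suc N) (osc_mat s) a)))"
    using vec_poly_sum by simp
  show "?L ^ (Suc N - d) dvd vec_poly N v"
    unfolding vp
  proof (intro dvd_sum dvd_smult)
    fix a assume "a \<in> {..<d}"
    then show "?L ^ (Suc N - d) dvd vec_poly N (mrow (Suc N) (osc_mat s) a)"
      using d by (subst vec_poly_osc_row) (auto intro!: dvd_smult le_imp_power_dvd)
  qed
next
  let ?L = "[:- of_real s, 1:] :: complex poly"
  assume "?L ^ (Suc N - d) dvd vec_poly N v"
  then obtain q where q: "vec_poly N v = ?L ^ (Suc N - d) * q" by (elim dvdE)
  have "\<exists>e. q = (\<Sum>k<d. Polynomial.smult (e k) (?L ^ k))"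
  proof (cases "q = 0")
    case True then show ?thesis by (intro exI[of _ "\<lambda>_. 0"]) simp
  next
    case False
    have "degree (?L ^ (Suc N - d) * q) = degree (?L ^ (Suc N - d)) + degree q"
      using False by (intro degree_mult_eq) auto
    then have "degree q < d" using degree_vec_poly[of N v] d unfolding q by (simp add: degree_linear_power)
    then show ?thesis by (rule shifted_power_expansion)
  qed
  then obtain e where e: "q = (\<Sum>k<d. Polynomial.smult (e k) (?L ^ k))" by blast
  \<comment> \<open>Row \<open>a\<close> has exponent \<open>N - a\<close>, so the powers are
    traversed backwards; the denominator cancels the constant of
    \<open>vec_poly_osc_row\<close>.\<close>
  define c where "c a = e (d - 1 - a) / ((- 1) ^ a * of_nat (N choose a))" for a
  have "vec_poly N v = (\<Sum>k<d. Polynomial.smult (e k) (?L ^ (Suc N - d + k)))"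
    by (simp only: q e sum_distrib_left mult_smult_right power_add)
  also have "\<dots> = (\<Sum>a<d. Polynomial.smult (e (d - 1 - a)) (?L ^ (N - a)))"
    by (rule sum.reindex_bij_witness[of _ "\<lambda>a. d - 1 - a" "\<lambda>k. d - 1 - k"])
      (use d in \<open>auto intro!: arg_cong2[where f = Polynomial.smult] arg_cong2[where f = "(^)"]\<close>)
  also have "\<dots> = (\<Sum>a<d. Polynomial.smult (c a) (vec_poly N (mrow (Suc N) (osc_mat s) a)))"
    using d by (intro sum.cong refl) (simp add: vec_poly_osc_row c_def)
  also have "\<dots> = vec_poly N (\<lambda>j. \<Sum>a<d. c a * mrow (Suc N) (osc_mat s) a j)"
    by (simp add: vec_poly_sum)
  finally have "v = (\<lambda>j. \<Sum>a<d. c a * mrow (Suc N) (osc_mat s) a j)"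
    using v by (rule vec_poly_inj) (simp add: cvec_def mrow_def)
  then show "v \<in> flag_space (Suc N) (osc_mat s) d" unfolding flag_space_iff
    by (intro exI[of _ c]) (simp add: fun_eq_iff)
qed

text \<open>Row \<open>a\<close> starts at column \<open>a\<close> with the entry 1, so the columns
  can be solved one after the other.\<close>

lemma osc_mat_invertible: "Defs.invertible_mat n (osc_mat s)"
  unfolding invertible_mat_kernel trivial_kernel_def
proof (intro allI impI)
  fix c assume c: "in_kernel {..<n} {..<n} (\<lambda>b a. osc_mat s a b) c"
  have "c i = 0" if "i < n" for i
    using that
  proof (induction i rule: less_induct)
    case (less i)
    have "0 = (\<Sum>a<n. osc_mat s a i * c a)" using c less.prems by (auto simp: in_kernel_def)
    also have "\<dots> = (\<Sum>a<n. if a = i then c i else 0)"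
      using less by (intro sum.cong) (auto simp: osc_mat_def not_less_iff_gr_or_eq)
    finally show ?case using less.prems by simp
  qed
  then show "\<forall>i\<in>{..<n}. c i = 0" by simp
qed

section \<open>Multiplicities, derivatives and rigidity by the Wronskian\<close>

lemma prod_linear_powers_dvd:
  fixes p :: "complex poly"
  assumes "finite I" "inj_on s I" "\<And>i. i \<in> I \<Longrightarrow> [:- s i, 1:] ^ c i dvd p"
  shows "(\<Prod>i\<in>I. [:- s i, 1:] ^ c i) dvd p"
  using assms
proof (induction I rule: finite_induct)
  case (insert a I)
  let ?P = "\<Prod>i\<in>I. [:- s i, 1:] ^ c i"
  have "?P dvd p" using insert by auto
  then obtain q where q: "p = ?P * q" by (elim dvdE)
  have "poly ?P (s a) \<noteq> 0" using insert by (auto simp: poly_prod)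
  then have o: "order (s a) ?P = 0" "?P \<noteq> 0" by (auto simp: order_0I)
  have "[:- s a, 1:] ^ c a dvd ?P * q" using insert.prems(2)[of a] q by simp
  then have "[:- s a, 1:] ^ c a dvd q" using o by (cases "q = 0") (simp_all add: order_divides order_mult)
  then have "[:- s a, 1:] ^ c a * ?P dvd q * ?P" by (rule mult_dvd_mono) simp
  then show ?case using insert(1,2) q by (simp add: mult.commute)
qed simp

lemma degree_prod_linear_powers:
  fixes s :: "'i \<Rightarrow> complex"
  assumes "finite I" shows "degree (\<Prod>i\<in>I. [:- s i, 1:] ^ c i) = (\<Sum>i\<in>I. c i)"
  using assms by (subst degree_prod_eq_sum_degree) (auto simp: degree_linear_power)

lemma poly_zero_by_multiplicities:
  fixes p :: "complex poly"
  assumes "finite I" "inj_on s I" "\<And>i. i \<in> I \<Longrightarrow> [:- s i, 1:] ^ c i dvd p"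
    and deg: "degree p < (\<Sum>i\<in>I. c i)"
  shows "p = 0"
  using dvd_imp_degree_le[OF prod_linear_powers_dvd[OF assms(1-3)]]
    degree_prod_linear_powers[OF assms(1), of s c] deg by fastforce

text \<open>The extra factor z - a avoids the exponent \<open>k - 1\<close>, so that
  \<open>k = 0\<close> is no exception.\<close>

lemma pderiv_linear_power:
  fixes a :: complex
  shows "pderiv ([:- a, 1:] ^ k) * [:- a, 1:] = Polynomial.smult (of_nat k) ([:- a, 1:] ^ k)"
  by (cases k) (simp_all only: pderiv_power_Suc power_0 pderiv_1, simp_all add: pderiv_pCons mult.commute)

lemma power_dvd_pderiv:
  assumes "P ^ Suc k dvd F" shows "P ^ k dvd pderiv F"
proof -
  obtain q where q: "F = P ^ Suc k * q" using assms by (elim dvdE)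
  have "pderiv F = P ^ k * (P * pderiv q + Polynomial.smult (of_nat (Suc k)) (q * pderiv P))"
    unfolding q pderiv_mult pderiv_power_Suc by (simp add: algebra_simps del: of_nat_Suc)
  then show ?thesis by simp
qed

text \<open>The Wronskian of \<open>F\<close> and \<open>(z - s0)\<^sup>N\<close> is divisible by \<open>(z - s0)\<^sup>N\<^sup>-\<^sup>1\<close>, and the quotient \<open>W\<close> has
  too many zeros.\<close>

lemma wronskian_rigidity:
  fixes F :: "complex poly"
  assumes deg: "degree F \<le> N" and I: "finite I" "inj_on s I" and N: "N \<ge> 1"
    and c: "N \<le> (\<Sum>i\<in>I. c i)"
    and dv: "\<And>i. i \<in> I \<Longrightarrow> \<exists>\<mu>. [:- s i, 1:] ^ Suc (c i) dvd F - Polynomial.smult \<mu> ([:- s0, 1:] ^ N)"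
  shows "\<exists>\<kappa>. F = Polynomial.smult \<kappa> ([:- s0, 1:] ^ N)"
proof -
  let ?L = "[:- s0, 1:]"
  define W where "W G = pderiv G * ?L - Polynomial.smult (of_nat N) G" for G :: "complex poly"
  \<comment> \<open>The terms of degree \<open>N\<close> cancel: each summand contributes
    \<open>N\<close> times the coefficient of \<open>F\<close>.\<close>
  have degW: "degree (W F) < N"
  proof -
    have "degree (W F) \<le> N"
      unfolding W_def
    proof (intro degree_diff_le)
      show "degree (pderiv F * ?L) \<le> N"
        using degree_mult_le[of "pderiv F" ?L] degree_pderiv[of F] deg N by simp
    qed (use deg degree_smult_le[of "of_nat N" F] in linarith)
    moreover have "coeff (W F) N = 0"
    proof -
      obtain M where M: "N = Suc M" using N by (cases N) auto
      have "coeff (pderiv F) N = 0" using deg by (simp add: coeff_pderiv coeff_eq_0)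
      then show ?thesis by (simp add: W_def M coeff_pderiv del: of_nat_Suc)
    qed
    ultimately show ?thesis
    proof (cases "W F = 0")
      case False
      then have "degree (W F) \<noteq> N" using \<open>coeff (W F) N = 0\<close> leading_coeff_0_iff[of "W F"] by auto
      then show ?thesis using \<open>degree (W F) \<le> N\<close> by simp
    qed (use N in simp)
  qed
  note dL = pderiv_linear_power[of s0]
  have WL: "W (?L ^ N) = 0" by (simp only: W_def dL diff_self)
  have Wlin: "W (G - Polynomial.smult \<mu> H) = W G - Polynomial.smult \<mu> (W H)" for G H \<mu>
    by (simp add: W_def pderiv_diff pderiv_smult left_diff_distrib smult_diff_right mult.commute[of "of_nat N"]
        del: mult_pCons_left mult_pCons_right)
  \<comment> \<open>\<open>W\<close> annihilates (z - s0)^N, so a contact of order c(i) + 1 with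
    some multiple of that power becomes a zero of order c(i) of \<open>W F\<close>; one order is
    lost to differentiation.\<close>
  have "W F = 0"
  proof (rule poly_zero_by_multiplicities[OF I])
    fix i assume i: "i \<in> I"
    obtain \<mu> where \<mu>: "[:- s i, 1:] ^ Suc (c i) dvd F - Polynomial.smult \<mu> (?L ^ N)" using dv[OF i] by blast
    have "[:- s i, 1:] ^ c i dvd W (F - Polynomial.smult \<mu> (?L ^ N))"
      unfolding W_def
      by (intro dvd_diff dvd_mult2 dvd_smult power_dvd_pderiv[OF \<mu>] dvd_trans[OF _ \<mu>] le_imp_power_dvd) simp
    then show "[:- s i, 1:] ^ c i dvd W F" using Wlin[of F \<mu> "?L ^ N"] WL by simp
  qed (use degW c in simp)
  show ?thesis
  proof (cases "F = 0")
    case False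
    \<comment> \<open>\<open>W F = 0\<close> is an Euler equation: once the exact power of z - s0 is
      split off from \<open>F\<close>, evaluation at \<open>s0\<close> forces r = N, and then the
      cofactor has derivative 0.\<close>
    define r where "r = order s0 F"
    obtain q where q: "F = ?L ^ r * q" "\<not> ?L dvd q"
      using order_decomp[OF False, of s0] unfolding r_def by blast
    have "W F = (?L ^ r * pderiv q + q * pderiv (?L ^ r)) * ?L - Polynomial.smult (of_nat N) (?L ^ r * q)"
      by (simp only: W_def q(1) pderiv_mult)
    also have "\<dots> = ?L ^ r * (pderiv q * ?L) + q * (pderiv (?L ^ r) * ?L) - Polynomial.smult (of_nat N) (?L ^ r * q)"
      by (simp only: distrib_right mult.assoc)
    also have "\<dots> = ?L ^ r * (Polynomial.smult (of_nat r - of_nat N) q + pderiv q * ?L)"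
      by (simp only: dL smult_diff_left distrib_left right_diff_distrib mult_smult_right mult.commute[of q])
        simp
    finally have z: "Polynomial.smult (of_nat r - of_nat N) q + pderiv q * ?L = 0" using \<open>W F = 0\<close> by simp
    have "poly (Polynomial.smult (of_nat r - of_nat N) q + pderiv q * ?L) s0 = 0" by (simp only: z poly_0)
    moreover have "poly q s0 \<noteq> 0" using q(2) by (simp add: poly_eq_0_iff_dvd)
    ultimately have "r = N" by simp
    then have "pderiv q = 0" using z by (simp del: mult_pCons_right)
    then obtain \<kappa> where "q = [:\<kappa>:]" by (auto simp: pderiv_eq_0_iff elim: degree_eq_zeroE)
    then show ?thesis using q(1) \<open>r = N\<close> by (intro exI[of _ \<kappa>]) simp
  qed (auto intro: exI[of _ 0])
qed

subsection \<open>Critical points and osculating planes\<close>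

text \<open>Rolle's theorem in each gap between consecutive zeros. Multiple zeros of
  \<open>P\<close> are critical too, but only critical points off the zeros are wanted, since
  \<open>wronskian_contact\<close> needs w \<noteq> \<tau>.\<close>

lemma critical_points_between_roots:
  fixes P :: "real poly"
  assumes S: "finite S" "S \<noteq> {}" "\<And>x. poly P x = 0 \<longleftrightarrow> x \<in> S"
  obtains T where "finite T" "card T = card S - 1"
    "\<And>t. t \<in> T \<Longrightarrow> poly (pderiv P) t = 0 \<and> poly P t \<noteq> 0"
proof -
  define nx where "nx s = Min {x \<in> S. s < x}" for s
  have nx: "nx s \<in> S" "s < nx s" "\<And>x. x \<in> S \<Longrightarrow> s < x \<Longrightarrow> nx s \<le> x" if "s \<in> S - {Max S}" for s
  proof -
    have "s \<le> Max S" "Max S \<in> S" "s \<noteq> Max S" using S(1,2) that by auto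
    then have "Max S \<in> {x \<in> S. s < x}" by simp
    then have "{x \<in> S. s < x} \<noteq> {}" by blast
    then have "nx s \<in> {x \<in> S. s < x}" unfolding nx_def using S(1) by (intro Min_in) simp_all
    then show "nx s \<in> S" "s < nx s" by auto
    show "nx s \<le> x" if "x \<in> S" "s < x" for x unfolding nx_def using S that by (intro Min_le) auto
  qed
  have "\<exists>t. s < t \<and> t < nx s \<and> poly (pderiv P) t = 0" if s: "s \<in> S - {Max S}" for s
  proof -
    obtain t where "s < t" "t < nx s" "poly P (nx s) - poly P s = (nx s - s) * poly (pderiv P) t"
      using poly_MVT[OF nx(2)[OF s], of P] by blast
    moreover have "poly P (nx s) = 0" "poly P s = 0" using S(3) nx(1)[OF s] s by auto
    ultimately show ?thesis using nx(2)[OF s] by auto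
  qed
  then obtain t where t: "\<And>s. s \<in> S - {Max S} \<Longrightarrow> s < t s \<and> t s < nx s \<and> poly (pderiv P) (t s) = 0"
    by metis
  have lt: "t s < t s'" if "s \<in> S - {Max S}" "s' \<in> S - {Max S}" "s < s'" for s s'
  proof -
    have "t s < nx s" using t that(1) by blast
    also have "\<dots> \<le> s'" using nx(3)[OF that(1)] that by simp
    also have "\<dots> < t s'" using t that(2) by blast
    finally show ?thesis .
  qed
  have inj: "inj_on t (S - {Max S})"
    by (intro inj_onI) (metis lt less_irrefl linorder_neqE)
  show thesis
  proof (rule that[of "t ` (S - {Max S})"])
    show "card (t ` (S - {Max S})) = card S - 1"
      using S by (simp add: card_image[OF inj] card_Diff_singleton)
    fix u assume "u \<in> t ` (S - {Max S})"
    then obtain s where s: "s \<in> S - {Max S}" "u = t s" by blast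
    have "u \<notin> S" using nx(3)[OF s(1), of u] t[OF s(1)] s(2) by force
    then show "poly (pderiv P) u = 0 \<and> poly P u \<noteq> 0" using S(3) t[OF s(1)] s(2) by blast
  qed (use S in simp)
qed

text \<open>The operator taking h to h' (z - \<tau>) - h multiplies (z - \<tau>)^k by k - 1, so the
  only obstruction is the coefficient of exponent 1 in \<open>Q\<close>, which is
  Q'(\<tau>).\<close>

lemma wronskian_primitive:
  fixes Q :: "complex poly"
  assumes deg: "degree Q \<le> N" and crit: "poly (pderiv Q) \<tau> = 0"
  obtains h where "degree h \<le> N" "pderiv h * [:- \<tau>, 1:] - h = Q"
proof -
  let ?L = "[:- \<tau>, 1:]"
  obtain e where e: "Q = (\<Sum>k<Suc N. Polynomial.smult (e k) (?L ^ k))"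
    using shifted_power_expansion[of Q "Suc N" \<tau>] deg by auto
  note dL = pderiv_linear_power[of \<tau>]
  have pdL: "poly (pderiv (?L ^ k)) \<tau> = (if k = 1 then 1 else 0)" for k
    by (cases k) (simp_all only: pderiv_power_Suc power_0 pderiv_1, simp_all add: pderiv_pCons)
  have e1: "N \<ge> 1 \<Longrightarrow> e 1 = 0"
  proof -
    assume N: "N \<ge> 1"
    have "poly (pderiv Q) \<tau> = (\<Sum>k<Suc N. e k * poly (pderiv (?L ^ k)) \<tau>)"
      unfolding e by (simp add: pderiv_sum pderiv_smult poly_sum del: sum.lessThan_Suc)
    also have "\<dots> = (\<Sum>k<Suc N. if k = 1 then e 1 else 0)"
      by (intro sum.cong) (auto simp: pdL)
    also have "\<dots> = e 1" using N by (simp add: sum.delta del: sum.lessThan_Suc)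
    finally show "e 1 = 0" using crit by simp
  qed
  \<comment> \<open>At k = 1 the division by 0 yields 0, which is harmless because
    \<open>e 1 = 0\<close>.\<close>
  define h where "h = (\<Sum>k<Suc N. Polynomial.smult (e k / (of_nat k - 1)) (?L ^ k))"
  have "degree h \<le> N"
    unfolding h_def
  proof (intro degree_sum_le)
    fix k assume "k \<in> {..<Suc N}"
    then show "degree (Polynomial.smult (e k / (of_nat k - 1)) (?L ^ k)) \<le> N"
      using degree_smult_le[of "e k / (of_nat k - 1)" "?L ^ k"] by (simp add: degree_linear_power)
  qed simp
  moreover have "pderiv h * ?L - h = Q"
  proof -
    have "pderiv h * ?L = (\<Sum>k<Suc N. Polynomial.smult (e k / (of_nat k - 1)) (pderiv (?L ^ k) * ?L))"
      unfolding h_def pderiv_sum sum_distrib_right pderiv_smult mult_smult_left ..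
    then have "pderiv h * ?L - h = (\<Sum>k<Suc N. Polynomial.smult (e k / (of_nat k - 1)) (Polynomial.smult (of_nat k) (?L ^ k))
        - Polynomial.smult (e k / (of_nat k - 1)) (?L ^ k))"
      unfolding dL h_def by (simp only: sum_subtractf)
    also have "\<dots> = Q"
      unfolding e
    proof (intro sum.cong refl)
      fix k assume k: "k \<in> {..<Suc N}"
      have "Polynomial.smult (e k / (of_nat k - 1)) (Polynomial.smult (of_nat k) (?L ^ k))
        - Polynomial.smult (e k / (of_nat k - 1)) (?L ^ k)
        = Polynomial.smult (e k / (of_nat k - 1) * (of_nat k - 1)) (?L ^ k)"
        by (simp add: smult_diff_left[symmetric] right_diff_distrib)
      also have "e k / (of_nat k - 1) * (of_nat k - 1) = e k"
        using e1 k by (cases "k = 1") auto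
      finally show "Polynomial.smult (e k / (of_nat k - 1)) (Polynomial.smult (of_nat k) (?L ^ k))
        - Polynomial.smult (e k / (of_nat k - 1)) (?L ^ k) = Polynomial.smult (e k) (?L ^ k)" .
    qed
    finally show ?thesis .
  qed
  ultimately show thesis using that by blast
qed

text \<open>Subtracting a multiple of z - \<tau> from \<open>h\<close> leaves the Wronskian
  unchanged, so \<open>h\<close> may be replaced by some G that vanishes at \<open>w\<close>. Since
  z - \<tau> is nonzero at \<open>w\<close>, the equation G' (z - \<tau>) = G + Q then raises the
  order of G at \<open>w\<close> step by step up to c + 1.\<close>

lemma wronskian_contact:
  fixes h :: "complex poly"
  assumes Q: "pderiv h * [:- \<tau>, 1:] - h = Q" and dv: "[:- w, 1:] ^ c dvd Q" and w: "w \<noteq> \<tau>"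
  shows "\<exists>\<mu>. [:- w, 1:] ^ Suc c dvd h - Polynomial.smult \<mu> [:- \<tau>, 1:]"
proof -
  define L where "L = [:- \<tau>, 1:]"
  define P where "P = [:- w, 1:]"
  define G where "G = h - Polynomial.smult (poly h w / (w - \<tau>)) L"
  have Pd: "P dvd F \<longleftrightarrow> poly F w = 0" for F by (simp add: P_def poly_eq_0_iff_dvd)
  have P0: "P \<noteq> 0" by (simp add: P_def)
  have dP: "pderiv P = 1" "pderiv L = 1" by (simp_all add: P_def L_def pderiv_pCons)
  have Lw': "poly L w = w - \<tau>" by (simp add: L_def)
  then have Lw: "poly L w \<noteq> 0" using w by simp
  have GQ: "pderiv G * L - G = Q"
    unfolding Q[symmetric] G_def L_def[symmetric]
    by (simp add: pderiv_diff pderiv_smult dP left_diff_distrib)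
  have "P ^ Suc j dvd G" if "j \<le> c" for j
    using that
  proof (induction j)
    case 0
    then show ?case using w by (simp add: Pd G_def Lw')
  next
    case (Suc j)
    obtain q where q: "G = P ^ Suc j * q" using Suc by (auto elim: dvdE)
    have "P ^ Suc j dvd Q" using dv Suc.prems dvd_trans[OF le_imp_power_dvd[of "Suc j" c P]]
      by (simp add: P_def)
    then have "P ^ Suc j dvd pderiv G * L" using GQ Suc by (metis Suc_leD diff_add_cancel dvd_add)
    moreover have "pderiv G * L = P ^ j * ((P * pderiv q + Polynomial.smult (of_nat (Suc j)) q) * L)"
      unfolding q pderiv_mult pderiv_power_Suc dP by (simp add: algebra_simps del: of_nat_Suc)
    ultimately have "P dvd (P * pderiv q + Polynomial.smult (of_nat (Suc j)) q) * L"
      using P0 by (simp add: mult.commute[of P])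
    then have "poly ((P * pderiv q + Polynomial.smult (of_nat (Suc j)) q) * L) w = 0" by (simp only: Pd)
    then have "poly q w = 0" using Lw by (simp add: P_def del: of_nat_Suc)
    then have "P dvd q" by (simp only: Pd)
    then have "P ^ Suc j * P dvd P ^ Suc j * q" by (rule mult_dvd_mono[OF dvd_refl])
    then show ?case by (simp add: q mult_ac)
  qed
  from this[of c] show ?thesis unfolding G_def P_def L_def by blast
qed

text \<open>The substitution \<open>w = 1 / (z - s0)\<close>, which moves the point \<open>s0\<close> to infinity.\<close>

definition invert_at :: "complex \<Rightarrow> nat \<Rightarrow> complex poly \<Rightarrow> complex poly" where
  "invert_at s0 N g = (\<Sum>k\<le>N. Polynomial.smult (coeff g k) ([:- s0, 1:] ^ (N - k)))"

lemma poly_invert_at: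
  assumes "degree g \<le> N" "z \<noteq> s0"
  shows "poly (invert_at s0 N g) z = (z - s0) ^ N * poly g (1 / (z - s0))"
proof -
  have "poly (invert_at s0 N g) z = (\<Sum>k\<le>N. coeff g k * (z - s0) ^ (N - k))"
    by (simp add: invert_at_def poly_sum)
  also have "\<dots> = (\<Sum>k\<le>N. (z - s0) ^ N * (coeff g k * (1 / (z - s0)) ^ k))"
    using assms(2) by (intro sum.cong) (auto simp: power_diff power_one_over)
  also have "\<dots> = (z - s0) ^ N * (\<Sum>k\<le>N. coeff g k * (1 / (z - s0)) ^ k)"
    by (simp add: sum_distrib_left)
  also have "(\<Sum>k\<le>N. coeff g k * (1 / (z - s0)) ^ k) = poly g (1 / (z - s0))"
    unfolding poly_altdef using assms(1)
    by (intro sum.mono_neutral_right) (auto simp: coeff_eq_0)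
  finally show ?thesis .
qed

lemma degree_invert_at: "degree (invert_at s0 N g) \<le> N"
  unfolding invert_at_def
proof (intro degree_sum_le)
  fix k
  show "degree (Polynomial.smult (coeff g k) ([:- s0, 1:] ^ (N - k))) \<le> N"
    using degree_smult_le[of "coeff g k" "[:- s0, 1:] ^ (N - k)"] by (simp add: degree_linear_power)
qed simp

lemma invert_at_diff_smult:
  "invert_at s0 N (g - Polynomial.smult \<mu> h) = invert_at s0 N g - Polynomial.smult \<mu> (invert_at s0 N h)"
  by (simp add: invert_at_def smult_diff_left sum_subtractf smult_sum2)

text \<open>Identities under the substitution are verified where 1 / (z - s0) makes sense; for
  polynomials one excluded point does not matter.\<close>

lemma poly_eq_off_point:
  fixes p q :: "complex poly"
  assumes "\<And>z. z \<noteq> a \<Longrightarrow> poly p z = poly q z" shows "p = q"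
proof -
  have "(p - q) * [:- a, 1:] = 0"
  proof (rule poly_ext)
    fix z show "poly ((p - q) * [:- a, 1:]) z = poly 0 z"
      using assms[of z] by (cases "z = a") simp_all
  qed
  then show ?thesis by (simp del: mult_pCons_right)
qed

lemma invert_at_inj:
  assumes "degree g \<le> N" "invert_at s0 N g = 0" shows "g = 0"
proof (rule poly_eq_off_point[of 0])
  fix w :: complex assume w: "w \<noteq> 0"
  show "poly g w = poly 0 w"
    using poly_invert_at[OF assms(1), of "s0 + 1 / w" s0] assms(2) w by simp
qed

lemma invert_at_linear:
  assumes "N \<ge> 1"
  shows "invert_at s0 N [:- \<tau>, 1:] = [:- s0, 1:] ^ (N - 1) - Polynomial.smult \<tau> ([:- s0, 1:] ^ N)"
proof (rule poly_eq_off_point[of s0])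
  fix z assume z: "z \<noteq> s0"
  obtain M where "N = Suc M" using assms by (cases N) auto
  then show "poly (invert_at s0 N [:- \<tau>, 1:]) z =
      poly ([:- s0, 1:] ^ (N - 1) - Polynomial.smult \<tau> ([:- s0, 1:] ^ N)) z"
    using z by (subst poly_invert_at) (auto simp: field_simps)
qed

lemma invert_at_dvd:
  assumes deg: "degree g \<le> N" and s: "s \<noteq> s0" and dv: "[:- (1 / (s - s0)), 1:] ^ k dvd g"
  shows "[:- s, 1:] ^ k dvd invert_at s0 N g"
proof (cases "g = 0")
  case True
  then show ?thesis by (simp add: invert_at_def)
next
  case False
  let ?w = "1 / (s - s0)"
  obtain q where q: "g = [:- ?w, 1:] ^ k * q" using dv by (elim dvdE)
  have "q \<noteq> 0" using False q by auto
  then have "degree g = k + degree q" unfolding q by (subst degree_mult_eq) (auto simp: degree_linear_power)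
  then have kN: "k \<le> N" "degree q \<le> N - k" using deg by auto
  have "invert_at s0 N g = [:- s, 1:] ^ k * (Polynomial.smult ((- ?w) ^ k) (invert_at s0 (N - k) q))"
  proof (rule poly_eq_off_point[of s0])
    fix z assume z: "z \<noteq> s0"
    \<comment> \<open>The substitution turns the factor w - 1 / (s - s0) into z - s up to a
      constant, at the cost of one factor z - s0, which is taken from the homogenising power
      \<open>N\<close>.\<close>
    have "e * (1 / e - 1 / d) = (e - d) * (- (1 / d))" if "e \<noteq> 0" "d \<noteq> 0" for e d :: complex
      using that by (simp add: field_simps)
    from this[of "z - s0" "s - s0"] have 1: "(z - s0) * (1 / (z - s0) - ?w) = (z - s) * (- ?w)"
      using z s by simp
    have "poly (invert_at s0 N g) z = (z - s0) ^ N * poly g (1 / (z - s0))"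
      by (rule poly_invert_at[OF deg z])
    also have "\<dots> = ((z - s0) * (1 / (z - s0) - ?w)) ^ k * ((z - s0) ^ (N - k) * poly q (1 / (z - s0)))"
      using kN(1) by (simp add: q power_mult_distrib power_add[symmetric] mult_ac
          flip: power_add)
    also have "\<dots> = (z - s) ^ k * ((- ?w) ^ k * poly (invert_at s0 (N - k) q) z)"
      unfolding 1 poly_invert_at[OF kN(2) z] by (simp only: power_mult_distrib mult.assoc)
    finally show "poly (invert_at s0 N g) z =
        poly ([:- s, 1:] ^ k * (Polynomial.smult ((- ?w) ^ k) (invert_at s0 (N - k) q))) z"
      by simp
  qed
  then show ?thesis by (rule dvdI)
qed

lemma poly_map_of_real: "poly (map_poly of_real p) (of_real x :: complex) = of_real (poly p x)"
  by (induction p) (simp_all add: map_poly_pCons)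

lemma pderiv_map_of_real: "pderiv (map_poly of_real p :: complex poly) = map_poly of_real (pderiv p)"
  by (rule poly_eqI) (simp add: coeff_pderiv coeff_map_poly)

text \<open>\<open>T\<close> consists of the real zeros of Q' between the zeros of Q. With s0 the
  point of \<open>j0\<close>, the substitution pulls w - \<tau> back to (z - s0)^(N - 1) - \<tau> (z
  - s0)^N and the second generator to \<open>G\<close>, while the contact orders at the other points
  are kept.\<close>

lemma osculating_pencils:
  fixes s :: "nat \<Rightarrow> real"
  assumes R: "finite R" "R \<noteq> {}" and inj: "inj_on s (insert j0 R)" "j0 \<notin> R"
    and c: "(\<Sum>i\<in>R. c i) = N" "\<And>i. i \<in> R \<Longrightarrow> c i \<ge> 1"
  obtains T where "finite T" "card T = card R - 1"
    "\<And>\<tau>. \<tau> \<in> T \<Longrightarrow> \<exists>G :: complex poly. degree G \<le> N \<and>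
      (\<forall>\<mu>. G \<noteq> Polynomial.smult \<mu> ([:- of_real (s j0), 1:] ^ (N - 1)
          - Polynomial.smult (of_real \<tau>) ([:- of_real (s j0), 1:] ^ N))) \<and>
      (\<forall>i\<in>R. \<exists>\<mu>. [:- of_real (s i), 1:] ^ Suc (c i) dvd
         G - Polynomial.smult \<mu> ([:- of_real (s j0), 1:] ^ (N - 1)
          - Polynomial.smult (of_real \<tau>) ([:- of_real (s j0), 1:] ^ N)))"
proof -
  define w where "w i = 1 / (s i - s j0)" for i
  have ne: "s i \<noteq> s j0" if "i \<in> R" for i using inj that by (auto simp: inj_on_def)
  have w_inj: "inj_on w R"
  proof (rule inj_onI)
    fix i j assume ij: "i \<in> R" "j \<in> R" "w i = w j"
    then have "s i = s j" using ne by (simp add: w_def)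
    then show "i = j" using inj(1) ij by (auto simp: inj_on_def)
  qed
  have N1: "N \<ge> 1"
  proof -
    obtain i where "i \<in> R" using R by auto
    then have "c i \<le> (\<Sum>i\<in>R. c i)" using R by (intro member_le_sum) auto
    then show ?thesis using c \<open>i \<in> R\<close> by fastforce
  qed
  define Q where "Q = (\<Prod>i\<in>R. [:- w i, 1:] ^ c i)"
  define QC :: "complex poly" where "QC = (\<Prod>i\<in>R. [:- of_real (w i), 1:] ^ c i)"
  \<comment> \<open>Both sides agree at every real number, hence at infinitely many points.\<close>
  have QC: "QC = map_poly of_real Q"
  proof (rule ccontr)
    assume "QC \<noteq> map_poly of_real Q"
    then have "finite {x. poly (QC - map_poly of_real Q) x = 0}" by (intro poly_roots_finite) simp
    moreover have "range complex_of_real \<subseteq> {x. poly (QC - map_poly of_real Q) x = 0}"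
      by (auto simp: poly_map_of_real QC_def Q_def poly_prod)
    moreover have "infinite (range complex_of_real)"
      using finite_imageD[of complex_of_real UNIV] infinite_UNIV_char_0[where 'a = real]
      by (auto simp: inj_on_def)
    ultimately show False using finite_subset by blast
  qed
  have Q0: "poly Q x = 0 \<longleftrightarrow> x \<in> w ` R" for x
    using R c(2) by (fastforce simp: Q_def poly_prod)
  have degQ: "degree QC \<le> N" using R c unfolding QC_def by (simp add: degree_prod_linear_powers)
  obtain T where T: "finite T" "card T = card (w ` R) - 1"
    "\<And>t. t \<in> T \<Longrightarrow> poly (pderiv Q) t = 0 \<and> poly Q t \<noteq> 0"
    using critical_points_between_roots[OF _ _ Q0] R by (metis finite_imageI image_is_empty)
  let ?l = "\<lambda>\<tau>. [:- of_real (s j0), 1:] ^ (N - 1)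
          - Polynomial.smult (of_real \<tau>) ([:- of_real (s j0), 1:] ^ N) :: complex poly"
  show thesis
  proof (rule that[OF T(1)])
    show "card T = card R - 1" using T(2) card_image[OF w_inj] by simp
    fix \<tau> assume \<tau>: "\<tau> \<in> T"
    have "poly (pderiv QC) (of_real \<tau>) = 0"
      using T(3)[OF \<tau>] by (simp add: QC pderiv_map_of_real poly_map_of_real)
    then obtain h where h: "degree h \<le> N" "pderiv h * [:- of_real \<tau>, 1:] - h = QC"
      using wronskian_primitive[OF degQ] by blast
    have l: "invert_at (of_real (s j0)) N [:- of_real \<tau>, 1:] = ?l \<tau>"
      by (rule invert_at_linear[OF N1])
    have deg: "degree (h - Polynomial.smult \<mu> [:- of_real \<tau>, 1:]) \<le> N" for \<mu>
      using h(1) N1 degree_smult_le[of \<mu> "[:- complex_of_real \<tau>, 1:]"] by (intro degree_diff_le) auto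
    let ?G = "invert_at (of_real (s j0)) N h"
    have G: "?G - Polynomial.smult \<mu> (?l \<tau>) =
        invert_at (of_real (s j0)) N (h - Polynomial.smult \<mu> [:- of_real \<tau>, 1:])" for \<mu>
      by (simp only: invert_at_diff_smult l)
    show "\<exists>G. degree G \<le> N \<and> (\<forall>\<mu>. G \<noteq> Polynomial.smult \<mu> (?l \<tau>)) \<and>
      (\<forall>i\<in>R. \<exists>\<mu>. [:- of_real (s i), 1:] ^ Suc (c i) dvd G - Polynomial.smult \<mu> (?l \<tau>))"
    proof (intro exI[of _ ?G] conjI allI ballI)
      show "degree ?G \<le> N" by (rule degree_invert_at)
      \<comment> \<open>A multiple of w - \<tau> has Wronskian 0 with it, whereas \<open>QC\<close>
        is not 0.\<close>
      show "?G \<noteq> Polynomial.smult \<mu> (?l \<tau>)" for \<mu>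
      proof
        assume "?G = Polynomial.smult \<mu> (?l \<tau>)"
        then have "invert_at (of_real (s j0)) N (h - Polynomial.smult \<mu> [:- of_real \<tau>, 1:]) = 0"
          using G[of \<mu>] by (simp only: diff_self)
        then have "h = Polynomial.smult \<mu> [:- of_real \<tau>, 1:]"
          using invert_at_inj[OF deg] by (simp only: right_minus_eq)
        then have "QC = 0" using h(2) by (simp add: pderiv_smult pderiv_pCons)
        then show False using R by (simp add: QC_def)
      qed
      fix i assume i: "i \<in> R"
      have "[:- of_real (w i), 1:] ^ c i dvd QC" unfolding QC_def using R(1) i by (rule dvd_prodI)
      moreover have "complex_of_real (w i) \<noteq> of_real \<tau>" using T(3)[OF \<tau>] Q0 i by auto
      ultimately obtain \<mu> where \<mu>: "[:- of_real (w i), 1:] ^ Suc (c i) dvd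
          h - Polynomial.smult \<mu> [:- of_real \<tau>, 1:]"
        using wronskian_contact[OF h(2)] by blast
      have "[:- of_real (s i), 1:] ^ Suc (c i) dvd
          invert_at (of_real (s j0)) N (h - Polynomial.smult \<mu> [:- of_real \<tau>, 1:])"
        by (rule invert_at_dvd[OF deg]) (use \<mu> ne[OF i] in \<open>simp_all add: w_def\<close>)
      then show "\<exists>\<mu>. [:- of_real (s i), 1:] ^ Suc (c i) dvd ?G - Polynomial.smult \<mu> (?l \<tau>)"
        unfolding G by blast
    qed
  qed
qed

subsection \<open>The Schubert problem\<close>

lemma trivial_kernelD:
  "trivial_kernel E C A \<Longrightarrow> in_kernel E C A v \<Longrightarrow> c \<in> C \<Longrightarrow> v c = 0"
  unfolding trivial_kernel_def by blast

lemma flag_space_cong: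
  assumes "i \<le> n" "\<And>a b. a < n \<Longrightarrow> b < n \<Longrightarrow> M a b = M' a b"
  shows "flag_space n M i = flag_space n M' i"
proof -
  have "mrow n M a = mrow n M' a" if "a < i" for a
    using assms that by (auto simp: mrow_def fun_eq_iff)
  then have "map (mrow n M) [0..<i] = map (mrow n M') [0..<i]" by (intro map_cong) auto
  then show ?thesis unfolding flag_space_def by (rule arg_cong)
qed

lemma invertible_mat_cong:
  assumes "\<And>a b. a < n \<Longrightarrow> b < n \<Longrightarrow> M a b = M' a b"
  shows "Defs.invertible_mat n M = Defs.invertible_mat n M'"
  using assms by (simp add: invertible_mat_kernel trivial_kernel_def in_kernel_def)

text \<open>The equation of the hyperplane spanned by the first n - 1 rows: linear in
  \<open>v\<close>, real for real data, and polynomial in all entries.\<close>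

definition last_det :: "nat \<Rightarrow> (nat \<Rightarrow> nat \<Rightarrow> complex) \<Rightarrow> (nat \<Rightarrow> complex) \<Rightarrow> complex" where
  "last_det n M v = det (mat n n (\<lambda>(i, j). if j < n - 1 then M j i else v i))"

lemma last_det_expand:
  assumes "n \<ge> 1"
  shows "last_det n M v = (\<Sum>p | p permutes {0..<n}.
    of_int (sign p) * ((\<Prod>j<n - 1. M j (p j)) * v (p (n - 1))))"
proof -
  obtain N where N: "n = Suc N" using assms by (cases n) auto
  have "last_det n M v = (\<Sum>p | p permutes {0..<n}. of_int (sign p) *
      (\<Prod>j<n. (mat n n (\<lambda>(i, j). if j < n - 1 then M j i else v i)) $$ (p j, j)))"
    unfolding last_det_def by (subst det_col[of _ n]) auto
  also have "\<dots> = (\<Sum>p | p permutes {0..<n}.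
    of_int (sign p) * ((\<Prod>j<n - 1. M j (p j)) * v (p (n - 1))))"
  proof (intro sum.cong refl arg_cong2[where f = "(*)"])
    fix p assume "p \<in> {p. p permutes {0..<n}}"
    then have p: "p j < n" if "j < n" for j using that permutes_in_image[of p "{0..<n}" j] by auto
    have "(\<Prod>j<n. (mat n n (\<lambda>(i, j). if j < n - 1 then M j i else v i)) $$ (p j, j)) =
      (\<Prod>j<n. if j < n - 1 then M j (p j) else v (p j))"
      using p by (intro prod.cong) auto
    also have "\<dots> = (\<Prod>j<n - 1. M j (p j)) * v (p (n - 1))" by (simp add: N)
    finally show "(\<Prod>j<n. (mat n n (\<lambda>(i, j). if j < n - 1 then M j i else v i)) $$ (p j, j)) =
      (\<Prod>j<n - 1. M j (p j)) * v (p (n - 1))" .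
  qed
  finally show ?thesis .
qed

lemma last_det_comb:
  assumes "n \<ge> 1"
  shows "last_det n M (\<lambda>j. a * u j + b * v j) = a * last_det n M u + b * last_det n M v"
  unfolding last_det_expand[OF assms]
  by (simp add: sum_distrib_left sum.distrib[symmetric] algebra_simps)

lemma last_det_real:
  assumes "n \<ge> 1" "\<And>a b. M a b \<in> \<real>" "\<And>b. v b \<in> \<real>"
  shows "last_det n M v \<in> \<real>"
  unfolding last_det_expand[OF assms(1)]
  by (intro sum_in_Reals Reals_mult prod_in_Reals assms) auto

lemma poly_fun_last_det:
  assumes "n \<ge> 1" "\<And>a b. a < n \<Longrightarrow> b < n \<Longrightarrow> poly_fun K (\<lambda>x. M x a b)"
    "\<And>b. b < n \<Longrightarrow> poly_fun K (\<lambda>x. v x b)"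
  shows "poly_fun K (\<lambda>x. last_det n (M x) (v x))"
  unfolding last_det_expand[OF assms(1)]
proof (intro poly_fun_sum poly_fun_mult poly_fun_const poly_fun_prod)
  fix p assume "p \<in> {p. p permutes {0..<n}}"
  then have p: "p j < n" if "j < n" for j using that permutes_in_image[of p "{0..<n}" j] by auto
  show "poly_fun K (\<lambda>x. v x (p (n - 1)))" using assms(1) by (intro assms(3) p) simp
  show "poly_fun K (\<lambda>x. M x j (p j))" if "j \<in> {..<n - 1}" for j
    using that by (intro assms(2) p) auto
qed

lemma last_det_zero_iff:
  assumes inv: "Defs.invertible_mat n M" and v: "v \<in> cvec n" and n: "n \<ge> 1"
  shows "last_det n M v = 0 \<longleftrightarrow> v \<in> flag_space n M (n - 1)"
proof -
  obtain N where N: "n = Suc N" using n by (cases n) auto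
  let ?A = "\<lambda>i j. if j < N then M j i else v i"
  have "last_det n M v = 0 \<longleftrightarrow> \<not> trivial_kernel {0..<n} {0..<n} ?A"
    unfolding last_det_def N diff_Suc_1 by (intro det_zero_iff_kernel[of id _ _ id, simplified]) auto
  also have "\<dots> \<longleftrightarrow> v \<in> flag_space n M N"
  proof
    have ker: "in_kernel {0..<n} {0..<n} ?A c \<longleftrightarrow> (\<forall>b. (\<Sum>a<N. c a * mrow n M a b) + c N * v b = 0)" for c
    proof -
      have "(\<Sum>j\<in>{0..<n}. ?A b j * c j) = (\<Sum>a<N. c a * M a b) + c N * v b" for b
        by (simp add: N atLeast0LessThan mult.commute)
      then have "in_kernel {0..<n} {0..<n} ?A c \<longleftrightarrow> (\<forall>b<n. (\<Sum>a<N. c a * M a b) + c N * v b = 0)"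
        by (auto simp: in_kernel_def)
      moreover have "(\<Sum>a<N. c a * mrow n M a b) + c N * v b =
          (if b < n then (\<Sum>a<N. c a * M a b) + c N * v b else 0)" for b
        using v by (simp add: mrow_def cvec_def)
      ultimately show ?thesis by simp
    qed
    {
      assume "\<not> trivial_kernel {0..<n} {0..<n} ?A"
      then obtain c j where c: "in_kernel {0..<n} {0..<n} ?A c" "j < n" "c j \<noteq> 0"
        unfolding trivial_kernel_def by auto
      have eq: "(\<Sum>a<N. c a * mrow n M a b) + c N * v b = 0" for b using c(1) ker by blast
      have "c N \<noteq> 0"
      proof
        assume 0: "c N = 0"
        then have "c a = 0" if "a < N" for a
          using invertible_matD[OF inv, of N c a] eq that N by simp
        then show False using 0 c(2,3) N by (auto simp: less_Suc_eq)
      qed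
      then show "v \<in> flag_space n M N" using flag_space_solve[OF eq] by blast
    next
      assume "v \<in> flag_space n M N"
      then obtain c where c: "\<And>b. v b = (\<Sum>a<N. c a * mrow n M a b)" unfolding flag_space_iff by blast
      have "in_kernel {0..<n} {0..<n} ?A (\<lambda>a. if a < N then c a else - 1)"
        unfolding ker by (simp add: c)
      then show "\<not> trivial_kernel {0..<n} {0..<n} ?A"
        using trivial_kernelD[of "{0..<n}" "{0..<n}" ?A _ N] N by fastforce
    }
  qed
  finally show ?thesis by (simp add: N)
qed

text \<open>Decodes the flat coordinates used by \<open>generic_count\<close>. Encoding after
  decoding gives back \<open>x\<close>, but in the other order matrix entries are recovered only for
  indices below \<open>n\<close>; hence the congruence lemmas for flags and intersections.\<close>

definition ent :: "nat \<Rightarrow> (nat \<Rightarrow> complex) \<Rightarrow> nat \<Rightarrow> nat \<Rightarrow> nat \<Rightarrow> complex" where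
  "ent n x j a b = x (j * (n * n) + a * n + b)"

lemma ent_mat_vars:
  assumes "a < n" "b < n" shows "ent n (mat_vars n Ms) j a b = Ms j a b"
proof -
  have ab: "a * n + b < n * n"
  proof -
    have "a * n + b < Suc a * n" using assms by simp
    also have "\<dots> \<le> n * n" using assms by (intro mult_le_mono1) simp
    finally show ?thesis .
  qed
  have eq: "j * (n * n) + a * n + b = (a * n + b) + j * (n * n)" by simp
  have "n * n \<noteq> 0" using assms by simp
  then have "(j * (n * n) + a * n + b) div (n * n) = j" unfolding eq
    using ab by (subst div_mult_self1) (use assms in simp_all)
  moreover have "(j * (n * n) + a * n + b) mod (n * n) = a * n + b" unfolding eq
    using ab by (subst mod_mult_self1) simp
  moreover have "(j * (n * n) + a * n + b) mod n = b"
  proof -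
    have "j * (n * n) + a * n + b = b + (j * n + a) * n" by (simp add: algebra_simps)
    then show ?thesis using assms(2) by (simp only: mod_mult_self1 mod_less)
  qed
  ultimately show ?thesis using assms by (simp add: ent_def mat_vars_def)
qed

lemma mat_vars_ent:
  assumes "n \<ge> 1" shows "mat_vars n (ent n x) = x"
proof
  fix v
  have "v mod (n * n) mod n = v mod n" by (simp add: mod_mod_cancel)
  then have "(v mod (n * n)) div n * n + v mod n = v mod (n * n)" by (metis div_mult_mod_eq)
  then have "v div (n * n) * (n * n) + (v mod (n * n)) div n * n + v mod n = v"
    by (metis add.assoc div_mult_mod_eq)
  then show "mat_vars n (ent n x) v = x v" by (simp only: mat_vars_def ent_def)
qed

lemma poly_fun_ent:
  assumes "j < k" "a < n" "b < n" shows "poly_fun (k * n * n) (\<lambda>x. ent n x j a b)"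
  unfolding ent_def
proof (rule poly_fun_var)
  have "j * (n * n) + a * n + b < j * (n * n) + Suc a * n" using assms by simp
  also have "\<dots> \<le> j * (n * n) + n * n" using assms by (intro add_left_mono mult_le_mono1) simp
  also have "\<dots> = Suc j * (n * n)" by simp
  also have "\<dots> \<le> k * (n * n)" using assms by (intro mult_le_mono1) simp
  finally show "j * (n * n) + a * n + b < k * n * n" by (simp add: mult.assoc)
qed

section \<open>Uniqueness of the generic count and reduction of \<open>SG\<close> to one
  polynomial\<close>

lemma schubert_inter_cong:
  assumes "\<And>j. j < length as \<Longrightarrow> schubert_cond n (as ! j)"
    and "\<And>j a b. j < length as \<Longrightarrow> a < n \<Longrightarrow> b < n \<Longrightarrow> Ms j a b = Ms' j a b"
  shows "schubert_inter n as Ms = schubert_inter n as Ms'"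
proof -
  have "schubert_var n (as ! j) (Ms j) = schubert_var n (as ! j) (Ms' j)" if j: "j < length as" for j
  proof -
    have "n + 1 - fst (as ! j) \<le> n" "n + 1 - snd (as ! j) \<le> n"
      using assms(1)[OF j] by (auto simp: schubert_cond_def)
    then show ?thesis
      unfolding schubert_var_def using flag_space_cong[of _ n "Ms j" "Ms' j"] assms(2)[OF j] by simp
  qed
  then show ?thesis by (simp add: schubert_inter_def)
qed

lemma generic_count_unique:
  assumes "n \<ge> 1" "generic_count n as c" "generic_count n as c'"
    and cond: "\<And>j. j < length as \<Longrightarrow> schubert_cond n (as ! j)"
  shows "c = c'"
proof -
  let ?k = "length as"
  obtain g where g: "poly_fun (?k * n * n) g" "\<exists>x. g x \<noteq> 0"
    "\<And>Ms. (\<forall>j<?k. Defs.invertible_mat n (Ms j)) \<Longrightarrow> g (mat_vars n Ms) \<noteq> 0 \<Longrightarrow>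
       card (schubert_inter n as Ms) = c"
    using assms(2) unfolding generic_count_def by blast
  obtain h where h: "poly_fun (?k * n * n) h" "\<exists>x. h x \<noteq> 0"
    "\<And>Ms. (\<forall>j<?k. Defs.invertible_mat n (Ms j)) \<Longrightarrow> h (mat_vars n Ms) \<noteq> 0 \<Longrightarrow>
       card (schubert_inter n as Ms) = c'"
    using assms(3) unfolding generic_count_def by blast
  have "\<exists>G. poly_fun (?k * n * n) G \<and> (\<forall>x. G x = 0 \<longleftrightarrow> \<not> Defs.invertible_mat n (ent n x j))"
    if j: "j < ?k" for j
    unfolding invertible_mat_kernel by (rule kernel_condition) (use j in \<open>auto intro: poly_fun_ent\<close>)
  then obtain G where G: "\<And>j. j < ?k \<Longrightarrow> poly_fun (?k * n * n) (G j)"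
    "\<And>j x. j < ?k \<Longrightarrow> G j x = 0 \<longleftrightarrow> \<not> Defs.invertible_mat n (ent n x j)" by metis
  define D where "D x = (\<Prod>j<?k. G j x)" for x
  have D: "poly_fun (?k * n * n) D" unfolding D_def by (intro poly_fun_prod G(1)) simp
  \<comment> \<open>\<open>osc_mat 0\<close> is the identity matrix; it shows that invertibility of
    all flags is a nonempty condition.\<close>
  let ?x0 = "mat_vars n (\<lambda>j. osc_mat 0)"
  have "Defs.invertible_mat n (ent n ?x0 j)" for j
    using osc_mat_invertible[of n 0] invertible_mat_cong[of n "ent n ?x0 j" "osc_mat 0"]
    by (simp add: ent_mat_vars)
  then have "D ?x0 \<noteq> 0" by (simp add: D_def G(2))
  moreover obtain x where "g x \<noteq> 0" using g(2) by blast
  ultimately obtain y where y: "g y \<noteq> 0" "D y \<noteq> 0" using poly_fun_common_nonzero[OF g(1) D] by metis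
  obtain x' where "h x' \<noteq> 0" using h(2) by blast
  then obtain z where z: "g z * D z \<noteq> 0" "h z \<noteq> 0"
    using poly_fun_common_nonzero[OF poly_fun_mult[OF g(1) D] h(1), of y x'] y by auto
  have "\<forall>j<?k. Defs.invertible_mat n (ent n z j)" using z(1) by (auto simp: D_def G(2))
  then show ?thesis using g(3)[of "ent n z"] h(3)[of "ent n z"] z mat_vars_ent[OF assms(1), of z] by simp
qed

text \<open>Osculating tuples with distinct parameters lie in the open set given by
  \<open>g\<close>. This proves that the set is nonempty, and it transfers the count
  \<open>c\<close> to these tuples.\<close>

lemma SG_from_generic_condition:
  assumes cond: "\<And>j. j < length as \<Longrightarrow> schubert_cond (m + 2) (as ! j)"
    and g: "poly_fun (length as * (m + 2) * (m + 2)) g"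
    and count: "\<And>Ms x. Ms = ent (m + 2) x \<Longrightarrow> (\<And>j. j < length as \<Longrightarrow> Defs.invertible_mat (m + 2) (Ms j)) \<Longrightarrow>
        g x \<noteq> 0 \<Longrightarrow> finite (schubert_inter (m + 2) as Ms) \<and> card (schubert_inter (m + 2) as Ms) = c"
    and osc: "\<And>s Ms x. inj_on s {..<length as} \<Longrightarrow> Ms = ent (m + 2) x \<Longrightarrow>
        (\<And>j a b. a < m + 2 \<Longrightarrow> b < m + 2 \<Longrightarrow> Ms j a b = osc_mat (s j) a b) \<Longrightarrow>
        (\<And>j a b. Ms j a b \<in> \<real>) \<Longrightarrow>
        g x \<noteq> 0 \<and> (\<forall>X\<in>schubert_inter (m + 2) as Ms. real_point X)"
  shows "SG m as"
proof -
  let ?n = "m + 2"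
  have osc': "g (mat_vars ?n (\<lambda>j. osc_mat (s j))) \<noteq> 0 \<and>
      (\<forall>X\<in>schubert_inter ?n as (\<lambda>j. osc_mat (s j)). real_point X)" if s: "inj_on s {..<length as}" for s
  proof -
    let ?x = "mat_vars ?n (\<lambda>j. osc_mat (s j))"
    have "g ?x \<noteq> 0 \<and> (\<forall>X\<in>schubert_inter ?n as (ent ?n ?x). real_point X)"
      by (rule osc[OF s refl]) (simp_all add: ent_mat_vars, simp add: ent_def mat_vars_def osc_mat_def)
    moreover have "schubert_inter ?n as (ent ?n ?x) = schubert_inter ?n as (\<lambda>j. osc_mat (s j))"
      by (rule schubert_inter_cong[OF cond]) (simp_all add: ent_mat_vars)
    ultimately show ?thesis by simp
  qed
  have count': "finite (schubert_inter ?n as Ms) \<and> card (schubert_inter ?n as Ms) = c"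
    if Ms: "\<And>j. j < length as \<Longrightarrow> Defs.invertible_mat ?n (Ms j)" "g (mat_vars ?n Ms) \<noteq> 0" for Ms
  proof -
    have "Defs.invertible_mat ?n (ent ?n (mat_vars ?n Ms) j)" if "j < length as" for j
      using Ms(1)[OF that] invertible_mat_cong[of ?n "ent ?n (mat_vars ?n Ms) j" "Ms j"]
      by (simp add: ent_mat_vars)
    moreover have "schubert_inter ?n as (ent ?n (mat_vars ?n Ms)) = schubert_inter ?n as Ms"
      by (rule schubert_inter_cong[OF cond]) (simp_all add: ent_mat_vars)
    ultimately show ?thesis using count[OF refl, of "mat_vars ?n Ms"] Ms(2) by simp
  qed
  have gen: "generic_count ?n as c"
    unfolding generic_count_def
  proof (intro exI[of _ g] conjI allI impI g)
    \<comment> \<open>The parameters 0, 1, 2, ... are distinct.\<close>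
    show "\<exists>x. g x \<noteq> 0" using osc'[of real] by (auto simp: inj_on_def)
  qed (use count' in auto)
  have d: "d_num m as = c"
    unfolding d_num_def
    by (rule the_equality[where P = "generic_count ?n as", OF gen]) (use generic_count_unique[OF _ _ gen cond] in auto)
  show ?thesis
    unfolding SG_def
  proof (intro exI[of _ "\<lambda>_. 1"] conjI allI impI)
    show "poly_fun (length as) (\<lambda>_. 1 :: real)" by (rule poly_fun_const)
    fix s :: "nat \<Rightarrow> real" assume "inj_on s {..<length as} \<and> (1::real) \<noteq> 0"
    then have s: "inj_on s {..<length as}" by simp
    show "let I = schubert_inter ?n as (\<lambda>j. osc_mat (s j)) in
        finite I \<and> card I = d_num m as \<and> (\<forall>X\<in>I. real_point X)"
      unfolding Let_def d using osc'[OF s] count'[of "\<lambda>j. osc_mat (s j)"] osc_mat_invertible by blast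
  qed simp
qed

section \<open>The Schubert problem with its special condition\<close>

lemma trivial_kernel_cong:
  "(\<And>e c. e \<in> E \<Longrightarrow> c \<in> C \<Longrightarrow> A e c = A' e c) \<Longrightarrow> trivial_kernel E C A \<longleftrightarrow> trivial_kernel E C A'"
  by (simp add: trivial_kernel_def in_kernel_def)

lemma flag_space_2:
  "w \<in> flag_space n M 2 \<longleftrightarrow> (\<exists>a b. w = (\<lambda>j. a * mrow n M 0 j + b * mrow n M 1 j))"
proof
  assume "w \<in> flag_space n M 2"
  then obtain c where "\<And>j. w j = (\<Sum>a<2. c a * mrow n M a j)" unfolding flag_space_iff by blast
  then have "w = (\<lambda>j. c 0 * mrow n M 0 j + c 1 * mrow n M 1 j)" by (auto simp: numeral_2_eq_2)
  then show "\<exists>a b. w = (\<lambda>j. a * mrow n M 0 j + b * mrow n M 1 j)" by blast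
next
  assume "\<exists>a b. w = (\<lambda>j. a * mrow n M 0 j + b * mrow n M 1 j)"
  then obtain a b where "w = (\<lambda>j. a * mrow n M 0 j + b * mrow n M 1 j)" by blast
  then show "w \<in> flag_space n M 2" unfolding flag_space_iff
    by (intro exI[of _ "\<lambda>i. if i = 0 then a else b"]) (simp add: numeral_2_eq_2)
qed

lemma rows_independent:
  assumes inv: "Defs.invertible_mat n M" and n: "n \<ge> 2"
    and z: "(\<lambda>j. a * mrow n M 0 j + b * mrow n M 1 j) = (\<lambda>_. 0)"
  shows "a = 0 \<and> b = 0"
proof -
  have "(\<Sum>i<2. (if i = 0 then a else b) * mrow n M i j) = 0" for j
    using fun_cong[OF z, of j] by (simp add: numeral_2_eq_2)
  then have "(if i = 0 then a else b) = 0" if "i < 2" for i :: nat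
    using invertible_matD[OF inv n, of "\<lambda>i. if i = 0 then a else b" i] that by simp
  from this[of 0] this[of 1] show ?thesis by simp
qed

locale schubert_problem =
  fixes m :: nat and as :: "(nat \<times> nat) list" and j0 :: nat
  assumes m: "m \<ge> 2" and j0: "j0 < length as" and asj0: "as ! j0 = (1, m + 1)"
    and cond: "\<And>j. j < length as \<Longrightarrow> schubert_cond (m + 2) (as ! j)"
    and total: "(\<Sum>j<length as. cond_size (as ! j)) = 2 * m"
begin

abbreviation n :: nat where "n \<equiv> m + 2"

text \<open>\<open>R\<close> collects the conditions besides \<open>j0\<close> that demand more than
  meeting a hyperplane. \<open>d j\<close> is the dimension of the space to be met, and
  \<open>c j\<close> is the codimension of that demand on planes, one less than the codimension of
  the space.\<close>

definition R :: "nat set" where "R = {j. j < length as \<and> j \<noteq> j0 \<and> 3 \<le> snd (as ! j)}"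
definition d :: "nat \<Rightarrow> nat" where "d j = m + 3 - snd (as ! j)"
definition c :: "nat \<Rightarrow> nat" where "c j = snd (as ! j) - 2"

abbreviation nvars :: nat where "nvars \<equiv> length as * n * n"
abbreviation inter :: "(nat \<Rightarrow> nat \<Rightarrow> nat \<Rightarrow> complex) \<Rightarrow> (nat \<Rightarrow> complex) set set" where
  "inter Ms \<equiv> schubert_inter n as Ms"
abbreviation Fl :: "(nat \<Rightarrow> nat \<Rightarrow> nat \<Rightarrow> complex) \<Rightarrow> nat \<Rightarrow> nat \<Rightarrow> (nat \<Rightarrow> complex) set" where
  "Fl Ms j i \<equiv> flag_space n (Ms j) i"
abbreviation eqs :: "nat \<Rightarrow> (nat \<times> nat) set" where "eqs i0 \<equiv> line_equations n R i0"
abbreviation unk :: "nat \<Rightarrow> (nat \<times> nat) set" where "unk i0 \<equiv> line_unknowns R i0 d"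

definition regular :: "(nat \<Rightarrow> nat \<Rightarrow> nat \<Rightarrow> complex) \<Rightarrow> bool" where
  "regular Ms \<longleftrightarrow> (\<forall>j<length as. Defs.invertible_mat n (Ms j))"

text \<open>The space K_2 of flag \<open>j0\<close> meets K_m of every other flag only in 0. As 2 +
  m = n, this is nonsingularity of a square matrix and so a polynomial condition;
  \<open>separated_iff\<close> gives the geometric form.\<close>

definition separated :: "(nat \<Rightarrow> nat \<Rightarrow> nat \<Rightarrow> complex) \<Rightarrow> bool" where
  "separated Ms \<longleftrightarrow> (\<forall>j<length as. j \<noteq> j0 \<longrightarrow>
     trivial_kernel {..<n} {..<n} (\<lambda>b a. if a < 2 then Ms j0 a b else Ms j (a - 2) b))"

text \<open>Outside the n x n block the entries are only asked to be real: there they are whatever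
  decoding by \<open>ent\<close> returns.\<close>

definition osculating :: "(nat \<Rightarrow> real) \<Rightarrow> (nat \<Rightarrow> nat \<Rightarrow> nat \<Rightarrow> complex) \<Rightarrow> bool" where
  "osculating s Ms \<longleftrightarrow> inj_on s {..<length as} \<and>
     (\<forall>j a b. a < n \<longrightarrow> b < n \<longrightarrow> Ms j a b = osc_mat (s j) a b) \<and> (\<forall>j a b. Ms j a b \<in> \<real>)"

abbreviation row :: "(nat \<Rightarrow> nat \<Rightarrow> nat \<Rightarrow> complex) \<Rightarrow> nat \<Rightarrow> nat \<Rightarrow> complex" where
  "row Ms i \<equiv> mrow n (Ms j0) i"

lemma finite_R: "finite R"
  by (simp add: R_def)

lemma d_le: "j \<in> R \<Longrightarrow> d j \<le> m"
  by (auto simp: R_def d_def)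

lemma condD:
  assumes "j < length as"
  shows "1 \<le> fst (as ! j)" "fst (as ! j) < snd (as ! j)" "snd (as ! j) \<le> m + 2"
  using cond[OF assms] by (auto simp: schubert_cond_def)

lemma d_c: "j \<in> R \<Longrightarrow> d j + c j + 1 = n" "j \<in> R \<Longrightarrow> c j \<ge> 1" "j \<in> R \<Longrightarrow> c j \<le> m"
  using condD[of j] by (auto simp: R_def d_def c_def)

lemma row_cvec: "row Ms i \<in> cvec n"
  by (simp add: mrow_def cvec_def)

text \<open>The special condition accounts for m - 1 of the total 2 m; the remaining m + 1 are split
  between meeting conditions and containments, and this split decides the case.\<close>

lemma sum_c: "(\<Sum>j\<in>R. c j) + (\<Sum>j<length as. fst (as ! j) - 1) = m + 1"
proof -
  have "(\<Sum>j<length as. c j) = c j0 + (\<Sum>j\<in>{..<length as} - {j0}. c j)"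
    using j0 by (subst sum.remove[of _ j0]) auto
  also have "(\<Sum>j\<in>{..<length as} - {j0}. c j) = (\<Sum>j\<in>R. c j)"
    by (intro sum.mono_neutral_right) (auto simp: R_def c_def)
  finally have "(\<Sum>j<length as. c j) = m - 1 + (\<Sum>j\<in>R. c j)" using asj0 by (simp add: c_def)
  moreover have "(\<Sum>j<length as. fst (as ! j) - 1) + (\<Sum>j<length as. c j) = 2 * m"
    using total by (simp add: cond_size_def c_def sum.distrib)
  ultimately show ?thesis using m by simp
qed

text \<open>Against (card R - 1) n equations, the system is square exactly if the \<open>c j\<close>
  sum to m + 1, and it has one unknown to spare if they sum to m.\<close>

lemma card_unknowns:
  assumes "i0 \<in> R"
  shows "card (unk i0) + (\<Sum>j\<in>R. c j) + 1 = card R * n"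
proof -
  have "(\<Sum>j\<in>R. d j + 1) + (\<Sum>j\<in>R. c j) = (\<Sum>j\<in>R. n)"
    unfolding sum.distrib[symmetric] using d_c(1) by (intro sum.cong) auto
  then show ?thesis using card_line_unknowns[OF finite_R assms, of d] by simp
qed

lemma separated_iff:
  assumes reg: "regular Ms"
  shows "separated Ms \<longleftrightarrow> (\<forall>j<length as. j \<noteq> j0 \<longrightarrow>
    (\<forall>y. y \<in> Fl Ms j0 2 \<longrightarrow> y \<in> Fl Ms j m \<longrightarrow> y = (\<lambda>_. 0)))"
proof -
  have "trivial_kernel {..<n} {..<n} (\<lambda>b a. if a < 2 then Ms j0 a b else Ms j (a - 2) b) \<longleftrightarrow>
    (\<forall>y. y \<in> Fl Ms j0 2 \<longrightarrow> y \<in> Fl Ms j m \<longrightarrow> y = (\<lambda>_. 0))"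
    if j: "j < length as" for j
  proof -
    let ?A = "\<lambda>b a. if a < 2 then Ms j0 a b else Ms j (a - 2) b"
    have ker: "in_kernel {..<n} {..<n} ?A v \<longleftrightarrow> (\<forall>b. v 0 * row Ms 0 b + v 1 * row Ms 1 b
        + (\<Sum>a<m. v (Suc (Suc a)) * mrow n (Ms j) a b) = 0)" for v
    proof -
      have "(\<Sum>a\<in>{..<n}. ?A b a * v a) = v 0 * Ms j0 0 b + v 1 * Ms j0 1 b
          + (\<Sum>a<m. v (Suc (Suc a)) * Ms j a b)" for b
        by (simp add: sum.lessThan_Suc_shift mult.commute del: sum.lessThan_Suc)
      then have "in_kernel {..<n} {..<n} ?A v \<longleftrightarrow> (\<forall>b<n. v 0 * Ms j0 0 b + v 1 * Ms j0 1 b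
          + (\<Sum>a<m. v (Suc (Suc a)) * Ms j a b) = 0)"
        by (auto simp: in_kernel_def)
      moreover have "v 0 * row Ms 0 b + v 1 * row Ms 1 b + (\<Sum>a<m. v (Suc (Suc a)) * mrow n (Ms j) a b) =
         (if b < n then v 0 * Ms j0 0 b + v 1 * Ms j0 1 b + (\<Sum>a<m. v (Suc (Suc a)) * Ms j a b) else 0)"
        for b by (simp add: mrow_def)
      ultimately show ?thesis by simp
    qed
    have inv: "Defs.invertible_mat n (Ms j0)" "Defs.invertible_mat n (Ms j)"
      using reg j j0 by (auto simp: regular_def)
    show ?thesis
    proof
      assume T: "trivial_kernel {..<n} {..<n} ?A"
      show "\<forall>y. y \<in> Fl Ms j0 2 \<longrightarrow> y \<in> Fl Ms j m \<longrightarrow> y = (\<lambda>_. 0)"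
      proof (intro allI impI)
        fix y assume "y \<in> Fl Ms j0 2" "y \<in> Fl Ms j m"
        then obtain p q \<beta> where y: "y = (\<lambda>b. p * row Ms 0 b + q * row Ms 1 b)"
          "\<And>b. y b = (\<Sum>a<m. \<beta> a * mrow n (Ms j) a b)"
          unfolding flag_space_2 flag_space_iff[of y n "Ms j" m] by blast
        define v where "v a = (if a = 0 then p else if a = 1 then q else - \<beta> (a - 2))" for a
        have "in_kernel {..<n} {..<n} ?A v"
          unfolding ker
        proof
          fix b
          have "p * row Ms 0 b + q * row Ms 1 b = (\<Sum>a<m. \<beta> a * mrow n (Ms j) a b)"
            using y(2)[of b] by (simp add: y(1))
          then show "v 0 * row Ms 0 b + v 1 * row Ms 1 b
            + (\<Sum>a<m. v (Suc (Suc a)) * mrow n (Ms j) a b) = 0"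
            by (simp add: v_def sum_negf)
        qed
        then have "v 0 = 0" "v 1 = 0" using trivial_kernelD[OF T] by auto
        then show "y = (\<lambda>_. 0)" by (simp add: y(1) v_def)
      qed
    next
      assume Y: "\<forall>y. y \<in> Fl Ms j0 2 \<longrightarrow> y \<in> Fl Ms j m \<longrightarrow> y = (\<lambda>_. 0)"
      show "trivial_kernel {..<n} {..<n} ?A"
        unfolding trivial_kernel_def
      proof (intro allI impI ballI)
        fix v a assume v: "in_kernel {..<n} {..<n} ?A v" and a: "a \<in> {..<n}"
        let ?y = "\<lambda>b. v 0 * row Ms 0 b + v 1 * row Ms 1 b"
        have eq: "?y b + (\<Sum>a<m. v (Suc (Suc a)) * mrow n (Ms j) a b) = 0" for b using v ker by blast
        then have "?y b = (\<Sum>a<m. (- v (Suc (Suc a))) * mrow n (Ms j) a b)" for b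
          using eq[of b] by (simp add: sum_negf eq_neg_iff_add_eq_0)
        then have "?y \<in> Fl Ms j m" unfolding flag_space_iff
          by (intro exI[of _ "\<lambda>a. - v (Suc (Suc a))"]) blast
        moreover have "?y \<in> Fl Ms j0 2" unfolding flag_space_2 by blast
        ultimately have y0: "?y = (\<lambda>_. 0)" using Y by blast
        have v01: "v 0 = 0 \<and> v 1 = 0" using rows_independent[OF inv(1) _ y0] by simp
        have "(\<Sum>a<m. v (Suc (Suc a)) * mrow n (Ms j) a b) = 0" for b
          using eq[of b] fun_cong[OF y0, of b] by simp
        then have v2: "v (Suc (Suc a)) = 0" if "a < m" for a
          using invertible_matD[OF inv(2), of m "\<lambda>a. v (Suc (Suc a))" a] that by simp
        show "v a = 0"
        proof (cases a)
          case (Suc a')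
          then show ?thesis using v01 v2 a by (cases a') auto
        qed (use v01 in simp)
      qed
    qed
  qed
  then show ?thesis unfolding separated_def by blast
qed

lemma separated_notin:
  assumes "regular Ms" "separated Ms" "j \<in> R" "y \<in> Fl Ms j0 2" "y \<noteq> (\<lambda>_. 0)"
  shows "y \<notin> Fl Ms j (d j)"
  using assms separated_iff[OF assms(1)] flag_space_mono[OF d_le[OF assms(3)], of n "Ms j"]
  by (auto simp: R_def)

lemma separated_condition:
  "\<exists>g. poly_fun nvars g \<and> (\<forall>x. g x = 0 \<longleftrightarrow> \<not> separated (ent n x))"
proof -
  have "\<exists>G. poly_fun nvars G \<and> (\<forall>x. G x = 0 \<longleftrightarrow>
      \<not> trivial_kernel {..<n} {..<n} (\<lambda>b a. if a < 2 then ent n x j0 a b else ent n x j (a - 2) b))"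
    if j: "j < length as" for j
  proof (rule kernel_condition)
    fix b a assume "b \<in> {..<n}" "a \<in> {..<n}"
    then show "poly_fun nvars
      (\<lambda>x. if a < 2 then ent n x j0 a b else ent n x j (a - 2) b)"
      using j j0 by (intro poly_fun_if poly_fun_ent) auto
  qed auto
  then have "\<forall>j\<in>{..<length as}. \<exists>G. poly_fun nvars G \<and> (\<forall>x. G x = 0 \<longleftrightarrow>
      \<not> trivial_kernel {..<n} {..<n} (\<lambda>b a. if a < 2 then ent n x j0 a b else ent n x j (a - 2) b))"
    by blast
  from bchoice[OF this] obtain G where
    "\<forall>j\<in>{..<length as}. poly_fun nvars (G j) \<and> (\<forall>x. G j x = 0 \<longleftrightarrow>
      \<not> trivial_kernel {..<n} {..<n} (\<lambda>b a. if a < 2 then ent n x j0 a b else ent n x j (a - 2) b))" ..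
  then have G: "\<And>j. j < length as \<Longrightarrow> poly_fun nvars (G j)"
    "\<And>j x. j < length as \<Longrightarrow> G j x = 0 \<longleftrightarrow>
      \<not> trivial_kernel {..<n} {..<n} (\<lambda>b a. if a < 2 then ent n x j0 a b else ent n x j (a - 2) b)"
    by simp_all
  define g where "g x = (\<Prod>j\<in>{..<length as} - {j0}. G j x)" for x
  have "poly_fun nvars g"
    unfolding g_def by (rule poly_fun_prod, rule G(1)) simp
  moreover have "g x = 0 \<longleftrightarrow> \<not> separated (ent n x)" for x
  proof -
    have "g x = 0 \<longleftrightarrow> (\<exists>j<length as. j \<noteq> j0 \<and> G j x = 0)" by (auto simp: g_def)
    then show ?thesis unfolding separated_def using G(2) by blast
  qed
  ultimately show ?thesis by blast
qed

text \<open>K_n is the whole space and every plane meets a hyperplane, so containments survive only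
  for first entries at least 2, and meeting conditions only for \<open>j0\<close> and
  \<open>R\<close>.\<close>

lemma inter_iff:
  assumes reg: "regular Ms"
  shows "X \<in> inter Ms \<longleftrightarrow> X \<in> grass2 n \<and> meets X (Fl Ms j0 2) \<and>
    (\<forall>j\<in>R. meets X (Fl Ms j (d j))) \<and>
    (\<forall>j<length as. fst (as ! j) \<ge> 2 \<longrightarrow> X \<subseteq> Fl Ms j (n + 1 - fst (as ! j)))"
    (is "?l \<longleftrightarrow> ?r")
proof -
  have l: "?l \<longleftrightarrow> X \<in> grass2 n \<and> (\<forall>j<length as. X \<subseteq> Fl Ms j (n + 1 - fst (as ! j)) \<and>
     meets X (Fl Ms j (d j)))"
    unfolding schubert_inter_def by (auto simp: schubert_var_iff meets_def d_def numeral_3_eq_3)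
  have dj0: "d j0 = 2" using asj0 by (simp add: d_def)
  show ?thesis
  proof
    assume ?l
    then show ?r using l dj0 j0 by (auto simp: R_def)
  next
    assume r: ?r
    have "X \<subseteq> Fl Ms j (n + 1 - fst (as ! j)) \<and> meets X (Fl Ms j (d j))"
      if j: "j < length as" for j
    proof
      have inv: "Defs.invertible_mat n (Ms j)" using reg j by (simp add: regular_def)
      show "X \<subseteq> Fl Ms j (n + 1 - fst (as ! j))"
      proof (cases "fst (as ! j) \<ge> 2")
        case False
        then have "fst (as ! j) = 1" using condD(1)[OF j] by simp
        then show ?thesis using flag_space_top[OF inv] grass2_subset[of X n] r by simp
      qed (use r j in blast)
      show "meets X (Fl Ms j (d j))"
      proof (cases "j = j0 \<or> j \<in> R")
        case True
        then show ?thesis using r dj0 by auto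
      next
        case False
        then have "snd (as ! j) = 2" using condD(1,2)[OF j] j by (auto simp: R_def)
        then have dj: "d j = n - 1" by (simp add: d_def)
        obtain w where "w \<in> X" "w \<in> Fl Ms j (n - 1)" "w \<noteq> (\<lambda>_. 0)"
          by (rule grass2_meets_hyperplane[OF inv, of X]) (use r in auto)
        then show ?thesis unfolding meets_def dj by blast
      qed
    qed
    then show ?l using l r by blast
  qed
qed

lemma line_systemI:
  assumes "regular Ms" "separated Ms" "i0 \<in> R" "y \<in> Fl Ms j0 2" "y \<noteq> (\<lambda>_. 0)"
  shows "line_system n R i0 d Ms y"
proof
  show "Defs.invertible_mat n (Ms j)" if "j \<in> R" for j
    using assms(1) that by (simp add: regular_def R_def)
  show "d j \<le> n" if "j \<in> R" for j using d_le[OF that] by simp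
  show "y \<in> cvec n" using assms(4) flag_space_cvec by blast
qed (use assms separated_notin finite_R in auto)

section \<open>Osculating flags in the Schubert problem\<close>

lemma osculating_regular: "osculating s Ms \<Longrightarrow> regular Ms"
proof -
  assume osc: "osculating s Ms"
  have "Defs.invertible_mat n (Ms j)" for j
    using osc invertible_mat_cong[of n "Ms j" "osc_mat (s j)"] osc_mat_invertible[of n "s j"]
    by (simp add: osculating_def)
  then show "regular Ms" by (simp add: regular_def)
qed

lemma osculating_flag_iff:
  assumes "osculating s Ms" "v \<in> cvec n" "i \<le> n"
  shows "v \<in> Fl Ms j i \<longleftrightarrow> [:- of_real (s j), 1:] ^ (n - i) dvd vec_poly (m + 1) v"
proof -
  have "Fl Ms j i = flag_space n (osc_mat (s j)) i"
    using assms by (intro flag_space_cong) (auto simp: osculating_def)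
  then show ?thesis using osc_flag_iff[of v "m + 1" i "s j"] assms(2,3) by simp
qed

lemma osculating_inj: "osculating s Ms \<Longrightarrow> i < length as \<Longrightarrow> j < length as \<Longrightarrow> s i = s j \<Longrightarrow> i = j"
  by (auto simp: osculating_def inj_on_def)

lemma osculating_rows:
  assumes "osculating s Ms"
  shows "vec_poly (m + 1) (row Ms 0) = [:- of_real (s j0), 1:] ^ (m + 1)"
    and "vec_poly (m + 1) (row Ms 1) = Polynomial.smult (- of_nat (m + 1)) ([:- of_real (s j0), 1:] ^ m)"
proof -
  have "row Ms i = mrow n (osc_mat (s j0)) i" if "i < n" for i
    using assms that by (auto simp: mrow_def osculating_def)
  then have r: "row Ms i = mrow (Suc (m + 1)) (osc_mat (s j0)) i" if "i < n" for i using that by simp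
  show "vec_poly (m + 1) (row Ms 0) = [:- of_real (s j0), 1:] ^ (m + 1)"
    by (subst r) (simp_all only: vec_poly_osc_row, simp_all)
  show "vec_poly (m + 1) (row Ms 1) = Polynomial.smult (- of_nat (m + 1)) ([:- of_real (s j0), 1:] ^ m)"
    by (subst r, simp, subst vec_poly_osc_row) simp_all
qed

text \<open>A nonzero polynomial of degree at most m + 1 cannot have more than m + 1 zeros counted
  with multiplicity. This is the transversality of osculating flags at distinct points.\<close>

lemma osculating_dependency:
  assumes osc: "osculating s Ms" and v: "v \<in> cvec n" and S: "S \<subseteq> {..<length as}"
    and i: "\<And>j. j \<in> S \<Longrightarrow> i j \<le> n \<and> v \<in> Fl Ms j (i j)"
    and big: "m + 1 < (\<Sum>j\<in>S. n - i j)"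
  shows "v = (\<lambda>_. 0)"
proof -
  have "vec_poly (m + 1) v = 0"
  proof (rule poly_zero_by_multiplicities[where I = S and s = "\<lambda>j. of_real (s j)" and c = "\<lambda>j. n - i j"])
    show "finite S" using S finite_subset by blast
    show "inj_on (\<lambda>j. complex_of_real (s j)) S"
      using S osculating_inj[OF osc] by (auto simp: inj_on_def)
    show "[:- of_real (s j), 1:] ^ (n - i j) dvd vec_poly (m + 1) v" if "j \<in> S" for j
      using osculating_flag_iff[OF osc v] i[OF that] by blast
    show "degree (vec_poly (m + 1) v) < (\<Sum>j\<in>S. n - i j)"
      using degree_vec_poly[of "m + 1" v] big by simp
  qed
  then show ?thesis using vec_poly_inj[of "m + 1" v "\<lambda>_. 0"] v by (simp add: vec_poly_0 cvec_def)
qed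

lemma osculating_separated:
  assumes osc: "osculating s Ms" shows "separated Ms"
  unfolding separated_iff[OF osculating_regular[OF osc]]
proof (intro allI impI)
  fix j y assume j: "j < length as" "j \<noteq> j0"
    and y: "y \<in> Fl Ms j0 2" "y \<in> Fl Ms j m"
  show "y = (\<lambda>_. 0)"
    by (rule osculating_dependency[OF osc, of y "{j0, j}" "\<lambda>i. if i = j0 then 2 else m"])
      (use y j j0 flag_space_cvec[of n "Ms j0" 2] in auto)
qed

section \<open>Problems without solutions\<close>

lemma SG_if_empty:
  assumes g: "poly_fun nvars g"
    and empty: "\<And>x. regular (ent n x) \<Longrightarrow> g x \<noteq> 0 \<Longrightarrow> inter (ent n x) = {}"
    and osc: "\<And>s x. osculating s (ent n x) \<Longrightarrow> g x \<noteq> 0"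
  shows "SG m as"
proof (rule SG_from_generic_condition[where g = g and c = 0, OF cond g])
  fix Ms x assume "Ms = ent n x" "\<And>j. j < length as \<Longrightarrow> Defs.invertible_mat n (Ms j)" "g x \<noteq> 0"
  then show "finite (inter Ms) \<and> card (inter Ms) = 0"
    using empty[of x] by (simp add: regular_def)
next
  fix s Ms x assume "inj_on s {..<length as}" "Ms = ent n x"
    "\<And>j a b. a < n \<Longrightarrow> b < n \<Longrightarrow> Ms j a b = osc_mat (s j) a b" "\<And>j a b. Ms j a b \<in> \<real>"
  then have "osculating s (ent n x)" "Ms = ent n x" by (auto simp: osculating_def)
  then show "g x \<noteq> 0 \<and> (\<forall>X\<in>inter Ms. real_point X)"
    using osc empty osculating_regular by blast
qed

lemma SG_fst_ge_3:
  assumes j: "j < length as" "fst (as ! j) \<ge> 3" shows "SG m as"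
proof -
  obtain g where g: "poly_fun nvars g" "\<And>x. g x = 0 \<longleftrightarrow> \<not> separated (ent n x)"
    using separated_condition by blast
  show ?thesis
  proof (rule SG_if_empty[OF g(1)])
    fix x assume reg: "regular (ent n x)" and gx: "g x \<noteq> 0"
    have jj0: "j \<noteq> j0" using j asj0 by auto
    have sub: "Fl (ent n x) j (n + 1 - fst (as ! j)) \<subseteq> Fl (ent n x) j m"
      using j by (intro flag_space_mono) simp
    {
      fix X assume X: "X \<in> inter (ent n x)"
      obtain w where w: "w \<in> X" "w \<in> Fl (ent n x) j0 2" "w \<noteq> (\<lambda>_. 0)"
        using X unfolding inter_iff[OF reg] meets_def by blast
      have "X \<subseteq> Fl (ent n x) j (n + 1 - fst (as ! j))"
        using X j unfolding inter_iff[OF reg] by simp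
      then have "w \<in> Fl (ent n x) j m" using w(1) sub by blast
      then have False using separated_iff[OF reg] g(2) gx j(1) jj0 w by blast
    }
    then show "inter (ent n x) = {}" by blast
  qed (use g(2) osculating_separated in blast)
qed

lemma SG_two_fst_ge_2:
  assumes i: "i < length as" "fst (as ! i) \<ge> 2" and j: "j < length as" "fst (as ! j) \<ge> 2"
    and ij: "i \<noteq> j"
  shows "SG m as"
proof -
  \<comment> \<open>The value of the hyperplane equation of flag \<open>k\<close> at row
    \<open>a\<close> of the basis of L. Then \<open>g\<close> is the determinant of two linear forms
    on L; it vanishes exactly if they have a common nonzero zero there.\<close>
  define l where "l k x a = last_det n (ent n x k) (row (ent n x) a)" for k x a
  define g where "g x = l i x 0 * l j x 1 + - (l i x 1 * l j x 0)" for x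
  have ne: "i \<noteq> j0" "j \<noteq> j0" using i j asj0 by auto
  have pl: "poly_fun nvars (\<lambda>x. l k x a)" if "k < length as" "a < n" for k a
    unfolding l_def mrow_def
    using that j0 by (intro poly_fun_last_det poly_fun_if poly_fun_const poly_fun_ent) auto
  have lin: "last_det n (ent n x k) (\<lambda>b. p * row (ent n x) 0 b + q * row (ent n x) 1 b) =
      p * l k x 0 + q * l k x 1" for k x p q
    by (simp add: last_det_comb l_def)
  show ?thesis
  proof (rule SG_if_empty[of g])
    show "poly_fun nvars g"
      unfolding g_def using i j by (intro poly_fun_add poly_fun_mult poly_fun_uminus pl) auto
  next
    fix x assume reg: "regular (ent n x)" and gx: "g x \<noteq> 0"
    have inv: "Defs.invertible_mat n (ent n x i)" "Defs.invertible_mat n (ent n x j)"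
      using reg i j by (auto simp: regular_def)
    {
      fix X assume X: "X \<in> inter (ent n x)"
      obtain w where w: "w \<in> X" "w \<in> Fl (ent n x) j0 2" "w \<noteq> (\<lambda>_. 0)"
        using X unfolding inter_iff[OF reg] meets_def by blast
      have sub: "X \<subseteq> Fl (ent n x) k (n - 1)" if "k < length as" "fst (as ! k) \<ge> 2" for k
        using X that flag_space_mono[of "n + 1 - fst (as ! k)" "n - 1" n "ent n x k"]
        unfolding inter_iff[OF reg] by force
      have wc: "w \<in> cvec n" using w(2) flag_space_cvec by blast
      obtain p q where pq: "w = (\<lambda>b. p * row (ent n x) 0 b + q * row (ent n x) 1 b)"
        using w(2) unfolding flag_space_2 by blast
      have "p * l i x 0 + q * l i x 1 = 0" "p * l j x 0 + q * l j x 1 = 0"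
        using last_det_zero_iff[OF inv(1) wc] last_det_zero_iff[OF inv(2) wc] sub[OF i] sub[OF j] w(1)
        unfolding pq lin by auto
      \<comment> \<open>Cramer's rule without division.\<close>
      moreover have "p * g x = l j x 1 * (p * l i x 0 + q * l i x 1) - l i x 1 * (p * l j x 0 + q * l j x 1)"
        "q * g x = l i x 0 * (p * l j x 0 + q * l j x 1) - l j x 0 * (p * l i x 0 + q * l i x 1)"
        by (simp_all add: g_def algebra_simps)
      ultimately have "p = 0" "q = 0" using gx by auto
      then have False using w(3) pq by simp
    }
    then show "inter (ent n x) = {}" by blast
  next
    fix s x assume osc: "osculating s (ent n x)"
    note reg = osculating_regular[OF osc]
    have inv: "Defs.invertible_mat n (ent n x i)" "Defs.invertible_mat n (ent n x j)"
      "Defs.invertible_mat n (ent n x j0)"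
      using reg i j j0 by (auto simp: regular_def)
    show "g x \<noteq> 0"
    proof
      assume "g x = 0"
      then have g0: "l i x 1 * l j x 0 + - l i x 0 * l j x 1 = 0" by (simp add: g_def algebra_simps)
      have "\<exists>p q. (p \<noteq> 0 \<or> q \<noteq> 0) \<and> p * l i x 0 + q * l i x 1 = 0 \<and> p * l j x 0 + q * l j x 1 = 0"
      proof (cases "l i x 0 = 0 \<and> l i x 1 = 0")
        case True
        show ?thesis
        proof (cases "l j x 0 = 0 \<and> l j x 1 = 0")
          case False
          then show ?thesis using True by (intro exI[of _ "l j x 1"] exI[of _ "- l j x 0"]) auto
        qed (use True in \<open>intro exI[of _ 1] exI[of _ 0], auto\<close>)
      next
        case False
        then show ?thesis using g0 by (intro exI[of _ "l i x 1"] exI[of _ "- l i x 0"]) auto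
      qed
      then obtain p q where pq: "p \<noteq> 0 \<or> q \<noteq> 0" "p * l i x 0 + q * l i x 1 = 0" "p * l j x 0 + q * l j x 1 = 0"
        by blast
      let ?w = "\<lambda>b. p * row (ent n x) 0 b + q * row (ent n x) 1 b"
      have wL: "?w \<in> Fl (ent n x) j0 2" unfolding flag_space_2 by blast
      then have wc: "?w \<in> cvec n" using flag_space_cvec by blast
      have "?w \<in> Fl (ent n x) i (n - 1)" "?w \<in> Fl (ent n x) j (n - 1)"
        using last_det_zero_iff[OF inv(1) wc] last_det_zero_iff[OF inv(2) wc] pq unfolding lin by auto
      \<comment> \<open>The codimensions m, 1 and 1 add up to m + 2, one more than a nonzero vector
        allows.\<close>
      then have "?w = (\<lambda>_. 0)"
        by (intro osculating_dependency[OF osc wc, of "{j0, i, j}" "\<lambda>i. if i = j0 then 2 else n - 1"])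
          (use wL ne ij i j j0 in auto)
      then show False using rows_independent[OF inv(3)] pq(1) by auto
    qed
  qed
qed

end

section \<open>One condition that confines the plane to a hyperplane\<close>

lemma linear_power_dvd_cancel:
  fixes P q :: "complex poly"
  assumes "[:- a, 1:] ^ k dvd P * q" "poly P a \<noteq> 0"
  shows "[:- a, 1:] ^ k dvd q"
proof -
  have "order a P = 0" "P \<noteq> 0" using assms(2) by (auto simp: order_0I)
  then show ?thesis using assms(1) by (cases "q = 0") (simp_all add: order_divides order_mult)
qed

context schubert_problem
begin

text \<open>These are the equations of the line system in terms of polynomials: x agrees with a
  multiple of y modulo (z - s(i))^(c(i) + 1). At \<open>i0\<close> the multiple is 0 because x is
  taken from that space.\<close>

lemma osculating_line_vec_dvd:
  assumes osc: "osculating s Ms" and LS: "line_system n R i0 d Ms y"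
    and v: "in_kernel (eqs i0) (unk i0) (line_coeff i0 d Ms y) v"
    and i: "i \<in> R"
  shows "\<exists>\<mu>. (i = i0 \<longrightarrow> \<mu> = 0) \<and> [:- of_real (s i), 1:] ^ Suc (c i) dvd
    vec_poly (m + 1) (line_vec n i0 d Ms v) - Polynomial.smult \<mu> (vec_poly (m + 1) y)"
proof -
  interpret line_system n R i0 d Ms y by (rule LS)
  let ?x = "line_vec n i0 d Ms v"
  define \<mu> where "\<mu> = (if i = i0 then 0 else v (i, d i))"
  let ?w = "\<lambda>b. 1 * ?x b + (- \<mu>) * y b"
  have "?w \<in> Fl Ms i (d i)"
  proof (cases "i = i0")
    case True
    then show ?thesis using line_vec_flag by (simp add: \<mu>_def)
  next
    case False
    then have "?w b = (\<Sum>a<d i. v (i, a) * mrow n (Ms i) a b)" for b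
      using v[unfolded ker_iff, rule_format, of i b] i by (simp add: \<mu>_def)
    then show ?thesis unfolding flag_space_iff by (intro exI[of _ "\<lambda>a. v (i, a)"]) blast
  qed
  moreover from this have "?w \<in> cvec n" using flag_space_cvec by blast
  ultimately have "[:- of_real (s i), 1:] ^ (n - d i) dvd vec_poly (m + 1) ?w"
    using osculating_flag_iff[OF osc] d_le[OF i] by simp
  moreover have "n - d i = Suc (c i)" using d_c(1)[OF i] by simp
  moreover have "vec_poly (m + 1) ?w = vec_poly (m + 1) ?x - Polynomial.smult \<mu> (vec_poly (m + 1) y)"
    by (simp only: vec_poly_comb) simp
  ultimately show ?thesis by (intro exI[of _ \<mu>]) (simp add: \<mu>_def)
qed

lemma osculating_line_vec_zero:
  assumes LS: "line_system n R i0 d Ms y"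
    and v: "in_kernel (eqs i0) (unk i0) (line_coeff i0 d Ms y) v"
    and z: "vec_poly (m + 1) (line_vec n i0 d Ms v) = 0" and cc: "cc \<in> unk i0"
  shows "v cc = 0"
proof (rule ccontr)
  interpret line_system n R i0 d Ms y by (rule LS)
  assume "v cc \<noteq> 0"
  then have "line_vec n i0 d Ms v \<noteq> (\<lambda>_. 0)" by (rule line_vec_nonzero[OF v cc])
  moreover have "line_vec n i0 d Ms v = (\<lambda>_. 0)"
    using vec_poly_inj[of "m + 1" "line_vec n i0 d Ms v" "\<lambda>_. 0"] z
      line_vec_flag[of v] flag_space_cvec[of n "Ms i0" "d i0"]
    by (auto simp: vec_poly_0 cvec_def)
  ultimately show False by simp
qed

text \<open>The vector of L in the hyperplane of \<open>i0\<close> has an explicit formula,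
  \<open>q x\<close>, polynomial in the flags and real for real flags. The remaining system has one
  unknown more than equations, so a solution always exists, and the extra condition \<open>K\<close>
  below provides uniqueness.\<close>

lemma SG_one_fst_2:
  assumes i0: "i0 < length as" "fst (as ! i0) = 2"
    and others: "\<And>j. j < length as \<Longrightarrow> j \<noteq> i0 \<Longrightarrow> fst (as ! j) = 1"
  shows "SG m as"
proof -
  have "(\<Sum>j<length as. fst (as ! j) - 1) = (\<Sum>j<length as. if j = i0 then 1 else 0)"
    using i0 others by (intro sum.cong) auto
  then have sumR: "(\<Sum>j\<in>R. c j) = m" using sum_c i0 by simp
  have ij: "i0 \<noteq> j0" using i0 asj0 by auto
  have i0R: "i0 \<in> R" using condD[OF i0(1)] i0 ij by (auto simp: R_def)
  have d0: "d i0 \<ge> 1" using condD(3)[OF i0(1)] by (simp add: d_def)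
  define l where "l x a = last_det n (ent n x i0) (row (ent n x) a)" for x a
  define q where "q x = (\<lambda>b. l x 1 * row (ent n x) 0 b + (- l x 0) * row (ent n x) 1 b)" for x
  define E where "E = eqs i0"
  define C where "C = unk i0"
  \<comment> \<open>An additional equation, indexed by \<open>None\<close>, sets the last coordinate
    of x in the space of \<open>i0\<close> to 0; if the enlarged square system is nonsingular, the
    original kernel is a line. For osculating flags the vanishing of this coordinate means one more
    zero of x at the point of \<open>i0\<close>.\<close>
  define ref where "ref = (i0, d i0 - 1)"
  define A where "A x e cc = (case e of None \<Rightarrow> if cc = ref then 1 else 0
      | Some e \<Rightarrow> line_coeff i0 d (ent n x) (q x) e cc)" for x e cc
  have fin: "finite E" "finite C"
    unfolding E_def C_def by (simp_all add: finite_line_equations finite_line_unknowns finite_R)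
  have refC: "ref \<in> C" using i0R d0 by (simp add: ref_def C_def line_unknowns_def)
  have cardR: "card R \<ge> 1" using i0R finite_R by (simp add: Suc_le_eq card_gt_0_iff) blast
  have cardEC: "card C = Suc (card E)"
  proof -
    obtain r where r: "card R = Suc r" using cardR by (cases "card R") auto
    show ?thesis using card_unknowns[OF i0R] sumR card_line_equations[OF i0R, of n]
      by (simp add: r E_def C_def)
  qed
  have pl: "poly_fun nvars (\<lambda>x. l x a)" if "a < n" for a
    unfolding l_def mrow_def
    using that j0 i0 by (intro poly_fun_last_det poly_fun_if poly_fun_const poly_fun_ent) auto
  have lin: "last_det n (ent n x i0) (\<lambda>b. p * row (ent n x) 0 b + p' * row (ent n x) 1 b) =
      p * l x 0 + p' * l x 1" for x p p'
    by (simp add: last_det_comb l_def)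
  have pA: "poly_fun nvars (\<lambda>x. A x e cc)"
    if e: "e \<in> insert None (Some ` E)" and cc: "cc \<in> C" for e cc
  proof (cases e)
    case None
    then show ?thesis by (simp add: A_def poly_fun_const)
  next
    case (Some e')
    obtain i b where e': "e' = (i, b)" by (cases e')
    have ib: "i \<in> R" "i \<noteq> i0" "b < n" using e Some e' by (auto simp: E_def line_equations_def)
    then have il: "i < length as" "d i \<le> n" "d i0 \<le> n"
      using d_le[of i] d_le[OF i0R] by (auto simp: R_def)
    have b1: "snd cc < n" if "fst cc = i0"
      using cc that il by (cases cc) (auto simp: C_def line_unknowns_def)
    have pq: "poly_fun nvars (\<lambda>x. q x b)"
      unfolding q_def mrow_def using ib j0
      by (intro poly_fun_add poly_fun_mult poly_fun_uminus pl poly_fun_if poly_fun_const poly_fun_ent) auto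
    show ?thesis
      unfolding A_def Some option.case line_coeff_def e' fst_conv snd_conv
      using b1 il ib i0(1)
      by (intro poly_fun_if poly_fun_uminus poly_fun_ent poly_fun_const pq) auto
  qed
  have "\<exists>K. poly_fun nvars K \<and>
      (\<forall>x. K x = 0 \<longleftrightarrow> \<not> trivial_kernel (insert None (Some ` E)) C (A x))"
  proof (rule kernel_condition)
    show "card (insert None (Some ` E)) = card C"
      using fin cardEC by (simp add: card_insert_if card_image)
  qed (use fin pA in auto)
  then obtain K where K: "poly_fun nvars K"
    "\<And>x. K x = 0 \<longleftrightarrow> \<not> trivial_kernel (insert None (Some ` E)) C (A x)" by blast
  have ker': "in_kernel (insert None (Some ` E)) C (A x) v \<longleftrightarrow>
      v ref = 0 \<and> in_kernel E C (line_coeff i0 d (ent n x) (q x)) v" for x v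
  proof -
    have "(\<Sum>cc\<in>C. (if cc = ref then 1 else 0) * v cc) = (\<Sum>cc\<in>C. if cc = ref then v ref else 0)"
      by (intro sum.cong) auto
    then have "(\<Sum>cc\<in>C. (if cc = ref then 1 else 0) * v cc) = v ref"
      using refC fin by simp
    then show ?thesis by (simp add: in_kernel_def A_def)
  qed
  obtain gs where gs: "poly_fun nvars gs" "\<And>x. gs x = 0 \<longleftrightarrow> \<not> separated (ent n x)"
    using separated_condition by blast
  \<comment> \<open>The factors say that the flags are separated, that row 0 is outside the
    hyperplane of \<open>i0\<close>, so that \<open>q x\<close> is nonzero and every vector of L in
    that hyperplane is a multiple of it, and that the solution is unique.\<close>
  define g where "g x = gs x * (l x 0 * K x)" for x
  have qL: "q x \<in> Fl (ent n x) j0 2" for x unfolding q_def flag_space_2 by blast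
  have q0: "q x \<noteq> (\<lambda>_. 0)" if reg: "regular (ent n x)" and l0: "l x 0 \<noteq> 0" for x
  proof
    assume "q x = (\<lambda>_. 0)"
    then have "l x 1 = 0 \<and> - l x 0 = 0" unfolding q_def
      using reg j0 by (intro rows_independent[of n "ent n x j0"]) (auto simp: regular_def)
    then show False using l0 by simp
  qed
  have core: "\<exists>X0. inter (ent n x) = {X0} \<and>
      ((\<forall>j a b. ent n x j a b \<in> \<real>) \<longrightarrow> real_point X0)"
    if reg: "regular (ent n x)" and gx: "g x \<noteq> 0" for x
  proof -
    have sep: "separated (ent n x)" and l0: "l x 0 \<noteq> 0" and K0: "K x \<noteq> 0"
      using gx gs(2)[of x] by (auto simp: g_def)
    let ?Ms = "ent n x" and ?y = "q x"
    have inv: "Defs.invertible_mat n (?Ms i0)" using reg i0 by (simp add: regular_def)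
    interpret LS: line_system n R i0 d ?Ms ?y
      by (rule line_systemI[OF reg sep i0R qL q0[OF reg l0]])
    have triv: "trivial_kernel (insert None (Some ` E)) C (A x)" using K(2) K0 by blast
    have one: LS.one_dim_ker
      unfolding LS.one_dim_ker_def
    proof (intro allI impI)
      fix v w cc assume v: "LS.ker v" and w: "LS.ker w" and cc: "cc \<in> unk i0" "v cc \<noteq> 0"
      have vr: "v ref \<noteq> 0"
      proof
        assume "v ref = 0"
        then have "in_kernel (insert None (Some ` E)) C (A x) v" using v ker' by (simp add: E_def C_def)
        then show False using trivial_kernelD[OF triv] cc by (simp add: C_def)
      qed
      have "in_kernel (insert None (Some ` E)) C (A x) (\<lambda>c. 1 * w c + (- w ref / v ref) * v c)"
        unfolding ker'
      proof
        show "1 * w ref + (- w ref / v ref) * v ref = 0" using vr by simp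
        show "in_kernel E C (line_coeff i0 d ?Ms ?y) (\<lambda>c. 1 * w c + (- w ref / v ref) * v c)"
          unfolding E_def C_def by (rule in_kernel_comb[OF w v])
      qed
      then have "1 * w c + (- w ref / v ref) * v c = 0" if "c \<in> C" for c
        using trivial_kernelD[OF triv] that by blast
      then show "\<exists>\<kappa>. \<forall>c\<in>unk i0. w c = \<kappa> * v c"
        by (intro exI[of _ "w ref / v ref"]) (simp add: C_def eq_neg_iff_add_eq_0)
    qed
    have "\<not> trivial_kernel E C (line_coeff i0 d ?Ms ?y)"
      by (rule kernel_nontrivial[OF fin]) (simp add: cardEC)
    then obtain v cc where v: "LS.ker v" "cc \<in> unk i0" "v cc \<noteq> 0"
      unfolding trivial_kernel_def E_def C_def by blast
    define X0 where "X0 = cspan [line_vec n i0 d ?Ms v, ?y]"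
    have X0: "X0 \<in> grass2 n" "\<And>j. j \<in> R \<Longrightarrow> meets X0 (Fl ?Ms j (d j))"
      unfolding X0_def by (rule LS.plane_of_kernel[OF v])+
    have yX0: "?y \<in> X0" unfolding X0_def by (rule cspan2_right)
    have ynz: "?y \<noteq> (\<lambda>_. 0)" by (rule q0[OF reg l0])
    have "last_det n (?Ms i0) ?y = 0" unfolding q_def lin by simp
    then have yH: "?y \<in> Fl ?Ms i0 (n - 1)"
      using last_det_zero_iff[OF inv, of ?y] LS.y by simp
    have xH: "line_vec n i0 d ?Ms v \<in> Fl ?Ms i0 (n - 1)"
      using LS.line_vec_flag[of v] flag_space_mono[of "d i0" "n - 1" n "?Ms i0"] d_le[OF i0R] by auto
    have "X0 \<subseteq> Fl ?Ms i0 (n - 1)"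
    proof
      fix w assume "w \<in> X0"
      then obtain a b where "\<And>j. w j = a * line_vec n i0 d ?Ms v j + b * ?y j"
        unfolding X0_def cspan2 by blast
      then have "w = (\<lambda>j. a * line_vec n i0 d ?Ms v j + b * ?y j)" by (intro ext)
      then show "w \<in> Fl ?Ms i0 (n - 1)" using flag_space_comb[OF xH yH, of a b] by simp
    qed
    then have X0I: "X0 \<in> inter ?Ms"
      unfolding inter_iff[OF reg]
    proof (intro conjI ballI allI impI)
      show "meets X0 (Fl ?Ms j0 2)" unfolding meets_def using yX0 qL ynz by blast
      fix j assume "j < length as" "2 \<le> fst (as ! j)"
      then have "j = i0" using others[of j] by fastforce
      then show "X0 \<subseteq> Fl ?Ms j (n + 1 - fst (as ! j))"
        using \<open>X0 \<subseteq> Fl ?Ms i0 (n - 1)\<close> i0 by simp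
    qed (use X0 in auto)
    have "X = X0" if X: "X \<in> inter ?Ms" for X
    proof -
      have XG: "X \<in> grass2 n" and XR: "\<And>j. j \<in> R \<Longrightarrow> meets X (Fl ?Ms j (d j))"
        using X unfolding inter_iff[OF reg] by auto
      obtain w where w: "w \<in> X" "w \<in> Fl ?Ms j0 2" "w \<noteq> (\<lambda>_. 0)"
        using X unfolding inter_iff[OF reg] meets_def by blast
      obtain p p' where pp: "w = (\<lambda>b. p * row ?Ms 0 b + p' * row ?Ms 1 b)"
        using w(2) unfolding flag_space_2 by blast
      have all: "\<forall>j<length as. 2 \<le> fst (as ! j) \<longrightarrow> X \<subseteq> Fl ?Ms j (n + 1 - fst (as ! j))"
        using X unfolding inter_iff[OF reg] by (elim conjE)
      have "X \<subseteq> Fl ?Ms i0 (n - 1)" using all[rule_format, OF i0(1)] i0(2) by simp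
      then have "w \<in> Fl ?Ms i0 (n - 1)" using w(1) by blast
      moreover have "w \<in> cvec n" using w(2) flag_space_cvec by blast
      ultimately have "last_det n (?Ms i0) w = 0" using last_det_zero_iff[OF inv] by simp
      then have pl0: "p * l x 0 + p' * l x 1 = 0" unfolding pp lin .
      have p'0: "p' \<noteq> 0" using pl0 l0 w(3) pp by auto
      have l1: "l x 1 = (- l x 0 / p') * p"
        using pl0 p'0 by (simp add: field_simps eq_neg_iff_add_eq_0 add.commute)
      have "?y b = (- l x 0 / p') * w b + 0 * w b" for b
        unfolding q_def pp l1 using p'0 by (simp add: field_simps)
      then have "?y = (\<lambda>b. (- l x 0 / p') * w b + 0 * w b)" by (intro ext)
      then have "?y \<in> X" using grass2_comb[OF XG w(1) w(1), of "- l x 0 / p'" 0] by simp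
      then show ?thesis using LS.plane_unique[OF one XG _ XR X0(1) yX0 X0(2)] by blast
    qed
    then have I: "inter ?Ms = {X0}" using X0I by blast
    moreover have "real_point X0" if real: "\<forall>j a b. ent n x j a b \<in> \<real>"
    proof (rule LS.plane_real[OF one _ _ X0(1) yX0 X0(2)])
      have "row ?Ms a b \<in> \<real>" for a b using real by (simp add: mrow_def)
      then show "?y b \<in> \<real>" for b using real
        unfolding q_def l_def by (intro Reals_add Reals_mult Reals_minus last_det_real) auto
    qed (use real in auto)
    ultimately show ?thesis by blast
  qed
  have osc_ok: "g x \<noteq> 0" if osc: "osculating s (ent n x)" for s x
  proof -
    let ?Ms = "ent n x"
    note reg = osculating_regular[OF osc]
    have sep: "separated ?Ms" by (rule osculating_separated[OF osc])
    have inv: "Defs.invertible_mat n (?Ms i0)" "Defs.invertible_mat n (?Ms j0)"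
      using reg i0 j0 by (auto simp: regular_def)
    have ne: "s i0 \<noteq> s j0" using osculating_inj[OF osc i0(1) j0] ij by blast
    have l0: "l x 0 \<noteq> 0"
    proof
      assume "l x 0 = 0"
      then have H: "row ?Ms 0 \<in> Fl ?Ms i0 (n - 1)"
        using last_det_zero_iff[OF inv(1) row_cvec] by (simp add: l_def)
      have L: "row ?Ms 0 \<in> Fl ?Ms j0 1"
        unfolding flag_space_iff by (intro exI[of _ "\<lambda>_. 1"]) simp
      have "row ?Ms 0 = (\<lambda>_. 0)"
        by (rule osculating_dependency[OF osc row_cvec, of "{j0, i0}" "\<lambda>i. if i = j0 then 1 else n - 1"])
          (use H L ij i0 j0 in auto)
      then have "1 = (0::complex) \<and> 0 = (0::complex)"
        by (intro rows_independent[OF inv(2)]) simp_all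
      then show False by simp
    qed
    have yn: "q x \<noteq> (\<lambda>_. 0)" by (rule q0[OF reg l0])
    have LS: "line_system n R i0 d ?Ms (q x)" by (rule line_systemI[OF reg sep i0R qL yn])
    then interpret LS: line_system n R i0 d ?Ms "q x" .
    have "last_det n (?Ms i0) (q x) = 0" unfolding q_def lin by simp
    then have yH: "q x \<in> Fl ?Ms i0 (n - 1)"
      using last_det_zero_iff[OF inv(1), of "q x"] LS.y by simp
    let ?L = "\<lambda>j. [:- of_real (s j), 1:] :: complex poly"
    \<comment> \<open>A vector of L is divisible by (z - s(j0))^m, and one in the hyperplane of
      \<open>i0\<close> also by z - s(i0); the degree m + 1 leaves only a constant.\<close>
    have qp: "vec_poly (m + 1) (q x) = ?L i0 * Polynomial.smult (l x 1) (?L j0 ^ m)"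
    proof -
      have "vec_poly (m + 1) (q x) = Polynomial.smult (l x 1) (?L j0 ^ (m + 1))
          + Polynomial.smult (- l x 0) (Polynomial.smult (- of_nat (m + 1)) (?L j0 ^ m))"
        unfolding q_def vec_poly_comb osculating_rows[OF osc] ..
      also have "\<dots> = (Polynomial.smult (l x 1) (?L j0) + [:l x 0 * of_nat (m + 1):]) * ?L j0 ^ m"
        by (rule poly_ext) (simp add: algebra_simps)
      finally have e1: "vec_poly (m + 1) (q x) =
          (Polynomial.smult (l x 1) (?L j0) + [:l x 0 * of_nat (m + 1):]) * ?L j0 ^ m" .
      have "?L i0 ^ 1 dvd vec_poly (m + 1) (q x)"
        using osculating_flag_iff[OF osc LS.y, of "n - 1" i0] yH by simp
      then have "poly (vec_poly (m + 1) (q x)) (of_real (s i0)) = 0"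
        by (simp only: poly_eq_0_iff_dvd power_one_right)
      then have "poly (Polynomial.smult (l x 1) (?L j0) + [:l x 0 * of_nat (m + 1):]) (of_real (s i0)) *
          poly (?L j0 ^ m) (of_real (s i0)) = 0"
        unfolding e1 by (simp only: poly_mult)
      moreover have "poly (?L j0 ^ m) (of_real (s i0)) \<noteq> 0" using ne by simp
      ultimately have "poly (Polynomial.smult (l x 1) (?L j0) + [:l x 0 * of_nat (m + 1):]) (of_real (s i0)) = 0"
        by (simp only: mult_eq_0_iff) blast
      then have "l x 1 * (of_real (s i0) - of_real (s j0)) + l x 0 * of_nat (m + 1) = 0"
        by (simp add: algebra_simps)
      then have "l x 0 * of_nat (m + 1) = - l x 1 * (of_real (s i0) - of_real (s j0))"
        by (simp only: eq_neg_iff_add_eq_0 mult_minus_left add.commute)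
      then have "Polynomial.smult (l x 1) (?L j0) + [:l x 0 * of_nat (m + 1):] =
          Polynomial.smult (l x 1) (?L i0)"
        by (simp only:) (rule poly_ext, simp add: algebra_simps)
      then show ?thesis unfolding e1 by (simp only: mult_smult_left mult_smult_right)
    qed
    \<comment> \<open>Both x and y are divisible by z - s(i0). After division x becomes
      \<open>F1\<close> of degree at most m, and \<open>wronskian_rigidity\<close> applies with N =
      m; the equation for \<open>ref\<close> supplies the order of contact that the division cost at
      s(i0). So \<open>F1\<close> is a multiple of (z - s(j0))^m, and it vanishes at s(i0), hence it
      is 0.\<close>
    have "trivial_kernel (insert None (Some ` E)) C (A x)"
      unfolding trivial_kernel_def
    proof (intro allI impI ballI)
      fix v cc assume v: "in_kernel (insert None (Some ` E)) C (A x) v" and cc: "cc \<in> C"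
      have vk: "LS.ker v" and vr: "v ref = 0" using v ker' by (auto simp: E_def C_def)
      let ?x = "line_vec n i0 d ?Ms v"
      let ?F = "vec_poly (m + 1) ?x"
      obtain D where D: "d i0 = Suc D" using d0 by (cases "d i0") auto
      have "?x \<in> Fl ?Ms i0 (d i0 - 1)"
        unfolding flag_space_iff using vr
        by (intro exI[of _ "\<lambda>a. v (i0, a)"]) (simp add: line_vec_def D ref_def)
      moreover have "?x \<in> cvec n" using LS.line_vec_flag flag_space_cvec by blast
      moreover have "n - (d i0 - 1) = Suc (Suc (c i0))" using d_c(1)[OF i0R] d0 by simp
      ultimately have dF: "?L i0 ^ Suc (Suc (c i0)) dvd ?F"
        using osculating_flag_iff[OF osc, of ?x "d i0 - 1" i0] d_le[OF i0R] by simp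
      then obtain F2 where F2: "?F = ?L i0 ^ Suc (Suc (c i0)) * F2" by (elim dvdE)
      define F1 where "F1 = ?L i0 ^ Suc (c i0) * F2"
      have F1: "?F = ?L i0 * F1" by (simp only: F2 F1_def power_Suc mult.assoc)
      have degF1: "degree F1 \<le> m"
      proof (cases "F1 = 0")
        case False
        then have "degree (?L i0 * F1) = degree (?L i0) + degree F1" by (intro degree_mult_eq) auto
        then show ?thesis using degree_vec_poly[of "m + 1" ?x] unfolding F1 by simp
      qed simp
      have "\<exists>\<kappa>. F1 = Polynomial.smult \<kappa> (?L j0 ^ m)"
      proof (rule wronskian_rigidity[OF degF1 finite_R, of "\<lambda>i. of_real (s i)" c])
        show "inj_on (\<lambda>i. complex_of_real (s i)) R"
          using osculating_inj[OF osc] by (auto simp: inj_on_def R_def)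
        fix i assume i: "i \<in> R"
        show "\<exists>\<mu>. ?L i ^ Suc (c i) dvd F1 - Polynomial.smult \<mu> (?L j0 ^ m)"
        proof (cases "i = i0")
          case True
          then show ?thesis unfolding F1_def by (intro exI[of _ 0]) simp
        next
          case False
          obtain \<mu> where \<mu>: "?L i ^ Suc (c i) dvd ?F - Polynomial.smult \<mu> (vec_poly (m + 1) (q x))"
            using osculating_line_vec_dvd[OF osc LS vk i] by blast
          have "?F - Polynomial.smult \<mu> (vec_poly (m + 1) (q x)) =
              ?L i0 * (F1 - Polynomial.smult (\<mu> * l x 1) (?L j0 ^ m))"
            unfolding F1 qp by (simp only: right_diff_distrib mult_smult_right smult_smult)
          then have "?L i ^ Suc (c i) dvd ?L i0 * (F1 - Polynomial.smult (\<mu> * l x 1) (?L j0 ^ m))"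
            using \<mu> by (simp only:)
          moreover have "poly (?L i0) (of_real (s i)) \<noteq> 0"
            using osculating_inj[OF osc] i i0(1) False by (auto simp: R_def)
          ultimately have "?L i ^ Suc (c i) dvd F1 - Polynomial.smult (\<mu> * l x 1) (?L j0 ^ m)"
            by (rule linear_power_dvd_cancel)
          then show ?thesis by blast
        qed
      qed (use m sumR in auto)
      then obtain \<kappa> where \<kappa>: "F1 = Polynomial.smult \<kappa> (?L j0 ^ m)" by blast
      have "poly F1 (of_real (s i0)) = 0" by (simp add: F1_def)
      then have "\<kappa> = 0" using ne by (simp add: \<kappa>)
      then have "?F = 0" unfolding F1 \<kappa> by simp
      then show "v cc = 0" using osculating_line_vec_zero[OF LS vk] cc by (simp add: C_def)
    qed
    then show ?thesis using K(2) l0 sep gs(2) by (simp add: g_def)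
  qed
  show ?thesis
  proof (rule SG_from_generic_condition[where g = g and c = 1, OF cond])
    show "poly_fun nvars g"
      unfolding g_def by (intro poly_fun_mult gs(1) K(1) pl) simp
  next
    fix Ms x assume "Ms = ent n x" "\<And>j. j < length as \<Longrightarrow> Defs.invertible_mat n (Ms j)" "g x \<noteq> 0"
    then show "finite (inter Ms) \<and> card (inter Ms) = 1"
      using core[of x] by (auto simp: regular_def)
  next
    fix s Ms x assume "inj_on s {..<length as}" and Ms: "Ms = ent n x"
      and "\<And>j a b. a < n \<Longrightarrow> b < n \<Longrightarrow> Ms j a b = osc_mat (s j) a b" and real: "\<And>j a b. Ms j a b \<in> \<real>"
    then have osc: "osculating s (ent n x)" by (auto simp: osculating_def)
    then show "g x \<noteq> 0 \<and> (\<forall>X\<in>inter Ms. real_point X)"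
      using osc_ok[OF osc] core[OF osculating_regular[OF osc]] real Ms by auto
  qed
qed

end

section \<open>The pencil: no condition confines the plane\<close>

context schubert_problem
begin

text \<open>An affine chart of the projective line of L. Only \<open>row Ms 0\<close> is left out,
  the point at infinity; for osculating flags it corresponds to \<tau> = \<infinity>, that is, to a
  constant polynomial in w.\<close>

definition pencil_vec :: "(nat \<Rightarrow> nat \<Rightarrow> nat \<Rightarrow> complex) \<Rightarrow> complex \<Rightarrow> nat \<Rightarrow> complex" where
  "pencil_vec Ms t = (\<lambda>b. t * row Ms 0 b + 1 * row Ms 1 b)"

lemma pencil_vec_flag: "pencil_vec Ms t \<in> Fl Ms j0 2"
  unfolding pencil_vec_def flag_space_2 by blast

lemma pencil_vec_nonzero:
  assumes "regular Ms" shows "pencil_vec Ms t \<noteq> (\<lambda>_. 0)"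
proof
  assume "pencil_vec Ms t = (\<lambda>_. 0)"
  then have "t = 0 \<and> (1::complex) = 0"
    unfolding pencil_vec_def using assms j0 by (intro rows_independent[of n "Ms j0"]) (auto simp: regular_def)
  then show False by simp
qed

lemma row_0_flag: "row Ms 0 \<in> Fl Ms j0 2"
  unfolding flag_space_2 by (intro exI[of _ 1] exI[of _ 0]) simp

lemma row_0_nonzero:
  assumes "regular Ms" shows "row Ms 0 \<noteq> (\<lambda>_. 0)"
proof
  assume "row Ms 0 = (\<lambda>_. 0)"
  then have "(1::complex) = 0 \<and> (0::complex) = 0"
    using assms j0 by (intro rows_independent[of n "Ms j0"]) (auto simp: regular_def)
  then show False by simp
qed

text \<open>Each plane in the intersection meets the line \<open>K\<^sub>2\<close> of the flag \<open>j0\<close> in a single point,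
  and \<open>row Ms 0\<close> is not that point; hence the planes correspond to the roots \<open>t\<close> of the pencil.\<close>

lemma pencil_count:
  assumes reg: "regular Ms" and sep: "separated Ms"
    and fst1: "\<And>j. j < length as \<Longrightarrow> fst (as ! j) = 1" and i0: "i0 \<in> R"
    and lead: "trivial_kernel (eqs i0) (unk i0) (line_coeff i0 d Ms (row Ms 0))"
    and Z: "\<And>t. t \<in> Z \<longleftrightarrow> \<not> trivial_kernel (eqs i0) (unk i0)
      (line_coeff i0 d Ms (pencil_vec Ms t))"
    and one: "\<And>t. t \<in> Z \<Longrightarrow> line_system.one_dim_ker n R i0 d Ms (pencil_vec Ms t)"
  obtains F where "bij_betw F Z (inter Ms)"
    "\<And>t. t \<in> Z \<Longrightarrow> pencil_vec Ms t \<in> F t"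
proof -
  let ?I = "inter Ms"
  have inter: "X \<in> ?I \<longleftrightarrow> X \<in> grass2 n \<and> meets X (Fl Ms j0 2) \<and>
      (\<forall>j\<in>R. meets X (Fl Ms j (d j)))" for X
    unfolding inter_iff[OF reg] using fst1 by auto
  have LS: "line_system n R i0 d Ms (pencil_vec Ms t)" for t
    by (rule line_systemI[OF reg sep i0 pencil_vec_flag pencil_vec_nonzero[OF reg]])
  have "\<exists>X. X \<in> ?I \<and> pencil_vec Ms t \<in> X" if t: "t \<in> Z" for t
  proof -
    interpret LS: line_system n R i0 d Ms "pencil_vec Ms t" by (rule LS)
    obtain v cc where v: "LS.ker v" "cc \<in> unk i0" "v cc \<noteq> 0"
      using t unfolding Z trivial_kernel_def by blast
    have "pencil_vec Ms t \<in> cspan [line_vec n i0 d Ms v, pencil_vec Ms t]" by (rule cspan2_right)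
    moreover from this have "meets (cspan [line_vec n i0 d Ms v, pencil_vec Ms t]) (Fl Ms j0 2)"
      unfolding meets_def using pencil_vec_flag pencil_vec_nonzero[OF reg] by blast
    ultimately show ?thesis using LS.plane_of_kernel[OF v] unfolding inter by blast
  qed
  then have "\<forall>t\<in>Z. \<exists>X. X \<in> ?I \<and> pencil_vec Ms t \<in> X" by blast
  from bchoice[OF this] obtain F where "\<forall>t\<in>Z. F t \<in> ?I \<and> pencil_vec Ms t \<in> F t" ..
  then have F: "\<And>t. t \<in> Z \<Longrightarrow> F t \<in> ?I" "\<And>t. t \<in> Z \<Longrightarrow> pencil_vec Ms t \<in> F t" by auto
  have "inj_on F Z"
  proof (rule inj_onI, rule ccontr)
    fix t t' assume t: "t \<in> Z" "t' \<in> Z" "F t = F t'" and ne: "t \<noteq> t'"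
    have G: "F t \<in> grass2 n" using F(1)[OF t(1)] inter by blast
    \<comment> \<open>A plane containing two different pencil vectors would be L itself, but L has
      no nonzero vector in the space of \<open>i0\<close>, which the plane must meet.\<close>
    have "lin_indep [pencil_vec Ms t, pencil_vec Ms t']"
      unfolding lin_indep2
    proof (intro allI impI)
      fix a b assume ab: "\<forall>j. a * pencil_vec Ms t j + b * pencil_vec Ms t' j = 0"
      have "(\<lambda>j. (a * t + b * t') * row Ms 0 j + (a + b) * row Ms 1 j) = (\<lambda>_. 0)"
      proof
        fix j show "(a * t + b * t') * row Ms 0 j + (a + b) * row Ms 1 j = 0"
          using ab[rule_format, of j] by (simp add: pencil_vec_def algebra_simps)
      qed
      then have 0: "a * t + b * t' = 0 \<and> a + b = 0"
        using reg j0 by (intro rows_independent[of n "Ms j0"]) (auto simp: regular_def)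
      then have "b = - a" by (simp add: eq_neg_iff_add_eq_0 add.commute)
      then have "a * (t - t') = 0" using 0 by (simp add: algebra_simps)
      then show "a = 0 \<and> b = 0" using ne \<open>b = - a\<close> by simp
    qed
    then have "F t = cspan [pencil_vec Ms t, pencil_vec Ms t']"
      using grass2_basis[OF G F(2)[OF t(1)]] F(2)[OF t(2)] t(3) by simp
    moreover obtain w where w: "w \<in> F t" "w \<in> Fl Ms i0 (d i0)" "w \<noteq> (\<lambda>_. 0)"
      using F(1)[OF t(1)] i0 unfolding inter meets_def by blast
    ultimately have "w \<in> cspan [pencil_vec Ms t, pencil_vec Ms t']" by simp
    then obtain a b where "\<And>j. w j = a * pencil_vec Ms t j + b * pencil_vec Ms t' j"
      unfolding cspan2 by blast
    then have "w = (\<lambda>j. a * pencil_vec Ms t j + b * pencil_vec Ms t' j)" by (intro ext)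
    then have "w \<in> Fl Ms j0 2"
      using flag_space_comb[OF pencil_vec_flag[of Ms t] pencil_vec_flag[of Ms t']] by simp
    then show False using separated_notin[OF reg sep i0 _ w(3)] w(2) by blast
  qed
  moreover have "F ` Z = ?I"
  proof (intro equalityI subsetI)
    fix X assume X: "X \<in> ?I"
    have XG: "X \<in> grass2 n" and XR: "\<And>j. j \<in> R \<Longrightarrow> meets X (Fl Ms j (d j))"
      using X unfolding inter by auto
    obtain w where w: "w \<in> X" "w \<in> Fl Ms j0 2" "w \<noteq> (\<lambda>_. 0)"
      using X unfolding inter meets_def by blast
    obtain a b where ab: "w = (\<lambda>j. a * row Ms 0 j + b * row Ms 1 j)"
      using w(2) unfolding flag_space_2 by blast
    \<comment> \<open>If the vector of L in X were a multiple of \<open>row Ms 0\<close>, then X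
      would give a nonzero solution of the system at infinity, against \<open>lead\<close>.\<close>
    have "b \<noteq> 0"
    proof
      assume b: "b = 0"
      then have "a \<noteq> 0" using ab w(3) by auto
      then have "row Ms 0 = (\<lambda>j. (1 / a) * w j + 0 * w j)" using b by (auto simp: ab)
      then have e: "row Ms 0 \<in> X" using grass2_comb[OF XG w(1) w(1), of "1 / a" 0] by simp
      interpret LS0: line_system n R i0 d Ms "row Ms 0"
        by (rule line_systemI[OF reg sep i0 row_0_flag[of Ms] row_0_nonzero[OF reg]])
      obtain v cc where "LS0.ker v" "cc \<in> unk i0" "v cc \<noteq> 0"
        by (rule LS0.kernel_of_plane[OF XG e XR]) auto
      then show False using trivial_kernelD[OF lead] by blast
    qed
    then have "pencil_vec Ms (a / b) = (\<lambda>j. (1 / b) * w j + 0 * w j)"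
      by (auto simp: ab pencil_vec_def field_simps)
    then have y: "pencil_vec Ms (a / b) \<in> X" using grass2_comb[OF XG w(1) w(1), of "1 / b" 0] by simp
    interpret LS: line_system n R i0 d Ms "pencil_vec Ms (a / b)" by (rule LS)
    obtain v cc where "LS.ker v" "cc \<in> unk i0" "v cc \<noteq> 0"
      by (rule LS.kernel_of_plane[OF XG y XR]) auto
    then have t: "a / b \<in> Z" unfolding Z trivial_kernel_def by blast
    have "F (a / b) \<in> grass2 n" "\<And>j. j \<in> R \<Longrightarrow> meets (F (a / b)) (Fl Ms j (d j))"
      using F(1)[OF t] unfolding inter by auto
    then have "X = F (a / b)" using LS.plane_unique[OF one[OF t] XG y XR _ F(2)[OF t]] by blast
    then show "X \<in> F ` Z" using t by blast
  qed (use F in auto)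
  ultimately show thesis using that F(2) by (auto simp: bij_betw_def)
qed

text \<open>At infinity y is (z - s(j0))^(m + 1), and x has contact of total order m + 1 with its
  multiples. By \<open>wronskian_rigidity\<close> x is itself such a multiple, and it vanishes at
  s(i0), so it is 0.\<close>

lemma osculating_lead:
  assumes osc: "osculating s Ms" and sumR: "(\<Sum>j\<in>R. c j) = m + 1" and i0: "i0 \<in> R"
  shows "trivial_kernel (eqs i0) (unk i0) (line_coeff i0 d Ms (row Ms 0))"
  unfolding trivial_kernel_def
proof (intro allI impI ballI)
  note reg = osculating_regular[OF osc]
  have LS: "line_system n R i0 d Ms (row Ms 0)"
    by (rule line_systemI[OF reg osculating_separated[OF osc] i0 row_0_flag[of Ms] row_0_nonzero[OF reg]])
  then interpret LS: line_system n R i0 d Ms "row Ms 0" .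
  fix v cc assume v: "LS.ker v" and cc: "cc \<in> unk i0"
  let ?L = "\<lambda>j. [:- of_real (s j), 1:] :: complex poly"
  let ?F = "vec_poly (m + 1) (line_vec n i0 d Ms v)"
  have dv: "\<exists>\<mu>. (i = i0 \<longrightarrow> \<mu> = 0) \<and> ?L i ^ Suc (c i) dvd ?F - Polynomial.smult \<mu> (?L j0 ^ (m + 1))"
    if "i \<in> R" for i
    using osculating_line_vec_dvd[OF osc LS v that] unfolding osculating_rows(1)[OF osc] .
  have "\<exists>\<kappa>. ?F = Polynomial.smult \<kappa> (?L j0 ^ (m + 1))"
  proof (rule wronskian_rigidity[OF degree_vec_poly finite_R, of "\<lambda>i. of_real (s i)" _ c])
    show "inj_on (\<lambda>i. complex_of_real (s i)) R"
      using osculating_inj[OF osc] by (auto simp: inj_on_def R_def)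
    show "\<exists>\<mu>. ?L i ^ Suc (c i) dvd ?F - Polynomial.smult \<mu> (?L j0 ^ (m + 1))" if "i \<in> R" for i
      using dv[OF that] by blast
  qed (use sumR in auto)
  then obtain \<kappa> where \<kappa>: "?F = Polynomial.smult \<kappa> (?L j0 ^ (m + 1))" by blast
  have "?L i0 ^ Suc (c i0) dvd ?F" using dv[OF i0] by auto
  then have "?L i0 dvd ?F" unfolding power_Suc by (rule dvd_mult_left)
  then have "poly ?F (of_real (s i0)) = 0" by (simp only: poly_eq_0_iff_dvd)
  moreover have "s i0 \<noteq> s j0" using osculating_inj[OF osc, of i0 j0] i0 j0 by (auto simp: R_def)
  ultimately have "\<kappa> = 0" unfolding \<kappa> by simp
  then have "?F = 0" unfolding \<kappa> by simp
  then show "v cc = 0" by (rule osculating_line_vec_zero[OF LS v _ cc])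
qed

lemma osculating_roots:
  assumes osc: "osculating s Ms" and sumR: "(\<Sum>j\<in>R. c j) = m + 1" and i0: "i0 \<in> R"
  obtains T where "finite T" "card T = card R - 1"
    "\<And>t. t \<in> T \<Longrightarrow> t \<in> \<real> \<and> \<not> trivial_kernel (eqs i0) (unk i0)
      (line_coeff i0 d Ms (pencil_vec Ms t))"
proof -
  note reg = osculating_regular[OF osc]
  let ?N = "of_nat (m + 1) :: complex"
  have N0: "?N \<noteq> 0" by (simp del: of_nat_Suc)
  let ?L = "\<lambda>j. [:- of_real (s j), 1:] :: complex poly"
  let ?l = "\<lambda>\<tau>. ?L j0 ^ (m + 1 - 1) - Polynomial.smult (of_real \<tau>) (?L j0 ^ (m + 1))"
  have inj: "inj_on s (insert j0 R)" "j0 \<notin> R"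
    using osculating_inj[OF osc] j0 by (auto simp: inj_on_def R_def)
  obtain T where T: "finite T" "card T = card R - 1"
    "\<And>\<tau>. \<tau> \<in> T \<Longrightarrow> \<exists>G :: complex poly. degree G \<le> m + 1 \<and>
      (\<forall>\<mu>. G \<noteq> Polynomial.smult \<mu> (?l \<tau>)) \<and>
      (\<forall>i\<in>R. \<exists>\<mu>. ?L i ^ Suc (c i) dvd G - Polynomial.smult \<mu> (?l \<tau>))"
    using osculating_pencils[of R s j0 c "m + 1", OF finite_R _ inj sumR] i0 d_c(2) by blast
  \<comment> \<open>The polynomial of \<open>row Ms 1\<close> carries the factor -(m + 1), so the
    critical point \<tau> sits at the pencil parameter (m + 1) \<tau>.\<close>
  let ?t = "\<lambda>\<tau>. ?N * of_real \<tau>"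
  have y: "vec_poly (m + 1) (pencil_vec Ms (?t \<tau>)) = Polynomial.smult (- ?N) (?l \<tau>)" for \<tau>
    unfolding pencil_vec_def vec_poly_comb osculating_rows[OF osc]
    by (rule poly_ext) (simp add: algebra_simps)
  have "\<not> trivial_kernel (eqs i0) (unk i0)
      (line_coeff i0 d Ms (pencil_vec Ms (?t \<tau>)))" if \<tau>: "\<tau> \<in> T" for \<tau>
  proof -
    let ?y = "pencil_vec Ms (?t \<tau>)"
    interpret LS: line_system n R i0 d Ms ?y
      by (rule line_systemI[OF reg osculating_separated[OF osc] i0 pencil_vec_flag pencil_vec_nonzero[OF reg]])
    obtain G :: "complex poly" where G: "degree G \<le> m + 1" "\<And>\<mu>. G \<noteq> Polynomial.smult \<mu> (?l \<tau>)"
      "\<And>i. i \<in> R \<Longrightarrow> \<exists>\<mu>. ?L i ^ Suc (c i) dvd G - Polynomial.smult \<mu> (?l \<tau>)"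
      using T(3)[OF \<tau>] by blast
    obtain x where x: "x \<in> cvec (Suc (m + 1))" "vec_poly (m + 1) x = G" using vec_poly_surj[OF G(1)] by blast
    \<comment> \<open>This vector realises the polynomial G - \<mu> l; the quotient undoes the
      factor -(m + 1) in the polynomial of y.\<close>
    define u where "u \<mu> = (\<lambda>b. 1 * x b + (\<mu> / ?N) * ?y b)" for \<mu>
    have u: "vec_poly (m + 1) (u \<mu>) = G - Polynomial.smult \<mu> (?l \<tau>)" for \<mu>
      unfolding u_def vec_poly_comb x(2) y using N0 by (simp add: algebra_simps del: of_nat_Suc of_nat_add)
    have uc: "u \<mu> \<in> cvec n" for \<mu> using x(1) LS.y by (simp add: u_def cvec_def)
    have un: "u \<mu> \<noteq> (\<lambda>_. 0)" for \<mu>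
    proof
      assume "u \<mu> = (\<lambda>_. 0)"
      then have "G - Polynomial.smult \<mu> (?l \<tau>) = 0" using u[of \<mu>] by (simp add: vec_poly_0)
      then show False using G(2)[of \<mu>] by simp
    qed
    have "\<exists>\<mu>. u \<mu> \<in> Fl Ms i (d i)" if i: "i \<in> R" for i
    proof -
      have "n - d i = Suc (c i)" using d_c(1)[OF i] by simp
      then show ?thesis
        using G(3)[OF i] osculating_flag_iff[OF osc uc] d_le[OF i] unfolding u[symmetric] by auto
    qed
    then obtain \<mu> where \<mu>: "\<And>i. i \<in> R \<Longrightarrow> u (\<mu> i) \<in> Fl Ms i (d i)" by metis
    define X where "X = cspan [u (\<mu> i0), ?y]"
    have ind: "lin_indep [u (\<mu> i0), ?y]" by (rule LS.indep_y[OF i0 \<mu>[OF i0] un])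
    have X: "X \<in> grass2 n" unfolding grass2_def X_def using ind uc LS.y by blast
    have uX: "u (\<mu> i) \<in> X" for i
    proof -
      have "u (\<mu> i) = (\<lambda>b. 1 * u (\<mu> i0) b + ((\<mu> i - \<mu> i0) / ?N) * ?y b)"
        by (simp add: u_def diff_divide_distrib algebra_simps)
      then show ?thesis unfolding X_def cspan2 by (intro exI[of _ 1] exI[of _ "(\<mu> i - \<mu> i0) / ?N"]) (rule allI, rule fun_cong)
    qed
    obtain v cc where "LS.ker v" "cc \<in> unk i0" "v cc \<noteq> 0"
    proof (rule LS.kernel_of_plane[OF X])
      show "?y \<in> X" unfolding X_def by (rule cspan2_right)
      show "meets X (Fl Ms j (d j))" if "j \<in> R" for j
        unfolding meets_def using uX \<mu>[OF that] un by blast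
    qed auto
    then show ?thesis unfolding trivial_kernel_def by blast
  qed
  moreover have "inj_on ?t T" using N0 by (intro inj_onI) (simp del: of_nat_Suc of_nat_add)
  ultimately have ker: "\<And>\<tau>. \<tau> \<in> T \<Longrightarrow> \<not> trivial_kernel (eqs i0) (unk i0)
      (line_coeff i0 d Ms (pencil_vec Ms (?t \<tau>)))" and inj_t: "inj_on ?t T" by blast+
  show thesis
  proof (rule that[of "?t ` T"])
    show "finite (?t ` T)" using T(1) by simp
    show "card (?t ` T) = card R - 1" using card_image[OF inj_t] T(2) by simp
    fix t assume "t \<in> ?t ` T"
    then obtain \<tau> where t: "t = ?t \<tau>" "\<tau> \<in> T" by blast
    have "?t \<tau> \<in> \<real>" by (intro Reals_mult) simp_all
    then show "t \<in> \<real> \<and> \<not> trivial_kernel (eqs i0) (unk i0)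
      (line_coeff i0 d Ms (pencil_vec Ms t))" using ker[OF t(2)] unfolding t(1) by blast
  qed
qed

lemma SG_all_fst_1:
  assumes fst1: "\<And>j. j < length as \<Longrightarrow> fst (as ! j) = 1"
  shows "SG m as"
proof -
  have sumR: "(\<Sum>j\<in>R. c j) = m + 1" using sum_c fst1 by simp
  then have "R \<noteq> {}" by auto
  then obtain i0 where i0: "i0 \<in> R" by blast
  \<comment> \<open>No single \<open>c j\<close> exceeds m, so a total of m + 1 takes at least two
    conditions. Hence r \<ge> 1, as \<open>discriminant_condition\<close> requires.\<close>
  have cardR: "card R \<ge> 2"
  proof (rule ccontr)
    assume "\<not> 2 \<le> card R"
    then have "(\<Sum>j\<in>R. c j) \<le> 1 * m"
      using sum_bounded_above[of R c m] d_c(3) by (metis le_trans mult_le_mono1 not_less_eq_eq numeral_2_eq_2 of_nat_id One_nat_def)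
    then show False using sumR by simp
  qed
  define r where "r = card R - 1"
  define E where "E = eqs i0"
  define C where "C = unk i0"
  \<comment> \<open>The unknowns \<mu>(i). Only their columns contain y, which is row 1 plus t times
    row 0; so the determinant has degree at most card R - 1 in t, and its leading system is the one
    for row 0.\<close>
  define C1 where "C1 = (\<lambda>i. (i, d i)) ` (R - {i0})"
  define A where "A x = line_coeff i0 d (\<lambda>j a b. [:ent n x j a b:])
    (\<lambda>b. [:row (ent n x) 1 b, row (ent n x) 0 b:])" for x
  have fin: "finite E" "finite C"
    unfolding E_def C_def by (simp_all add: finite_line_equations finite_line_unknowns finite_R)
  have cardEC: "card E = card C"
  proof -
    have "card R = Suc r" using cardR by (simp add: r_def)
    then show ?thesis using card_unknowns[OF i0] sumR card_line_equations[OF i0, of n]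
      by (simp add: E_def C_def)
  qed
  have C1: "C1 \<subseteq> C" by (auto simp: C1_def C_def line_unknowns_def)
  have cardC1: "card C1 = r"
    unfolding C1_def r_def using i0 finite_R by (subst card_image) (auto simp: inj_on_def)
  have mem1: "(i, a) \<in> C1 \<longleftrightarrow> i \<in> R \<and> i \<noteq> i0 \<and> a = d i" for i a by (auto simp: C1_def)
  have degA: "degree (A x e cc) \<le> (if cc \<in> C1 then 1 else 0)" if "e \<in> E" "cc \<in> C" for x e cc
    using that by (cases e; cases cc)
      (auto simp: A_def line_coeff_def mem1 E_def C_def line_equations_def line_unknowns_def)
  have pfA: "poly_fun nvars (\<lambda>x. coeff (A x e cc) k)" if e: "e \<in> E" and cc: "cc \<in> C" for e cc k
  proof -
    obtain i b where e': "e = (i, b)" by (cases e)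
    obtain i' a where cc': "cc = (i', a)" by (cases cc)
    have ib: "i \<in> R" "i \<noteq> i0" "b < n" using e e' by (auto simp: E_def line_equations_def)
    then have il: "i < length as" "i0 < length as" "d i \<le> n" "d i0 \<le> n"
      using d_le[of i] d_le[OF i0] i0 by (auto simp: R_def)
    have b1: "a < n" if "i' = i0"
      using cc that il by (auto simp: cc' C_def line_unknowns_def)
    have p1: "poly_fun nvars (\<lambda>x. coeff [:ent n x j a' b:] k)"
      if "j < length as" "a' < n" for j a'
      using that ib by (cases k) (simp_all add: poly_fun_const poly_fun_ent del: add_2_eq_Suc')
    have p2: "poly_fun nvars (\<lambda>x. coeff [:row (ent n x) 1 b, row (ent n x) 0 b:] k)"
    proof (cases k)
      case 0
      then show ?thesis using ib j0 by (simp add: mrow_def poly_fun_ent del: add_2_eq_Suc')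
    next
      case (Suc k')
      then show ?thesis using ib j0
        by (cases k') (simp_all add: mrow_def poly_fun_ent poly_fun_const del: add_2_eq_Suc')
    qed
    show ?thesis
      unfolding A_def line_coeff_def e' cc' fst_conv snd_conv if_distrib[of "\<lambda>p. coeff p k"] coeff_minus coeff_0
      using b1 il ib(3)
      by (intro poly_fun_if poly_fun_uminus p1 p2 poly_fun_const) auto
  qed
  obtain D where D: "\<And>x. degree (D x) \<le> card C1" "\<And>k. poly_fun nvars (\<lambda>x. coeff (D x) k)"
    "\<And>x t. poly (D x) t = 0 \<longleftrightarrow> \<not> trivial_kernel E C (\<lambda>e c. poly (A x e c) t)"
    "\<And>x. coeff (D x) (card C1) = 0 \<longleftrightarrow>
       \<not> trivial_kernel E C (\<lambda>e c. coeff (A x e c) (if c \<in> C1 then 1 else 0))"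
    "\<And>x t v w a b. in_kernel E C (\<lambda>e c. poly (A x e c) t) v \<Longrightarrow> v a = 1 \<Longrightarrow> v b = 0 \<Longrightarrow>
       in_kernel E C (\<lambda>e c. poly (A x e c) t) w \<Longrightarrow> w a = 0 \<Longrightarrow> w b = 1 \<Longrightarrow>
       a \<in> C \<Longrightarrow> b \<in> C \<Longrightarrow> [:-t, 1:] ^ 2 dvd D x"
    by (rule linear_pencil[where A = A and N = "nvars", OF fin cardEC C1 degA pfA]) auto
  have evalA: "poly (A x e cc) t = line_coeff i0 d (ent n x) (pencil_vec (ent n x) t) e cc" for x e cc t
    by (simp add: A_def line_coeff_def pencil_vec_def)
  have leadA: "coeff (A x e cc) (if cc \<in> C1 then 1 else 0) =
      line_coeff i0 d (ent n x) (row (ent n x) 0) e cc" if "e \<in> E" "cc \<in> C" for x e cc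
    using that by (cases e; cases cc)
      (auto simp: A_def line_coeff_def mem1 E_def C_def line_equations_def line_unknowns_def)
  have root: "poly (D x) t = 0 \<longleftrightarrow>
      \<not> trivial_kernel E C (line_coeff i0 d (ent n x) (pencil_vec (ent n x) t))" for x t
    unfolding D(3) evalA ..
  have lead: "coeff (D x) r = 0 \<longleftrightarrow>
      \<not> trivial_kernel E C (line_coeff i0 d (ent n x) (row (ent n x) 0))" for x
  proof -
    have "trivial_kernel E C (\<lambda>e c. coeff (A x e c) (if c \<in> C1 then 1 else 0)) \<longleftrightarrow>
        trivial_kernel E C (line_coeff i0 d (ent n x) (row (ent n x) 0))"
      by (rule trivial_kernel_cong) (rule leadA)
    then show ?thesis using D(4)[of x] unfolding cardC1 by blast
  qed
  have "\<exists>G. poly_fun nvars G \<and> (\<forall>x. coeff (D x) r \<noteq> 0 \<longrightarrow> (G x \<noteq> 0 \<longleftrightarrow> rsquarefree (D x)))"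
  proof (rule discriminant_condition[of D r "nvars"])
    show "degree (D x) \<le> r" for x using D(1)[of x] cardC1 by simp
    show "r \<ge> 1" using cardR by (simp add: r_def)
    fix G assume "poly_fun nvars G"
      "\<And>x. coeff (D x) r \<noteq> 0 \<Longrightarrow> G x \<noteq> 0 \<longleftrightarrow> rsquarefree (D x)"
    then show ?thesis by (intro exI[of _ G]) blast
  qed (rule D(2))
  then obtain G where G: "poly_fun nvars G"
    "\<And>x. coeff (D x) r \<noteq> 0 \<Longrightarrow> G x \<noteq> 0 \<longleftrightarrow> rsquarefree (D x)" by blast
  obtain gs where gs: "poly_fun nvars gs" "\<And>x. gs x = 0 \<longleftrightarrow> \<not> separated (ent n x)"
    using separated_condition by blast
  \<comment> \<open>Nonvanishing means: the flags are separated, there is no solution at infinity,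
    and the determinant has r distinct roots.\<close>
  define g where "g x = gs x * (coeff (D x) r * G x)" for x
  have pg: "poly_fun nvars g"
    unfolding g_def by (intro poly_fun_mult gs(1) D(2) G(1))
  have degD: "degree (D x) = r" "D x \<noteq> 0" if "coeff (D x) r \<noteq> 0" for x
    using D(1)[of x] le_degree[OF that] that cardC1 by auto
  have core: "\<exists>F. bij_betw F {t. poly (D x) t = 0} (inter (ent n x)) \<and>
      card {t. poly (D x) t = 0} = r \<and>
      (\<forall>t. poly (D x) t = 0 \<longrightarrow> pencil_vec (ent n x) t \<in> F t \<and>
        line_system.one_dim_ker n R i0 d (ent n x) (pencil_vec (ent n x) t))"
    if reg: "regular (ent n x)" and gx: "g x \<noteq> 0" for x
  proof -
    have sep: "separated (ent n x)" and l0: "coeff (D x) r \<noteq> 0" and G0: "G x \<noteq> 0"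
      using gx gs(2)[of x] by (auto simp: g_def)
    have sf: "rsquarefree (D x)" using G(2)[OF l0] G0 by blast
    have cardZ: "card {t. poly (D x) t = 0} = r"
      using rsquarefree_card_degree[OF degD(2)[OF l0]] sf degD(1)[OF l0] by simp
    have one: "line_system.one_dim_ker n R i0 d (ent n x) (pencil_vec (ent n x) t)"
      if t: "poly (D x) t = 0" for t
    proof -
      interpret LS: line_system n R i0 d "ent n x" "pencil_vec (ent n x) t"
        by (rule line_systemI[OF reg sep i0 pencil_vec_flag pencil_vec_nonzero[OF reg]])
      show ?thesis
        unfolding LS.one_dim_ker_def
      proof (intro allI impI, rule ccontr)
        fix v w cc assume v: "LS.ker v" and w: "LS.ker w" and cc: "cc \<in> unk i0" "v cc \<noteq> 0"
          and no: "\<nexists>\<kappa>. \<forall>c\<in>unk i0. w c = \<kappa> * v c"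
        obtain v' w' b where n: "LS.ker v'" "v' cc = 1" "v' b = 0" "LS.ker w'" "w' cc = 0" "w' b = 1"
          "b \<in> unk i0"
          by (rule kernel_two_dim_normal_form[OF v w cc no])
        \<comment> \<open>A kernel of dimension two would make \<open>t\<close> a double root,
          against squarefreeness.\<close>
        have "[:- t, 1:] ^ 2 dvd D x"
          by (rule D(5)[of x t v' cc b w']) (use n cc in \<open>simp_all only: evalA E_def C_def\<close>)
        then have "[:- t, 1:] ^ Suc 1 dvd D x" by (simp only: numeral_2_eq_2 One_nat_def)
        then have "[:- t, 1:] ^ 1 dvd pderiv (D x)" by (rule power_dvd_pderiv)
        then have "poly (pderiv (D x)) t = 0" by (simp only: power_one_right poly_eq_0_iff_dvd)
        then show False using sf t unfolding rsquarefree_roots by blast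
      qed
    qed
    have lead': "trivial_kernel E C (line_coeff i0 d (ent n x) (row (ent n x) 0))" using lead l0 by blast
    obtain F where "bij_betw F {t. poly (D x) t = 0} (inter (ent n x))"
      "\<And>t. t \<in> {t. poly (D x) t = 0} \<Longrightarrow> pencil_vec (ent n x) t \<in> F t"
    proof (rule pencil_count[OF reg sep fst1 i0 lead'[unfolded E_def C_def], of "{t. poly (D x) t = 0}"])
      show "t \<in> {t. poly (D x) t = 0} \<longleftrightarrow> \<not> trivial_kernel (eqs i0) (unk i0)
          (line_coeff i0 d (ent n x) (pencil_vec (ent n x) t))" for t
        using root[of x t] by (simp only: E_def C_def mem_Collect_eq)
    qed (use one in auto)
    then show ?thesis using cardZ one by (intro exI[of _ F]) simp
  qed
  have osc_ok: "g x \<noteq> 0 \<and> {t. poly (D x) t = 0} \<subseteq> \<real>" if osc: "osculating s (ent n x)" for s x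
  proof -
    have sep: "separated (ent n x)" by (rule osculating_separated[OF osc])
    have l0: "coeff (D x) r \<noteq> 0"
      using lead osculating_lead[OF osc sumR i0] by (simp only: E_def C_def) blast
    obtain T where T: "finite T" "card T = card R - 1"
      "\<And>t. t \<in> T \<Longrightarrow> t \<in> \<real> \<and> \<not> trivial_kernel (eqs i0) (unk i0)
        (line_coeff i0 d (ent n x) (pencil_vec (ent n x) t))"
      by (rule osculating_roots[OF osc sumR i0]) blast
    have sub: "T \<subseteq> {t. poly (D x) t = 0}"
      using T(3) root[of x] by (auto simp: E_def C_def)
    have finZ: "finite {t. poly (D x) t = 0}" by (rule poly_roots_finite[OF degD(2)[OF l0]])
    \<comment> \<open>The real roots obtained from Rolle's theorem already exhaust the degree r; so
      the roots are simple, and there are no others.\<close>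
    have "r \<le> card {t. poly (D x) t = 0}" using card_mono[OF finZ sub] T(2) by (simp add: r_def)
    moreover have "card {t. poly (D x) t = 0} \<le> r"
      using card_poly_roots_bound[OF degD(2)[OF l0]] degD(1)[OF l0] by simp
    ultimately have cardZ: "card {t. poly (D x) t = 0} = r" by simp
    then have "rsquarefree (D x)" using rsquarefree_card_degree[OF degD(2)[OF l0]] degD(1)[OF l0] by simp
    then have "G x \<noteq> 0" using G(2)[OF l0] by blast
    moreover have "{t. poly (D x) t = 0} = T"
      using card_subset_eq[OF finZ sub] cardZ T(2) by (simp add: r_def)
    ultimately show ?thesis using T(3) l0 sep gs(2) by (auto simp: g_def)
  qed
  show ?thesis
  proof (rule SG_from_generic_condition[where g = g and c = r, OF cond pg])
    fix Ms x assume Ms: "Ms = ent n x" "\<And>j. j < length as \<Longrightarrow> Defs.invertible_mat n (Ms j)"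
      and gx: "g x \<noteq> 0"
    then have "regular (ent n x)" by (simp add: regular_def)
    then obtain F where F: "bij_betw F {t. poly (D x) t = 0} (inter (ent n x))"
      "card {t. poly (D x) t = 0} = r"
      using core gx by blast
    moreover have "finite {t. poly (D x) t = 0}"
      using gx by (intro poly_roots_finite degD(2)) (auto simp: g_def)
    ultimately show "finite (inter Ms) \<and> card (inter Ms) = r"
      unfolding Ms(1) using bij_betw_finite bij_betw_same_card by metis
  next
    fix s Ms x assume "inj_on s {..<length as}" and Ms: "Ms = ent n x"
      and "\<And>j a b. a < n \<Longrightarrow> b < n \<Longrightarrow> Ms j a b = osc_mat (s j) a b" and real: "\<And>j a b. Ms j a b \<in> \<real>"
    then have osc: "osculating s (ent n x)" by (auto simp: osculating_def)
    note reg = osculating_regular[OF osc]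
    have gx: "g x \<noteq> 0" and Zr: "{t. poly (D x) t = 0} \<subseteq> \<real>" using osc_ok[OF osc] by auto
    obtain F where F: "bij_betw F {t. poly (D x) t = 0} (inter (ent n x))"
      "\<And>t. poly (D x) t = 0 \<Longrightarrow> pencil_vec (ent n x) t \<in> F t"
      "\<And>t. poly (D x) t = 0 \<Longrightarrow> line_system.one_dim_ker n R i0 d (ent n x) (pencil_vec (ent n x) t)"
      using core[OF reg gx] by blast
    have "real_point X" if X: "X \<in> inter (ent n x)" for X
    proof -
      obtain t where t: "poly (D x) t = 0" "X = F t" using F(1) X by (auto simp: bij_betw_def)
      interpret LS: line_system n R i0 d "ent n x" "pencil_vec (ent n x) t"
        by (rule line_systemI[OF reg osculating_separated[OF osc] i0 pencil_vec_flag pencil_vec_nonzero[OF reg]])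
      have "t \<in> \<real>" using t(1) Zr by auto
      then have "pencil_vec (ent n x) t b \<in> \<real>" for b
        using real unfolding Ms by (simp add: pencil_vec_def mrow_def)
      moreover have "X \<in> grass2 n" "\<And>j. j \<in> R \<Longrightarrow> meets X (Fl (ent n x) j (d j))"
        using X unfolding inter_iff[OF reg] by auto
      moreover have "pencil_vec (ent n x) t \<in> X" using F(2)[OF t(1)] t(2) by simp
      moreover have "ent n x j a b \<in> \<real>" for j a b using real unfolding Ms .
      ultimately show ?thesis using LS.plane_real[OF F(3)[OF t(1)]] by blast
    qed
    then show "g x \<noteq> 0 \<and> (\<forall>X\<in>inter Ms. real_point X)" using gx Ms by blast
  qed
qed

end

section \<open>Case distinction on the containment conditions\<close>

theorem mainTheorem7:
  fixes m :: nat and as :: "(nat \<times> nat) list"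
  assumes "m \<ge> 2"
    and "pieri_data m as"
    and "(1, m + 1) \<in> set as"
  shows "SG m as"
proof -
  obtain j0 where j0: "j0 < length as" "as ! j0 = (1, m + 1)"
    using assms(3) by (auto simp: in_set_conv_nth)
  have data: "schubert_data m as" using assms(2) by (simp add: pieri_data_def)
  interpret schubert_problem m as j0
  proof
    show "schubert_cond (m + 2) (as ! j)" if "j < length as" for j
      using data that by (simp add: schubert_data_def)
    have "(\<Sum>a\<leftarrow>as. cond_size a) = (\<Sum>j<length as. cond_size (as ! j))"
      by (simp add: sum_list_sum_nth atLeast0LessThan)
    then show "(\<Sum>j<length as. cond_size (as ! j)) = 2 * m" using data by (simp add: schubert_data_def)
  qed (use assms j0 in auto)
  show ?thesis
  \<comment> \<open>A condition with first entry a confines the plane to a space of codimension a -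
    1; two entries at least 2, or one at least 3, therefore amount to codimension at least 2 for
    osculating flags.\<close>
  proof (cases "\<exists>i<length as. fst (as ! i) \<ge> 2")
    case False
    have "fst (as ! j) = 1" if "j < length as" for j
      using False condD(1)[OF that] that by (metis One_nat_def Suc_1 le_antisym not_less_eq_eq)
    then show ?thesis by (rule SG_all_fst_1)
  next
    case True
    then obtain i where i: "i < length as" "fst (as ! i) \<ge> 2" by blast
    show ?thesis
    proof (cases "\<exists>j<length as. j \<noteq> i \<and> fst (as ! j) \<ge> 2")
      case True
      then show ?thesis using SG_two_fst_ge_2[OF i] by blast
    next
      case False
      have others: "fst (as ! j) = 1" if "j < length as" "j \<noteq> i" for j
        using False condD(1)[OF that(1)] that by (metis One_nat_def Suc_1 le_antisym not_less_eq_eq)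
      show ?thesis
      proof (cases "fst (as ! i) = 2")
        case True
        then show ?thesis using SG_one_fst_2[OF i(1) _ others] by blast
      next
        case False
        then have "fst (as ! i) \<ge> 3" using i(2) by simp
        then show ?thesis by (rule SG_fst_ge_3[OF i(1)])
      qed
    qed
  qed
qed

end
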